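(* Suppose there exist $R_2,R_3\in(0,\infty)$, constants $a_6,a_7,a_8,a_9>0$ and $2>\alpha_4\ge\alpha_3>0$ such that $$a_6\Big(\frac Rr\Big)^{1+\alpha_3}\le\frac{\nu(r)}{\nu(R)}\le a_7\Big(\frac Rr\Big)^{1+\alpha_4}\quad\text{for all }R_2\le r\le R<\infty,\qquad \frac{\nu(r)}{\nu(R)}\ge a_8\Big(\frac Rr\Big)^{-a_9}\quad\text{for all }0<r\le R<R_3.$$ Then there exist constants $T_1>T_0$ and $c_1>1$ such that $$c_1^{-1}\big(H^{-1}(1/t)\wedge t\nu(y)\big)\le p(t,tb(t)+y)\le c_1\big(H^{-1}(1/t)\wedge t\nu(y)\big)\quad( * )$$ holds for all $t\in[T_1,\infty)$ and $y\in[0,\infty)$, and, for a constant $c_2>1$, $$c_2^{-1}\min\Big\{H^{-1}(1/t)\exp(-2tH(\sigma)),\,t\nu\big((x-tb(t))_+\big)\Big\}\le p(t,x)\le c_2\min\Big\{H^{-1}(1/t)\exp\big(-\tfrac t2H(\sigma)\big),\,t\nu\big((x-tb(t))_+\big)\Big\}\quad( ** )$$ holds for all $t\in[T_1,\infty)$ and $x\in[tb(T_1),\infty)$. Moreover, if $T_0=0$, then for every $T>0$ there are constants $c_1,c_2>1$ such that $( * )$ holds for all $t\in[T,\infty)$ and $y\in[0,\infty)$, and $( ** )$ holds for all $t\in[T,\infty)$ and $x\in[tb(T),\infty)$.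
   Context: $S=(S_t)_{t\ge0}$ is a subordinator (non-decreasing Lévy process on $\mathbb R$ with $S_0=0$) without drift. Its Laplace exponent $\phi$ is given by $\mathbb E e^{-\lambda S_t}=e^{-t\phi(\lambda)}$ and $\phi(\lambda)=\int_0^\infty(1-e^{-\lambda s})\nu(s)\,ds$, where the Lévy measure has a density $\nu:(0,\infty)\to[0,\infty)$ with $\int_0^\infty\min\{1,s\}\nu(s)ds<\infty$. (Inequalities on quotients of $\nu$ presuppose $\nu>0$ on the stated range.) Standing assumption: there is $T_0\in[0,\infty)$ with $\liminf_{x\to0}x\nu(x)=1/T_0$, where $1/0=\infty$. For $t>T_0$, $S_t$ has a transition density $p(t,\cdot)$, continuous and bounded on $(0,\infty)$. Notation: $H(\lambda)=\phi(\lambda)-\lambda\phi'(\lambda)$, $H(0)=0$, a strictly increasing bijection of $(0,\infty)$ with inverse $H^{-1}$; $b(t)=\phi'(H^{-1}(1/t))$; $\phi'(0)=\lim_{\lambda\downarrow0}\phi'(\lambda)\in(0,\infty]$; $\sigma=\sigma(t,x)=(\phi')^{-1}(x/t)$ for $t>0$, $0<x<t\phi'(0)$, and $\sigma=0$ for $x\ge t\phi'(0)$. $a\wedge b=\min\{a,b\}$, $z_+=\max\{z,0\}$. Convention: $\nu(0)=\infty$.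
   Formalization: If R_3 ≤ R_2, it is additionally assumed that ν is bounded below by some ε>0 on (0,R_2]; otherwise ν may vanish on [R_3,R_2), where the upper bound in ( * ) fails since p>0, and ( * ) itself forces this bound. *)

theory Defs
  imports "HOL-Probability.Probability"
begin

(* No separate clause for stochastic continuity: almost surely cadlag paths together with
   stationary increments imply it. *)
definition levy_process :: "'a measure \<Rightarrow> (real \<Rightarrow> 'a \<Rightarrow> real) \<Rightarrow> bool" where
  "levy_process M S \<longleftrightarrow>
     prob_space M \<and>
     (\<forall>t\<ge>0. S t \<in> borel_measurable M) \<and>
     (AE \<omega> in M. S 0 \<omega> = 0) \<and>
     (\<forall>n (t :: nat \<Rightarrow> real). 0 \<le> t 0 \<and> incseq t \<longrightarrow>
        prob_space.indep_vars M (\<lambda>_. borel) (\<lambda>k \<omega>. S (t (Suc k)) \<omega> - S (t k) \<omega>) {..<n}) \<and>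
     (\<forall>s\<ge>0. \<forall>h\<ge>0. distr M borel (\<lambda>\<omega>. S (s + h) \<omega> - S s \<omega>) = distr M borel (S h)) \<and>
     (AE \<omega> in M.
        (\<forall>t\<ge>0. ((\<lambda>s. S s \<omega>) \<longlongrightarrow> S t \<omega>) (at_right t)) \<and>
        (\<forall>t>0. \<exists>l. ((\<lambda>s. S s \<omega>) \<longlongrightarrow> l) (at_left t)))"

definition subordinator :: "'a measure \<Rightarrow> (real \<Rightarrow> 'a \<Rightarrow> real) \<Rightarrow> bool" where
  "subordinator M S \<longleftrightarrow> levy_process M S \<and> (AE \<omega> in M. mono_on {0..} (\<lambda>t. S t \<omega>))"

definition levy_density :: "(real \<Rightarrow> real) \<Rightarrow> bool" where
  "levy_density \<nu> \<longleftrightarrow>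
     set_borel_measurable borel {0<..} \<nu> \<and> (\<forall>s>0. 0 \<le> \<nu> s) \<and>
     set_integrable lborel {0<..} (\<lambda>s. min 1 s * \<nu> s)"

(* The Laplace exponent phi of the driftless subordinator with Levy density nu.  It and the
   functions derived from it below are only meaningful for nonnegative arguments; values of nu
   outside (0,infinity) are irrelevant. *)
definition laplace_exponent :: "(real \<Rightarrow> real) \<Rightarrow> real \<Rightarrow> real" where
  "laplace_exponent \<nu> u = (LINT s:{0<..}|lborel. (1 - exp (- u * s)) * \<nu> s)"

definition driftless_subordinator ::
    "'a measure \<Rightarrow> (real \<Rightarrow> 'a \<Rightarrow> real) \<Rightarrow> (real \<Rightarrow> real) \<Rightarrow> bool" where
  "driftless_subordinator M S \<nu> \<longleftrightarrow>
     subordinator M S \<and> levy_density \<nu> \<and>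
     (\<forall>t\<ge>0. \<forall>u\<ge>0. (LINT \<omega>|M. exp (- u * S t \<omega>)) = exp (- t * laplace_exponent \<nu> u))"

(* f is the version of the density of X on (0,infinity) that is continuous and bounded there;
   the indicator says that X is almost surely positive and leaves f unconstrained elsewhere. *)
definition continuous_bounded_density :: "'a measure \<Rightarrow> ('a \<Rightarrow> real) \<Rightarrow> (real \<Rightarrow> real) \<Rightarrow> bool" where
  "continuous_bounded_density M X f \<longleftrightarrow>
     (\<forall>x>0. 0 \<le> f x) \<and> continuous_on {0<..} f \<and> bounded (f ` {0<..}) \<and>
     distributed M lborel X (\<lambda>x. ennreal (indicator {0<..} x * f x))"

definition phi_deriv :: "(real \<Rightarrow> real) \<Rightarrow> real \<Rightarrow> real" where
  "phi_deriv \<nu> = deriv (laplace_exponent \<nu>)"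

definition phi_deriv0 :: "(real \<Rightarrow> real) \<Rightarrow> ereal" where
  "phi_deriv0 \<nu> = Lim (at_right 0) (\<lambda>u. ereal (phi_deriv \<nu> u))"

definition H_phi :: "(real \<Rightarrow> real) \<Rightarrow> real \<Rightarrow> real" where
  "H_phi \<nu> u = (if u = 0 then 0 else laplace_exponent \<nu> u - u * phi_deriv \<nu> u)"

definition H_phi_inv :: "(real \<Rightarrow> real) \<Rightarrow> real \<Rightarrow> real" where
  "H_phi_inv \<nu> = the_inv_into {0<..} (H_phi \<nu>)"

definition b_phi :: "(real \<Rightarrow> real) \<Rightarrow> real \<Rightarrow> real" where
  "b_phi \<nu> t = phi_deriv \<nu> (H_phi_inv \<nu> (1 / t))"

definition sigma_phi :: "(real \<Rightarrow> real) \<Rightarrow> real \<Rightarrow> real \<Rightarrow> real" where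
  "sigma_phi \<nu> t x =
     (if ereal x < ereal t * phi_deriv0 \<nu> then the_inv_into {0<..} (phi_deriv \<nu>) (x / t) else 0)"

(* nu with the convention nu(0) = infinity *)
definition nu_ext :: "(real \<Rightarrow> real) \<Rightarrow> real \<Rightarrow> ereal" where
  "nu_ext \<nu> y = (if y = 0 then \<infinity> else ereal (\<nu> y))"

end

theory Submission
  imports Defs "HOL-Complex_Analysis.Complex_Analysis"
begin

text \<open>
  Parametrise time by \<open>l = H_phi_inv \<nu> (1 / t)\<close>, so that \<open>t = 1 / H l\<close> and \<open>1 / l\<close> is the spatial scale of \<open>S t\<close>.
  A law is determined by its Levy measure through its Laplace transform; hence, for every \<open>a\<close>, the law of \<open>S t\<close>
  is the convolution of a law with jumps at most \<open>a\<close>, which has all exponential moments, and a compound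
  Poisson law carrying the jumps beyond \<open>a\<close>.

  Lower bounds come from exactly one jump beyond \<open>a\<close>, the small jumps being concentrated near their mean by
  Chernoff's bound. To the left of \<open>t * b_phi \<nu> t\<close> the same argument is applied to the exponentially tilted law.

  For the upper bounds, Levy's inversion formula gives \<open>p t \<le> C l\<close>: the singularity of \<open>\<nu>\<close> at 0 makes the
  characteristic function integrable once \<open>t\<close> is large (for every \<open>t > 0\<close> if \<open>T\<^sub>0 = 0\<close>). Since
  \<open>S t\<close> is a sum of two independent copies of \<open>S (t / 2)\<close>, one of which lies below (above) half the total, this
  bound at time \<open>t / 2\<close> times a Chernoff bound gives the left tail with exponent \<open>t / 2\<close>. On the right, either a single jump
  beyond a small multiple of \<open>y\<close> occurs, which costs \<open>t * \<nu> y\<close>, or many smaller ones conspire, which is much less likely.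
\<close>

section \<open>Laws with a given Levy measure\<close>

text \<open>All estimates are uniform in \<open>0 < l \<le> \<Lambda>\<close> with
  \<open>H \<Lambda> = 1 / T\<close>, hence in all times from \<open>T\<close> on. The obstacle is
  that below \<open>R2\<close> almost nothing is known about \<nu>: it is at least
  \<open>c0 / s\<close> near 0 and has a positive floor \<open>\<epsilon>\<close>, but it obeys no
  upper power bound. Power bounds therefore start at \<open>R2\<close> for \<nu>, and for
  \<open>H\<close> they are first proved up to \<open>1 / R2\<close>; the scales between
  \<open>1 / R2\<close> and \<Lambda> are bridged by the monotonicity of \<open>H\<close> and by
  \<open>H (k * u) \<le> k^2 * H u\<close>, with constants depending on \<Lambda>. The requirement
  \<open>8 \<le> c0 * T\<close> comes from the inversion formula at half the time. For large
  frequencies \<xi> the real part of the characteristic exponent is only known to exceed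
  \<open>c0 * (ln (\<xi> * \<delta>) - 1)\<close>. One half of the exponent is spent on the decay
  \<open>\<xi>^(-2)\<close>, which makes the integral finite and needs the 8; the other half is
  traded for a factor \<open>l^2\<close>, without which the integral would not be of order
  \<open>l\<close>. Estimates bound the mass of an interval by a multiple of its length; continuity
  of the density turns them into pointwise bounds.\<close>

lemma has_field_derivative_integral:
  fixes f :: "'b::{real_normed_field, banach, second_countable_topology} \<Rightarrow> 'a \<Rightarrow> 'b"
  assumes U: "open U" "convex U" "z \<in> U"
    and int: "\<And>w. w \<in> U \<Longrightarrow> integrable M (f w)"
    and der: "AE x in M. \<forall>w\<in>U. ((\<lambda>w. f w x) has_field_derivative f' w x) (at w)"
    and bound: "AE x in M. \<forall>w\<in>U. norm (f' w x) \<le> g x"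
    and g: "integrable M g"
    and f': "f' z \<in> borel_measurable M"
  shows "((\<lambda>w. \<integral>x. f w x \<partial>M) has_field_derivative (\<integral>x. f' z x \<partial>M)) (at z)"
  unfolding has_field_derivative_iff tendsto_at_iff_sequentially comp_def
proof (intro allI impI)
  fix X :: "nat \<Rightarrow> 'b" assume X: "\<forall>i. X i \<in> UNIV - {z}" and "X \<longlonglongrightarrow> z"
  then have "eventually (\<lambda>n. X n \<in> U) sequentially"
    using U by (auto dest: topological_tendstoD)
  then obtain k where k: "\<And>n. n \<ge> k \<Longrightarrow> X n \<in> U"
    by (auto simp: eventually_sequentially)
  define Y where "Y n = X (n + k)" for n
  have Y: "Y n \<in> U" "Y n \<noteq> z" for n using k X by (auto simp: Y_def)
  have Ylim: "Y \<longlonglongrightarrow> z" using \<open>X \<longlonglongrightarrow> z\<close> unfolding Y_def by (rule LIMSEQ_ignore_initial_segment)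
  have "(\<lambda>n. \<integral>x. (f (Y n) x - f z x) / (Y n - z) \<partial>M) \<longlonglongrightarrow> (\<integral>x. f' z x \<partial>M)"
  proof (rule integral_dominated_convergence[where w = g])
    show "AE x in M. (\<lambda>n. (f (Y n) x - f z x) / (Y n - z)) \<longlonglongrightarrow> f' z x"
      using der
    proof eventually_elim
      case (elim x)
      then have "((\<lambda>w. (f w x - f z x) / (w - z)) \<longlongrightarrow> f' z x) (at z)"
        using U(3) by (auto simp: has_field_derivative_iff)
      then show ?case using Ylim Y unfolding tendsto_at_iff_sequentially comp_def by auto
    qed
    show "AE x in M. norm ((f (Y n) x - f z x) / (Y n - z)) \<le> g x" for n
      using der bound
    proof eventually_elim
      case (elim x)
      \<comment> \<open>Mean value inequality on the convex set \<open>U\<close>: a bound for the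
        derivative also dominates the difference quotients.\<close>
      have "norm (f (Y n) x - f z x) \<le> g x * norm (Y n - z)"
        by (rule field_differentiable_bound[OF U(2), where f = "\<lambda>w. f w x" and f' = "\<lambda>w. f' w x"])
           (use elim Y U in \<open>auto intro: has_field_derivative_at_within\<close>)
      then show ?case using Y[of n] by (simp add: norm_divide divide_simps)
    qed
  qed (use f' g int Y U in \<open>auto intro!: borel_measurable_divide borel_measurable_diff borel_measurable_integrable\<close>)
  also have "(\<lambda>n. \<integral>x. (f (Y n) x - f z x) / (Y n - z) \<partial>M)
      = (\<lambda>n. ((\<integral>x. f (Y n) x \<partial>M) - (\<integral>x. f z x \<partial>M)) / (Y n - z))"
    using int Y U by (auto simp: Bochner_Integration.integral_diff)
  finally show "(\<lambda>n. ((\<integral>x. f (X n) x \<partial>M) - (\<integral>x. f z x \<partial>M)) / (X n - z)) \<longlonglongrightarrow> (\<integral>x. f' z x \<partial>M)"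
    unfolding Y_def by (rule LIMSEQ_offset)
qed

text \<open>Mean value inequality on the closed right half-plane, where the derivative of
  \<open>exp (- w)\<close> has modulus at most 1.\<close>

lemma norm_one_minus_exp_le:
  fixes w :: complex
  assumes "0 \<le> Re w"
  shows "norm (1 - exp (- w)) \<le> norm w"
proof -
  have "norm (exp (- 0) - exp (- w)) \<le> 1 * norm (0 - w)"
    by (rule field_differentiable_bound[OF convex_halfspace_Re_ge[of 0], where f' = "\<lambda>w. - exp (- w)"])
       (use assms in \<open>auto intro!: derivative_eq_intros\<close>)
  then show ?thesis by simp
qed

lemma mult_exp_neg_le: "x * exp (- e * x) \<le> 1 / e" if "0 < e" for x e :: real
proof -
  have "e * x \<le> exp (e * x)" using exp_ge_add_one_self[of "e * x"] by linarith
  then have "e * x * exp (- (e * x)) \<le> 1" by (simp add: exp_minus divide_simps)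
  then show ?thesis using that by (simp add: field_simps)
qed

section \<open>From the Laplace transform to the characteristic function\<close>

locale levy_measure =
  fixes N :: "real measure"
  assumes sets_N [simp, measurable_cong]: "sets N = sets borel"
    and AE_pos: "AE s in N. 0 < s"
    and integrable_min: "integrable N (\<lambda>s. min 1 s)"

text \<open>The Levy-Khintchine representation of a law on the half-line without drift, encoded by
  its Laplace exponent at real arguments only. That this determines the law is proved below.\<close>

definition laplace_law :: "real measure \<Rightarrow> real measure \<Rightarrow> bool" where
  "laplace_law N \<mu> \<longleftrightarrow> real_distribution \<mu> \<and> (AE x in \<mu>. 0 \<le> x) \<and>
     (\<forall>u\<ge>0. (LINT x|\<mu>. exp (- u * x)) = exp (- (LINT s|N. 1 - exp (- u * s))))"

context levy_measure
begin

lemma integrable_one_minus_cexp: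
  fixes z :: complex
  assumes "0 \<le> Re z"
  shows "integrable N (\<lambda>s. 1 - exp (- z * s))"
proof (rule Bochner_Integration.integrable_bound)
  show "integrable N (\<lambda>s. (2 + norm z) * min 1 s)" using integrable_min by simp
  show "AE s in N. norm (1 - exp (- z * s)) \<le> norm ((2 + norm z) * min 1 s)"
    using AE_pos
  proof eventually_elim
    case (elim s)
    have "norm (1 - exp (- (z * s))) \<le> norm z * s"
      using norm_one_minus_exp_le[of "z * s"] assms elim by (simp add: norm_mult)
    moreover have "norm (1 - exp (- (z * s))) \<le> 2"
    proof -
      have "exp (- (Re z * s)) \<le> 1" using assms elim by simp
      then have "norm (exp (- (z * s))) \<le> 1" by simp
      then show ?thesis using norm_triangle_ineq4[of 1 "exp (- (z * s))"] unfolding norm_one by linarith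
    qed
    ultimately have "norm (1 - exp (- (z * s))) \<le> (2 + norm z) * min 1 s"
      using elim by (cases "s \<le> 1") (auto simp: min_def algebra_simps intro: order_trans add_increasing)
    then show ?case using elim by (simp add: abs_mult)
  qed
qed measurable

lemma integrable_one_minus_exp: "integrable N (\<lambda>s. 1 - exp (- u * s))" if "0 \<le> u" for u :: real
proof -
  have "integrable N (\<lambda>s. Re (1 - exp (- complex_of_real u * s)))"
    by (rule integrable_Re, rule integrable_one_minus_cexp) (use that in simp)
  then show ?thesis by (simp add: Re_exp)
qed

lemma integrable_mult_exp: "integrable N (\<lambda>s. s * exp (- e * s))" if "0 < e"
proof (rule Bochner_Integration.integrable_bound)
  show "integrable N (\<lambda>s. (1 + 1 / e) * min 1 s)" using integrable_min by simp
  show "AE s in N. norm (s * exp (- e * s)) \<le> norm ((1 + 1 / e) * min 1 s)"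
    using AE_pos
  proof eventually_elim
    case (elim s)
    have "s * exp (- (e * s)) \<le> s * 1" using elim that by (intro mult_left_mono) auto
    moreover have "s * exp (- (e * s)) \<le> 1 / e" using mult_exp_neg_le[OF that, of s] by simp
    moreover have "1 * s \<le> (1 + 1 / e) * s" using elim that by (intro mult_right_mono) auto
    moreover have "s * exp (- (e * s)) \<le> (1 + 1 / e) * min 1 s"
    proof (cases "s \<le> 1")
      case True
      then have "min 1 s = s" by simp
      with calculation show ?thesis by (metis mult_1 mult.commute order_trans)
    next
      case False
      with calculation show ?thesis by simp
    qed
    ultimately show ?case using elim that by (simp add: abs_mult)
  qed
qed measurable

text \<open>Both sides are holomorphic on the open right half-plane, by differentiation under the
  integral sign, and agree on the positive reals; the identity theorem does the rest.\<close>

lemma laplace_law_complex: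
  assumes law: "laplace_law N \<mu>" and z: "0 < Re z"
  shows "(CLINT x|\<mu>. exp (- z * x)) = exp (- (CLINT s|N. 1 - exp (- z * s)))"
proof -
  interpret real_distribution \<mu> using law by (simp add: laplace_law_def)
  have nonneg: "AE x in \<mu>. 0 \<le> x" using law by (simp add: laplace_law_def)
  define F where "F z = (CLINT x|\<mu>. exp (- z * x))" for z :: complex
  define \<Phi> where "\<Phi> z = (CLINT s|N. 1 - exp (- z * s))" for z :: complex
  have intF: "integrable \<mu> (\<lambda>x. exp (- w * complex_of_real x))" if "0 < Re w" for w
    by (rule integrable_const_bound[where B = 1]) (use nonneg that in \<open>auto elim!: eventually_mono\<close>)
  have dF: "(F has_field_derivative (CLINT x|\<mu>. - complex_of_real x * exp (- w * x))) (at w)" if w: "0 < Re w" for w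
    unfolding F_def
  proof (rule has_field_derivative_integral[OF open_halfspace_Re_gt convex_halfspace_Re_gt])
    \<comment> \<open>Halving the real part leaves a convex neighbourhood of \<open>w\<close> that
      stays away from the imaginary axis, where \<open>x * exp (- v * x)\<close> has a common
      bound.\<close>
    show "w \<in> {v. Re v > Re w / 2}" using w by simp
    show "AE x in \<mu>. \<forall>v\<in>{v. Re v > Re w / 2}.
        ((\<lambda>v::complex. exp (- v * complex_of_real x)) has_field_derivative - complex_of_real x * exp (- v * complex_of_real x)) (at v)"
      by (intro AE_I2 ballI) (auto intro!: derivative_eq_intros)
    show "AE x in \<mu>. \<forall>v\<in>{v. Re v > Re w / 2}. norm (- complex_of_real x * exp (- v * complex_of_real x)) \<le> 1 / (Re w / 2)"
      using nonneg
    proof (eventually_elim, safe)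
      fix x :: real and v :: complex assume "0 \<le> x" "Re w / 2 < Re v"
      then have "Re w / 2 * x \<le> Re v * x" by (intro mult_right_mono) auto
      with \<open>0 \<le> x\<close> have "x * exp (- (Re v * x)) \<le> x * exp (- (Re w / 2) * x)"
        by (intro mult_left_mono) auto
      also have "\<dots> \<le> 1 / (Re w / 2)" using w by (intro mult_exp_neg_le) auto
      finally show "norm (- complex_of_real x * exp (- v * complex_of_real x)) \<le> 1 / (Re w / 2)"
        using \<open>0 \<le> x\<close> by (simp add: norm_mult)
    qed
  qed (use w intF in auto)
  have d\<Phi>: "(\<Phi> has_field_derivative (CLINT s|N. complex_of_real s * exp (- w * s))) (at w)" if w: "0 < Re w" for w
    unfolding \<Phi>_def
  proof (rule has_field_derivative_integral[OF open_halfspace_Re_gt convex_halfspace_Re_gt])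
    show "w \<in> {v. Re v > Re w / 2}" using w by simp
    show "AE x in N. \<forall>v\<in>{v. Re v > Re w / 2}.
        ((\<lambda>v::complex. 1 - exp (- v * complex_of_real x)) has_field_derivative complex_of_real x * exp (- v * complex_of_real x)) (at v)"
      by (intro AE_I2 ballI) (auto intro!: derivative_eq_intros)
    show "AE s in N. \<forall>v\<in>{v. Re v > Re w / 2}. norm (complex_of_real s * exp (- v * complex_of_real s))
        \<le> s * exp (- (Re w / 2) * s)"
      using AE_pos
    proof (eventually_elim, safe)
      fix x :: real and v :: complex assume "0 < x" "Re w / 2 < Re v"
      then have "Re w / 2 * x \<le> Re v * x" by (intro mult_right_mono) auto
      with \<open>0 < x\<close> have "x * exp (- (Re v * x)) \<le> x * exp (- (Re w / 2) * x)"
        by (intro mult_left_mono) auto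
      then show "norm (complex_of_real x * exp (- v * x)) \<le> x * exp (- (Re w / 2) * x)"
        using \<open>0 < x\<close> by (simp add: norm_mult)
    qed
    show "integrable N (\<lambda>s. s * exp (- (Re w / 2) * s))"
      using w by (intro integrable_mult_exp) auto
    show "complex_integrable N (\<lambda>s. 1 - exp (- v * complex_of_real s))" if "v \<in> {v. Re v > Re w / 2}" for v
      using integrable_one_minus_cexp[of v] that w by simp
  qed auto
  have "F z - exp (- \<Phi> z) = 0"
  proof (rule analytic_continuation[where S = "{z. 0 < Re z}" and U = "complex_of_real ` {0<..}" and \<xi> = 1
        and f = "\<lambda>z. F z - exp (- \<Phi> z)"])
    show "(\<lambda>z. F z - exp (- \<Phi> z)) holomorphic_on {z. 0 < Re z}"
    proof (intro holomorphic_intros)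
      show "F holomorphic_on {z. 0 < Re z}" "\<Phi> holomorphic_on {z. 0 < Re z}"
        unfolding holomorphic_on_def field_differentiable_def
        using dF d\<Phi> has_field_derivative_at_within by blast+
    qed
    show "1 islimpt complex_of_real ` {0<..}"
      unfolding islimpt_sequential
    proof (intro exI conjI allI)
      fix n
      have "1 + 1 / real (Suc n) > 0" "1 + 1 / real (Suc n) \<noteq> 1" by (simp_all add: add_pos_pos)
      then show "complex_of_real (1 + 1 / real (Suc n)) \<in> complex_of_real ` {0<..} - {1}"
        by (metis DiffI greaterThan_iff imageI of_real_eq_1_iff singletonD)
      have "(\<lambda>n. complex_of_real (1 + 1 / real (Suc n))) \<longlonglongrightarrow> complex_of_real (1 + 0)"
        by (intro tendsto_intros LIMSEQ_Suc[OF lim_1_over_n])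
      then show "(\<lambda>n. complex_of_real (1 + 1 / real (Suc n))) \<longlonglongrightarrow> 1" by simp
    qed
    fix w assume "w \<in> complex_of_real ` {0<..}"
    then obtain u where u: "w = of_real u" "0 < u" by auto
    have e: "exp (- complex_of_real u * complex_of_real x) = complex_of_real (exp (- u * x))" for x
      by (metis exp_of_real of_real_minus of_real_mult)
    have e': "1 - complex_of_real x = complex_of_real (1 - x)" for x by simp
    have "F w = of_real (LINT x|\<mu>. exp (- u * x))"
      unfolding F_def u e integral_complex_of_real ..
    moreover have "\<Phi> w = of_real (LINT s|N. 1 - exp (- u * s))"
      unfolding \<Phi>_def u e e' integral_complex_of_real ..
    ultimately show "F w - exp (- \<Phi> w) = 0"
      using law u by (simp add: laplace_law_def exp_of_real flip: of_real_minus)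
  qed (use z in \<open>auto simp: open_halfspace_Re_gt intro!: convex_connected convex_halfspace_Re_gt\<close>)
  then show ?thesis by (simp add: F_def \<Phi>_def)
qed

text \<open>The imaginary axis is approached from inside the half-plane along
  \<open>1 / (n + 1) - \<i> * \<xi>\<close>. Dominated convergence applies to both integrals, for
  \<open>N\<close> with a multiple of \<open>min 1 s\<close> as majorant.\<close>

lemma laplace_law_char:
  assumes law: "laplace_law N \<mu>"
  shows "char \<mu> \<xi> = exp (- (CLINT s|N. 1 - iexp (\<xi> * s)))"
proof -
  interpret real_distribution \<mu> using law by (simp add: laplace_law_def)
  have nonneg: "AE x in \<mu>. 0 \<le> x" using law by (simp add: laplace_law_def)
  define z where "z n = Complex (1 / real (Suc n)) (- \<xi>)" for n
  have Re_z: "0 < Re (z n)" "Re (z n) \<le> 1" "norm (z n) \<le> 1 + \<bar>\<xi>\<bar>" for n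
  proof -
    have "1 / real (Suc n) \<le> 1" by simp
    moreover have "norm (z n) \<le> 1 / real (Suc n) + \<bar>\<xi>\<bar>"
      using cmod_le[of "z n"] unfolding z_def complex.sel by simp
    ultimately show "norm (z n) \<le> 1 + \<bar>\<xi>\<bar>" by linarith
    show "0 < Re (z n)" "Re (z n) \<le> 1" by (simp_all add: z_def)
  qed
  have lim: "z \<longlonglongrightarrow> - (\<i> * \<xi>)"
  proof -
    have "z \<longlonglongrightarrow> Complex 0 (- \<xi>)" unfolding z_def
      by (intro tendsto_Complex tendsto_const LIMSEQ_Suc[OF lim_1_over_n])
    then show ?thesis by (simp add: complex_eq_iff Complex_eq)
  qed
  have "(\<lambda>n. CLINT x|\<mu>. exp (- z n * x)) \<longlonglongrightarrow> (CLINT x|\<mu>. exp (- (- (\<i> * \<xi>)) * x))"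
  proof (rule integral_dominated_convergence[where w = "\<lambda>_. 1"])
    show "AE x in \<mu>. norm (exp (- z n * complex_of_real x)) \<le> 1" for n
      using nonneg by eventually_elim (use Re_z[of n] in \<open>simp\<close>)
    show "AE x in \<mu>. (\<lambda>n. exp (- z n * complex_of_real x)) \<longlonglongrightarrow> exp (- (- (\<i> * \<xi>)) * x)"
      by (intro AE_I2 tendsto_intros lim)
  qed auto
  moreover have "(\<lambda>n. CLINT s|N. 1 - exp (- z n * s)) \<longlonglongrightarrow> (CLINT s|N. 1 - exp (- (- (\<i> * \<xi>)) * s))"
  proof (rule integral_dominated_convergence[where w = "\<lambda>s. (3 + \<bar>\<xi>\<bar>) * min 1 s"])
    show "AE s in N. norm (1 - exp (- z n * complex_of_real s)) \<le> (3 + \<bar>\<xi>\<bar>) * min 1 s" for n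
      using AE_pos
    proof eventually_elim
      case (elim s)
      have "norm (1 - exp (- (z n * s))) \<le> norm (z n * s)"
        using norm_one_minus_exp_le[of "z n * s"] Re_z[of n] elim by simp
      also have "\<dots> \<le> (1 + \<bar>\<xi>\<bar>) * s" using Re_z(3)[of n] elim by (simp add: norm_mult)
      finally have 1: "norm (1 - exp (- (z n * s))) \<le> (1 + \<bar>\<xi>\<bar>) * s" .
      have 2: "norm (1 - exp (- (z n * s))) \<le> 2"
      proof -
        have "exp (- (Re (z n) * s)) \<le> 1" using Re_z(1)[of n] elim by simp
        then have "norm (exp (- (z n * s))) \<le> 1" by simp
        then show ?thesis using norm_triangle_ineq4[of 1 "exp (- (z n * s))"] unfolding norm_one by linarith
      qed
      show ?case
      proof (cases "s \<le> 1")
        case True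
        then show ?thesis using 1 elim by (simp add: algebra_simps)
      qed (use 2 in simp)
    qed
    show "AE s in N. (\<lambda>n. 1 - exp (- z n * complex_of_real s)) \<longlonglongrightarrow> 1 - exp (- (- (\<i> * \<xi>)) * s)"
      by (intro AE_I2 tendsto_intros lim)
    show "integrable N (\<lambda>s. (3 + \<bar>\<xi>\<bar>) * min 1 s)" using integrable_min by simp
  qed auto
  then have "(\<lambda>n. CLINT x|\<mu>. exp (- z n * x)) \<longlonglongrightarrow> exp (- (CLINT s|N. 1 - exp (- (- (\<i> * \<xi>)) * s)))"
    unfolding laplace_law_complex[OF law Re_z(1)] by (intro tendsto_intros)
  ultimately have "(CLINT x|\<mu>. exp (- (- (\<i> * \<xi>)) * x)) = exp (- (CLINT s|N. 1 - exp (- (- (\<i> * \<xi>)) * s)))"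
    by (rule LIMSEQ_unique)
  then show ?thesis by (simp add: char_def mult_ac)
qed

lemma laplace_law_unique:
  assumes "laplace_law N \<mu>" "laplace_law N \<mu>'"
  shows "\<mu> = \<mu>'"
proof (rule Levy_uniqueness)
  show "char \<mu> = char \<mu>'" using assms by (auto simp: laplace_law_char)
qed (use assms in \<open>auto simp: laplace_law_def\<close>)

lemma norm_char_laplace_law:
  assumes law: "laplace_law N \<mu>"
  shows "norm (char \<mu> \<xi>) = exp (- (LINT s|N. 1 - cos (\<xi> * s)))"
proof -
  have "Re (CLINT s|N. 1 - iexp (\<xi> * s)) = (LINT s|N. 1 - cos (\<xi> * s))"
    using integrable_one_minus_cexp[of "- (\<i> * \<xi>)"]
    by (subst integral_Re[symmetric]) (auto simp: mult_ac Re_exp)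
  then show ?thesis by (simp add: laplace_law_char[OF law])
qed

lemma integrable_one_minus_cos: "integrable N (\<lambda>s. 1 - cos (\<xi> * s))"
proof -
  have "integrable N (\<lambda>s. Re (1 - exp (- (- (\<i> * \<xi>)) * complex_of_real s)))"
    by (rule integrable_Re, rule integrable_one_minus_cexp) simp
  then show ?thesis by (simp add: Re_exp)
qed

end

section \<open>Convolution of laws on the half-line\<close>

lemma real_distribution_finite: "real_distribution \<mu> \<Longrightarrow> finite_measure \<mu>"
  by (simp add: real_distribution_def prob_space_def)

lemma real_distribution_convolution:
  assumes "real_distribution M" "real_distribution N"
  shows "real_distribution (M \<star> N)"
proof -
  interpret M: real_distribution M by fact
  interpret N: real_distribution N by fact
  interpret pair_prob_space M N ..
  have "prob_space (M \<star> N)" unfolding convolution_def by (rule prob_space_distr) measurable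
  then show ?thesis by (simp add: real_distribution_def real_distribution_axioms_def)
qed

lemma AE_convolution_nonneg:
  assumes M: "real_distribution M" "AE x in M. 0 \<le> x" and N: "real_distribution N" "AE x in N. 0 \<le> x"
  shows "AE x in M \<star> N. 0 \<le> x"
proof -
  interpret M: real_distribution M by fact
  interpret N: real_distribution N by fact
  interpret MN: real_distribution "M \<star> N" by (intro real_distribution_convolution M N)
  have "(\<integral>\<^sup>+x. indicator {..<0} x \<partial>(M \<star> N)) = (\<integral>\<^sup>+x. \<integral>\<^sup>+y. indicator {..<0} (x + y) \<partial>N \<partial>M)"
    by (rule nn_integral_convolution) (auto simp: M.finite_measure_axioms N.finite_measure_axioms)
  also have "\<dots> = (\<integral>\<^sup>+x. 0 \<partial>M)"
  proof (rule nn_integral_cong_AE, use M(2) in eventually_elim)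
    fix x :: real assume "0 \<le> x"
    have "(\<integral>\<^sup>+y. indicator {..<0} (x + y) \<partial>N) = (\<integral>\<^sup>+y. 0 \<partial>N)"
      by (rule nn_integral_cong_AE, use N(2) in eventually_elim) (use \<open>0 \<le> x\<close> in auto)
    then show "(\<integral>\<^sup>+y. indicator {..<0} (x + y) \<partial>N) = (0::ennreal)" by simp
  qed
  finally have "emeasure (M \<star> N) {..<0} = 0" by simp
  then have "AE x in M \<star> N. x \<notin> {..<0}" by (intro AE_not_in null_setsI) auto
  then show ?thesis by (auto elim: eventually_mono)
qed

lemma nn_integral_exp_convolution:
  assumes M: "real_distribution M" and N: "real_distribution N"
  shows "(\<integral>\<^sup>+x. ennreal (exp (- u * x)) \<partial>(M \<star> N)) =
    (\<integral>\<^sup>+x. ennreal (exp (- u * x)) \<partial>M) * (\<integral>\<^sup>+x. ennreal (exp (- u * x)) \<partial>N)"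
proof -
  interpret M: real_distribution M by fact
  interpret N: real_distribution N by fact
  have "(\<integral>\<^sup>+x. ennreal (exp (- u * x)) \<partial>(M \<star> N)) = (\<integral>\<^sup>+x. \<integral>\<^sup>+y. ennreal (exp (- u * (x + y))) \<partial>N \<partial>M)"
    by (rule nn_integral_convolution) (auto simp: M.finite_measure_axioms N.finite_measure_axioms)
  also have "\<dots> = (\<integral>\<^sup>+x. ennreal (exp (- u * x)) * (\<integral>\<^sup>+y. ennreal (exp (- u * y)) \<partial>N) \<partial>M)"
  proof -
    have "ennreal (exp (- u * (x + y))) = ennreal (exp (- u * x)) * ennreal (exp (- u * y))" for x y
      by (simp add: ennreal_mult[symmetric] exp_add[symmetric] algebra_simps)
    then show ?thesis by (simp add: nn_integral_cmult)
  qed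
  also have "\<dots> = (\<integral>\<^sup>+x. ennreal (exp (- u * x)) \<partial>M) * (\<integral>\<^sup>+x. ennreal (exp (- u * x)) \<partial>N)"
    by (rule nn_integral_multc) auto
  finally show ?thesis .
qed

text \<open>Nonnegative integrals multiply along convolutions and add up over mixtures without
  integrability conditions; this rule brings the outcome back to the Bochner integral of
  \<open>laplace_law\<close>.\<close>

lemma laplace_lawI_nn:
  assumes "real_distribution \<mu>" "AE x in \<mu>. 0 \<le> x"
    and "\<And>u. 0 \<le> u \<Longrightarrow> (\<integral>\<^sup>+x. ennreal (exp (- u * x)) \<partial>\<mu>) = ennreal (exp (- (LINT s|N. 1 - exp (- u * s))))"
  shows "laplace_law N \<mu>"
proof -
  interpret real_distribution \<mu> by fact
  show ?thesis
    unfolding laplace_law_def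
  proof (safe intro!: assms(1,2))
    fix u :: real assume "0 \<le> u"
    have "(LINT x|\<mu>. exp (- u * x)) = enn2real (\<integral>\<^sup>+x. ennreal (exp (- u * x)) \<partial>\<mu>)"
      by (rule integral_eq_nn_integral) auto
    then show "(LINT x|\<mu>. exp (- u * x)) = exp (- (LINT s|N. 1 - exp (- u * s)))"
      using assms(3)[OF \<open>0 \<le> u\<close>] by simp
  qed
qed

lemma laplace_law_nn:
  assumes law: "laplace_law N \<mu>" and u: "0 \<le> u"
  shows "(\<integral>\<^sup>+x. ennreal (exp (- u * x)) \<partial>\<mu>) = ennreal (exp (- (LINT s|N. 1 - exp (- u * s))))"
proof -
  interpret real_distribution \<mu> using law by (simp add: laplace_law_def)
  have "AE x in \<mu>. 0 \<le> x" using law by (simp add: laplace_law_def)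
  then have "integrable \<mu> (\<lambda>x. exp (- u * x))"
    using u by (intro integrable_const_bound[where B = 1]) auto
  then have "(\<integral>\<^sup>+x. ennreal (exp (- u * x)) \<partial>\<mu>) = ennreal (LINT x|\<mu>. exp (- u * x))"
    by (rule nn_integral_eq_integral) auto
  then show ?thesis using law u by (simp add: laplace_law_def)
qed

lemma laplace_law_convolution:
  assumes "laplace_law N1 \<mu>1" "laplace_law N2 \<mu>2"
    and sum: "\<And>u. 0 \<le> u \<Longrightarrow>
      (LINT s|N. 1 - exp (- u * s)) = (LINT s|N1. 1 - exp (- u * s)) + (LINT s|N2. 1 - exp (- u * s))"
  shows "laplace_law N (\<mu>1 \<star> \<mu>2)"
proof (rule laplace_lawI_nn)
  have r: "real_distribution \<mu>1" "real_distribution \<mu>2" using assms by (auto simp: laplace_law_def)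
  show "real_distribution (\<mu>1 \<star> \<mu>2)" by (intro real_distribution_convolution r)
  show "AE x in \<mu>1 \<star> \<mu>2. 0 \<le> x"
    using assms by (intro AE_convolution_nonneg) (auto simp: laplace_law_def)
  fix u :: real assume u: "0 \<le> u"
  show "(\<integral>\<^sup>+x. ennreal (exp (- u * x)) \<partial>(\<mu>1 \<star> \<mu>2)) = ennreal (exp (- (LINT s|N. 1 - exp (- u * s))))"
    unfolding nn_integral_exp_convolution[OF r] laplace_law_nn[OF assms(1) u] laplace_law_nn[OF assms(2) u] sum[OF u]
    by (simp add: exp_add exp_diff ennreal_mult[symmetric] exp_minus divide_simps)
qed

subsection \<open>Compound Poisson laws\<close>

primrec conv_power :: "real measure \<Rightarrow> nat \<Rightarrow> real measure" where
  "conv_power P 0 = return borel 0"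
| "conv_power P (Suc n) = (P \<star> conv_power P n)"

lemma real_distribution_return: "real_distribution (return borel x)"
  by (simp add: real_distribution_def real_distribution_axioms_def prob_space_return)

lemma real_distribution_conv_power: "real_distribution P \<Longrightarrow> real_distribution (conv_power P n)"
  by (induction n) (auto intro: real_distribution_return real_distribution_convolution)

text \<open>\<open>Q\<close> is the Poisson mixture of the convolution powers of the normalised
  \<open>N\<close>. The upper inequality takes one jump out of every nonempty sum; the lower one
  keeps only the sums with exactly one jump. Both are phrased with \<open>N\<close> itself, so the
  normalisation disappears.\<close>

lemma compound_poisson:
  assumes fin: "finite_measure N" and sets_N [measurable_cong, simp]: "sets N = sets borel"
    and nonneg: "AE s in N. 0 \<le> s"
  obtains Q where "laplace_law N Q"
    "\<And>g. g \<in> borel_measurable borel \<Longrightarrow> (\<integral>\<^sup>+x. g x \<partial>Q) \<le> g 0 + (\<integral>\<^sup>+y. \<integral>\<^sup>+s. g (s + y) \<partial>N \<partial>Q)"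
    "\<And>g. g \<in> borel_measurable borel \<Longrightarrow>
        ennreal (exp (- measure N UNIV)) * (\<integral>\<^sup>+s. g s \<partial>N) \<le> (\<integral>\<^sup>+x. g x \<partial>Q)"
proof -
  interpret N: finite_measure N by fact
  define \<Lambda> where "\<Lambda> = measure N UNIV"
  have space_N: "space N = UNIV" using sets_N sets_eq_imp_space_eq by fastforce
  have \<Lambda>: "emeasure N UNIV = ennreal \<Lambda>" unfolding \<Lambda>_def by (rule N.emeasure_eq_measure)
  show ?thesis
  proof (cases "\<Lambda> = 0")
    \<comment> \<open>Without mass there is nothing to normalise, and \<open>Q\<close> is the point
      mass at 0.\<close>
    case True
    then have null: "AE s in N. False"
      using \<Lambda> by (intro AE_I[where N = UNIV]) (auto simp: space_N)
    have nn0: "(\<integral>\<^sup>+s. g s \<partial>N) = 0" for g :: "real \<Rightarrow> ennreal"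
      using null by (subst nn_integral_cong_AE[of _ "\<lambda>_. 0"]) (auto elim: eventually_mono)
    have l0: "(LINT s|N. g s) = 0" for g :: "real \<Rightarrow> real"
      using null by (intro integral_eq_zero_AE) (auto elim: eventually_mono)
    show ?thesis
    proof (rule that[of "return borel 0"])
      show "laplace_law N (return borel 0)"
        by (rule laplace_lawI_nn) (auto simp: real_distribution_return AE_return nn_integral_return l0)
    qed (auto simp: nn_integral_return nn0)
  next
    case False
    then have pos: "0 < \<Lambda>" unfolding \<Lambda>_def by (simp add: less_le)
    define P where "P = density N (\<lambda>_. ennreal (1 / \<Lambda>))"
    have sets_P [measurable_cong, simp]: "sets P = sets borel" by (simp add: P_def)
    have nnP: "ennreal \<Lambda> * (\<integral>\<^sup>+s. g s \<partial>P) = (\<integral>\<^sup>+s. g s \<partial>N)" if [measurable]: "g \<in> borel_measurable borel" for g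
    proof -
      have "ennreal \<Lambda> * (\<integral>\<^sup>+s. g s \<partial>P) = ennreal \<Lambda> * (ennreal (1 / \<Lambda>) * (\<integral>\<^sup>+s. g s \<partial>N))"
        unfolding P_def by (simp add: nn_integral_density nn_integral_cmult)
      also have "\<dots> = (\<integral>\<^sup>+s. g s \<partial>N)"
        using pos by (simp add: mult.assoc[symmetric] ennreal_mult[symmetric])
      finally show ?thesis .
    qed
    have "emeasure P (space P) = 1"
      using pos \<Lambda> by (simp add: P_def emeasure_density space_N ennreal_mult[symmetric])
    then have P: "real_distribution P"
      by (auto simp: real_distribution_def real_distribution_axioms_def intro: prob_spaceI)
    interpret P: real_distribution P by fact
    interpret C: real_distribution "conv_power P n" for n by (intro real_distribution_conv_power P)
    define pois where "pois = poisson_pmf \<Lambda>"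
    define Q where "Q = measure_pmf pois \<bind> conv_power P"
    have pmf: "pmf pois k = \<Lambda> ^ k / fact k * exp (- \<Lambda>)" for k
      unfolding pois_def by (rule pmf_poisson[OF pos])
    have kernel: "conv_power P \<in> measurable (measure_pmf pois) (subprob_algebra borel)"
      by (auto simp: space_subprob_algebra intro!: C.prob_space_axioms prob_space_imp_subprob_space)
    have nnQ: "(\<integral>\<^sup>+x. g x \<partial>Q) = (\<Sum>k. ennreal (pmf pois k) * (\<integral>\<^sup>+x. g x \<partial>conv_power P k))"
      if "g \<in> borel_measurable borel" for g
      unfolding Q_def nn_integral_bind[OF that kernel] nn_integral_measure_pmf nn_integral_count_space_nat ..
    have sets_Q [measurable_cong, simp]: "sets Q = sets borel"
      unfolding Q_def by (rule sets_bind[OF sets_kernel[OF kernel]]) auto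
    have space_Q: "space Q = UNIV" using sets_eq_imp_space_eq[OF sets_Q] by simp
    have "emeasure Q (space Q) = (\<integral>\<^sup>+x. 1 \<partial>Q)" by simp
    also have "\<dots> = (\<integral>\<^sup>+k. \<integral>\<^sup>+x. 1 \<partial>conv_power P k \<partial>measure_pmf pois)"
      unfolding Q_def by (rule nn_integral_bind[OF _ kernel]) simp
    also have "\<dots> = 1" using C.emeasure_space_1 by simp
    finally have Q: "real_distribution Q"
      by (auto simp: real_distribution_def real_distribution_axioms_def intro: prob_spaceI)
    have P_nonneg: "AE s in P. 0 \<le> s" unfolding P_def using nonneg by (subst AE_density) (auto elim: eventually_mono)
    have C_nonneg: "AE x in conv_power P k. 0 \<le> x" for k
    proof (induction k)
      case (Suc k)
      show ?case unfolding conv_power.simps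
        by (rule AE_convolution_nonneg[OF P P_nonneg real_distribution_conv_power[OF P] Suc])
    next
      case 0
      show ?case unfolding conv_power.simps by (subst AE_return) auto
    qed
    have "(\<integral>\<^sup>+x. indicator {..<0} x \<partial>Q) = (\<Sum>k. ennreal (pmf pois k) * emeasure (conv_power P k) {..<0})"
      by (subst nnQ) auto
    also have "\<dots> = 0"
    proof -
      have "emeasure (conv_power P k) {..<0} = 0" for k
        using C_nonneg[of k] by (intro AE_iff_measurable[THEN iffD1, of _ _ "\<lambda>x. 0 \<le> x"]) auto
      then show ?thesis by simp
    qed
    finally have "emeasure Q {..<0} = 0" by simp
    then have "AE x in Q. x \<notin> {..<0}" by (intro AE_not_in null_setsI) auto
    then have Q_nonneg: "AE x in Q. 0 \<le> x" by (auto elim: eventually_mono)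
    have law: "laplace_law N Q"
    proof (rule laplace_lawI_nn[OF Q Q_nonneg])
      fix u :: real assume u: "0 \<le> u"
      have int: "integrable N (\<lambda>s. exp (- u * s))"
        using nonneg u by (intro N.integrable_const_bound[where B = 1]) auto
      define l where "l = (LINT s|N. exp (- u * s)) / \<Lambda>"
      have l: "0 \<le> l" unfolding l_def using pos by simp
      have "(\<integral>\<^sup>+s. ennreal (exp (- u * s)) \<partial>P) = ennreal (1 / \<Lambda>) * ennreal (LINT s|N. exp (- u * s))"
        unfolding P_def using int by (simp add: nn_integral_density nn_integral_cmult nn_integral_eq_integral)
      also have "\<dots> = ennreal l" using pos by (simp add: l_def ennreal_mult[symmetric])
      finally have lP: "(\<integral>\<^sup>+s. ennreal (exp (- u * s)) \<partial>P) = ennreal l" .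
      have lC: "(\<integral>\<^sup>+s. ennreal (exp (- u * s)) \<partial>conv_power P k) = ennreal (l ^ k)" for k
      proof (induction k)
        case (Suc k)
        show ?case
          unfolding conv_power.simps nn_integral_exp_convolution[OF P real_distribution_conv_power[OF P]] lP Suc
          using l by (simp add: ennreal_mult)
      qed (simp add: nn_integral_return)
      have "(\<integral>\<^sup>+x. ennreal (exp (- u * x)) \<partial>Q) = (\<Sum>k. ennreal (pmf pois k * l ^ k))"
        by (subst nnQ, simp, unfold lC, use l in \<open>simp add: ennreal_mult'\<close>)
      also have "\<dots> = ennreal (exp (\<Lambda> * l) * exp (- \<Lambda>))"
      proof (rule suminf_ennreal_eq)
        have "(\<lambda>k. (\<Lambda> * l) ^ k /\<^sub>R fact k * exp (- \<Lambda>)) sums (exp (\<Lambda> * l) * exp (- \<Lambda>))"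
          by (intro sums_mult2 exp_converges)
        then show "(\<lambda>k. pmf pois k * l ^ k) sums (exp (\<Lambda> * l) * exp (- \<Lambda>))"
          by (simp add: pmf power_mult_distrib field_simps)
      qed (use l in auto)
      also have "exp (\<Lambda> * l) * exp (- \<Lambda>) = exp (- (LINT s|N. 1 - exp (- u * s)))"
        using pos int by (simp add: l_def exp_add[symmetric] Bochner_Integration.integral_diff \<Lambda>_def space_N)
      finally show "(\<integral>\<^sup>+x. ennreal (exp (- u * x)) \<partial>Q) = ennreal (exp (- (LINT s|N. 1 - exp (- u * s))))" .
    qed
    show ?thesis
    proof (rule that[OF law])
      fix g :: "real \<Rightarrow> ennreal" assume g [measurable]: "g \<in> borel_measurable borel"
      interpret CN: pair_sigma_finite N "conv_power P k" for k ..
      let ?c = "\<lambda>k. \<integral>\<^sup>+x. g x \<partial>conv_power P k"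
      \<comment> \<open>The factor \<open>1 / (k + 1)\<close> in the ratio of consecutive Poisson
        weights is given away, so that the sum over \<open>k\<close> reassembles to an integral over
        \<open>Q\<close>.\<close>
      have step: "ennreal (pmf pois (Suc k)) * ?c (Suc k)
          \<le> ennreal (pmf pois k) * (\<integral>\<^sup>+y. \<integral>\<^sup>+s. g (s + y) \<partial>N \<partial>conv_power P k)" for k
      proof -
        have "?c (Suc k) = (\<integral>\<^sup>+s. \<integral>\<^sup>+y. g (s + y) \<partial>conv_power P k \<partial>P)"
          unfolding conv_power.simps
          by (rule nn_integral_convolution) (auto simp: P.finite_measure_axioms C.finite_measure_axioms)
        then have "ennreal \<Lambda> * ?c (Suc k) = (\<integral>\<^sup>+s. \<integral>\<^sup>+y. g (s + y) \<partial>conv_power P k \<partial>N)"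
          by (simp add: nnP)
        also have "\<dots> = (\<integral>\<^sup>+y. \<integral>\<^sup>+s. g (s + y) \<partial>N \<partial>conv_power P k)"
          by (rule CN.Fubini'[symmetric]) measurable
        finally have fub: "ennreal \<Lambda> * ?c (Suc k) = (\<integral>\<^sup>+y. \<integral>\<^sup>+s. g (s + y) \<partial>N \<partial>conv_power P k)" .
        have "\<Lambda> ^ Suc k / fact (Suc k) \<le> \<Lambda> ^ Suc k / fact k"
          using pos by (intro divide_left_mono) (auto intro!: fact_mono simp del: fact_Suc)
        then have "\<Lambda> ^ Suc k / fact (Suc k) * exp (- \<Lambda>) \<le> \<Lambda> ^ Suc k / fact k * exp (- \<Lambda>)"
          by (rule mult_right_mono) simp
        then have "pmf pois (Suc k) \<le> pmf pois k * \<Lambda>"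
          by (simp add: pmf mult_ac divide_right_mono del: fact_Suc)
        then have "ennreal (pmf pois (Suc k)) \<le> ennreal (pmf pois k) * ennreal \<Lambda>"
          using pos by (simp add: ennreal_mult[symmetric] ennreal_leI)
        then have "ennreal (pmf pois (Suc k)) * ?c (Suc k) \<le> ennreal (pmf pois k) * ennreal \<Lambda> * ?c (Suc k)"
          by (rule mult_right_mono) simp
        then show ?thesis unfolding mult.assoc fub .
      qed
      define F where "F k = ennreal (pmf pois k) * ?c k" for k
      have "(\<lambda>k. F (Suc k)) sums (\<Sum>k. F (Suc k))" by (rule summable_sums) auto
      from sums_unique[OF sums_Suc[OF this]]
      have "(\<Sum>k. ennreal (pmf pois k) * ?c k)
          = (\<Sum>k. ennreal (pmf pois (Suc k)) * ?c (Suc k)) + ennreal (pmf pois 0) * ?c 0"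
        unfolding F_def by simp
      also have "\<dots> \<le> (\<Sum>k. ennreal (pmf pois k) * (\<integral>\<^sup>+y. \<integral>\<^sup>+s. g (s + y) \<partial>N \<partial>conv_power P k)) + 1 * ?c 0"
        by (intro add_mono suminf_le step mult_right_mono) (auto simp: pmf pos less_imp_le)
      also have "(\<Sum>k. ennreal (pmf pois k) * (\<integral>\<^sup>+y. \<integral>\<^sup>+s. g (s + y) \<partial>N \<partial>conv_power P k))
          = (\<integral>\<^sup>+y. \<integral>\<^sup>+s. g (s + y) \<partial>N \<partial>Q)"
        by (subst nnQ) (auto intro!: N.borel_measurable_nn_integral)
      finally show "(\<integral>\<^sup>+x. g x \<partial>Q) \<le> g 0 + (\<integral>\<^sup>+y. \<integral>\<^sup>+s. g (s + y) \<partial>N \<partial>Q)"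
        by (simp add: nnQ nn_integral_return add.commute)
      \<comment> \<open>The weight of a single jump is \<open>\<Lambda> * exp (- \<Lambda>)\<close>,
        and its factor \<Lambda> undoes the normalisation of \<open>P\<close>.\<close>
      have "?c 1 = (\<integral>\<^sup>+s. g s \<partial>P)"
        by (simp add: nn_integral_convolution P.finite_measure_axioms real_distribution_finite real_distribution_return nn_integral_return)
      then have "ennreal (exp (- \<Lambda>)) * (\<integral>\<^sup>+s. g s \<partial>N) = ennreal (pmf pois 1) * ?c 1"
        using pos by (simp add: nnP[symmetric] pmf ennreal_mult mult_ac)
      also have "\<dots> \<le> (\<integral>\<^sup>+k. ennreal (pmf pois k) * ?c k \<partial>count_space UNIV)"
        by (rule nn_integral_ge_point) simp
      also have "\<dots> = (\<integral>\<^sup>+x. g x \<partial>Q)" by (simp add: nnQ nn_integral_count_space_nat)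
      finally show "ennreal (exp (- measure N UNIV)) * (\<integral>\<^sup>+s. g s \<partial>N) \<le> (\<integral>\<^sup>+x. g x \<partial>Q)"
        by (simp add: \<Lambda>_def)
    qed
  qed
qed

subsection \<open>Existence of laws, exponential tilting\<close>

context levy_measure
begin

lemma integral_density_real:
  fixes f g :: "real \<Rightarrow> real"
  assumes [measurable]: "f \<in> borel_measurable borel" "g \<in> borel_measurable borel" and f: "\<And>s. 0 \<le> f s"
  shows "(LINT s|density N (\<lambda>s. ennreal (f s)). g s) = (LINT s|N. f s * g s)"
  using f by (subst integral_density) auto

lemma integrable_mult_bounded:
  fixes f g :: "real \<Rightarrow> real"
  assumes g: "integrable N g" and [measurable]: "f \<in> borel_measurable borel" and f: "\<And>s. \<bar>f s\<bar> \<le> B"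
  shows "integrable N (\<lambda>s. f s * g s)"
proof (rule Bochner_Integration.integrable_bound)
  show "integrable N (\<lambda>s. B * g s)" using g by simp
  have [measurable]: "g \<in> borel_measurable N" using g by simp
  show "(\<lambda>s. f s * g s) \<in> borel_measurable N" by simp
  show "AE s in N. norm (f s * g s) \<le> norm (B * g s)"
  proof (intro AE_I2)
    fix s
    have "\<bar>f s\<bar> \<le> \<bar>B\<bar>" using f[of s] by linarith
    then show "norm (f s * g s) \<le> norm (B * g s)" by (simp add: abs_mult mult_right_mono)
  qed
qed

lemma levy_measure_density:
  assumes [measurable]: "f \<in> borel_measurable borel" and f: "\<And>s. 0 \<le> f s" "\<And>s. f s \<le> B"
  shows "levy_measure (density N (\<lambda>s. ennreal (f s)))"
proof
  show "AE s in density N (\<lambda>s. ennreal (f s)). 0 < s"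
    using AE_pos by (subst AE_density) (auto elim: eventually_mono)
  have "integrable N (\<lambda>s. f s * min 1 s)"
    by (rule integrable_mult_bounded[OF integrable_min, where B = B]) (use f in auto)
  then show "integrable (density N (\<lambda>s. ennreal (f s))) (\<lambda>s. min 1 s)"
    using f by (subst integrable_density) auto
qed simp

lemma integrable_indicator_greater:
  assumes "0 < e"
  shows "integrable N (\<lambda>s. indicator {e<..} s :: real)"
proof (rule Bochner_Integration.integrable_bound)
  show "integrable N (\<lambda>s. (1 + 1 / e) * min 1 s)" using integrable_min by simp
  show "AE s in N. norm (indicator {e<..} s :: real) \<le> norm ((1 + 1 / e) * min 1 s)"
  proof (intro AE_I2)
    fix s show "norm (indicator {e<..} s :: real) \<le> norm ((1 + 1 / e) * min 1 s)"
    proof (cases "e < s")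
      case True
      have "1 \<le> (1 + 1 / e) * min 1 s"
      proof (cases "s \<le> 1")
        case s1: True
        have "1 \<le> s / e" using True assms by simp
        moreover have "(1 + 1 / e) * s = s + s / e" using assms by (simp add: field_simps)
        ultimately have "1 \<le> (1 + 1 / e) * s" using True assms by linarith
        then show ?thesis using s1 by simp
      qed (use assms in simp)
      then show ?thesis using True by simp
    qed simp
  qed
qed simp

lemma emeasure_greater:
  assumes "0 < e"
  shows "emeasure N {e<..} = ennreal (measure N {e<..})"
proof -
  have "emeasure N {e<..} < \<infinity>"
    using integrable_indicator_greater[OF assms] by (simp add: integrable_indicator_iff)
  then show ?thesis by (simp add: emeasure_eq_ennreal_measure less_top)
qed

lemma finite_measure_truncated:
  assumes "0 < e"
  shows "finite_measure (density N (\<lambda>s. ennreal (indicator {e<..} s)))"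
    and "measure (density N (\<lambda>s. ennreal (indicator {e<..} s))) UNIV = measure N {e<..}"
proof -
  have UNIV_N: "space N = UNIV" using sets_N sets_eq_imp_space_eq by fastforce
  have *: "emeasure (density N (\<lambda>s. ennreal (indicator {e<..} s))) UNIV = emeasure N {e<..}"
    by (subst emeasure_density) (auto simp: ennreal_indicator)
  show "finite_measure (density N (\<lambda>s. ennreal (indicator {e<..} s)))"
    by (rule finite_measureI) (use * UNIV_N in \<open>simp add: emeasure_greater[OF assms]\<close>)
  show "measure (density N (\<lambda>s. ennreal (indicator {e<..} s))) UNIV = measure N {e<..}"
    unfolding measure_def * ..
qed

text \<open>The law is a weak limit of the compound Poisson laws of the jumps beyond
  \<open>1 / (n + 1)\<close>. The finite mean bounds all their exponents by \<open>u * m\<close>,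
  which yields tightness; in the applications the jumps are bounded, so the mean is finite.\<close>

theorem laplace_law_exists:
  assumes mean: "integrable N (\<lambda>s. s)"
  shows "\<exists>\<mu>. laplace_law N \<mu>"
proof -
  define e where "e n = 1 / real (Suc n)" for n
  have e: "0 < e n" for n by (simp add: e_def)
  define N' where "N' n = density N (\<lambda>s. ennreal (indicator {e n<..} s))" for n
  define m where "m = (LINT s|N. s)"
  have m: "0 \<le> m" unfolding m_def using AE_pos by (intro integral_nonneg_AE) (auto elim: eventually_mono)
  have "\<exists>Q. laplace_law (N' n) Q" for n
  proof (rule compound_poisson)
    show "finite_measure (N' n)" unfolding N'_def by (rule finite_measure_truncated[OF e])
    show "AE s in N' n. 0 \<le> s" unfolding N'_def
      using AE_pos by (subst AE_density) (auto elim: eventually_mono)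
  qed (auto simp: N'_def)
  then obtain Q where Q: "laplace_law (N' n) (Q n)" for n by metis
  have rd: "real_distribution (Q n)" and nonneg: "AE x in Q n. 0 \<le> x" for n
    using Q[of n] by (auto simp: laplace_law_def)
  interpret Q: real_distribution "Q n" for n by (rule rd)
  define \<phi> where "\<phi> n u = (LINT s|N' n. 1 - exp (- u * s))" for n u
  have \<phi>: "\<phi> n u = (LINT s|N. indicator {e n<..} s * (1 - exp (- u * s)))" for n u
    unfolding \<phi>_def N'_def by (rule integral_density_real) auto
  have \<phi>_le: "\<phi> n u \<le> u * m" if "0 \<le> u" for n u
    unfolding \<phi> m_def integral_mult_right_zero[symmetric]
  proof (rule integral_mono_AE)
    show "integrable N (\<lambda>s. indicator {e n<..} s * (1 - exp (- u * s)))"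
      by (rule integrable_mult_bounded[OF integrable_one_minus_exp[OF that], where B = 1]) auto
    show "AE s in N. indicator {e n<..} s * (1 - exp (- u * s)) \<le> u * s"
      using AE_pos
    proof eventually_elim
      case (elim s)
      then show ?case using exp_ge_add_one_self[of "- u * s"] that by (auto simp: indicator_def)
    qed
  qed (use mean in simp)
  have \<phi>_lim: "(\<lambda>n. \<phi> n u) \<longlonglongrightarrow> (LINT s|N. 1 - exp (- u * s))" if u: "0 \<le> u" for u
    unfolding \<phi>
  proof (rule integral_dominated_convergence[where w = "\<lambda>s. 1 - exp (- u * s)"])
    show "integrable N (\<lambda>s. 1 - exp (- u * s))" by (rule integrable_one_minus_exp[OF u])
    show "AE s in N. (\<lambda>n. indicator {e n<..} s * (1 - exp (- u * s))) \<longlonglongrightarrow> 1 - exp (- u * s)"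
      using AE_pos
    proof eventually_elim
      case (elim s)
      have "e \<longlonglongrightarrow> 0" unfolding e_def by (rule LIMSEQ_Suc[OF lim_1_over_n])
      then have "eventually (\<lambda>n. e n < s) sequentially" using elim by (rule order_tendstoD)
      then have "eventually (\<lambda>n. indicator {e n<..} s * (1 - exp (- u * s)) = 1 - exp (- u * s)) sequentially"
        by eventually_elim simp
      then show ?case by (rule tendsto_eventually)
    qed
    show "AE s in N. norm (indicator {e n<..} s * (1 - exp (- u * s))) \<le> 1 - exp (- u * s)" for n
      using AE_pos by eventually_elim (use u in \<open>auto simp: indicator_def\<close>)
  qed auto
  have lap: "(LINT x|Q n. exp (- u * x)) = exp (- \<phi> n u)" if "0 \<le> u" for n u
    using Q[of n] that unfolding laplace_law_def \<phi>_def by blast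
  have "tight Q"
    unfolding tight_def
  proof (intro conjI allI impI rd)
    fix \<epsilon> :: real assume \<epsilon>: "0 < \<epsilon>"
    \<comment> \<open>Markov's inequality in Laplace form: testing with \<open>exp (- x / K)\<close>
      bounds the mass beyond \<open>K\<close> by \<open>2 * m / K\<close>. The left end -1 below
      keeps a possible atom at 0 inside a left-open interval.\<close>
    define K where "K = 2 * m / \<epsilon> + 1"
    have K: "1 \<le> K" "2 * m < \<epsilon> * K" using m \<epsilon> by (auto simp: K_def field_simps)
    have "1 - \<epsilon> < measure (Q n) {-1<..K}" for n
    proof -
      let ?P = "measure (Q n) {-1<..K}"
      have e1: "exp (-1) \<le> (1 / 2 :: real)"
        using exp_ge_add_one_self[of "1::real"] by (simp add: exp_minus field_simps)
      have "1 - m / K \<le> exp (- \<phi> n (1 / K))"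
        using exp_ge_add_one_self[of "- \<phi> n (1 / K)"] \<phi>_le[of "1 / K" n] K by auto
      also have "\<dots> = (LINT x|Q n. exp (- (1 / K) * x))" using lap[of "1 / K" n] K by simp
      also have "\<dots> \<le> (LINT x|Q n. exp (-1) + (1 - exp (-1)) * indicator {-1<..K} x)"
      proof (rule integral_mono_AE)
        show "integrable (Q n) (\<lambda>x. exp (- (1 / K) * x))"
          using nonneg[of n] K by (intro Q.integrable_const_bound[where B = 1]) auto
        show "AE x in Q n. exp (- (1 / K) * x) \<le> exp (-1) + (1 - exp (-1)) * indicator {-1<..K} x"
          using nonneg[of n] by eventually_elim (use K in \<open>auto simp: indicator_def field_simps\<close>)
      qed (use order_trans[OF e1, of 2] in \<open>auto intro!: Q.integrable_const_bound[where B = 2] simp: indicator_def\<close>)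
      also have "\<dots> = exp (-1) + (1 - exp (-1)) * ?P"
        by (subst Bochner_Integration.integral_add)
           (auto simp: Q.prob_space[unfolded Q.space_eq_univ] intro!: Q.integrable_const_bound[where B = 1])
      finally have "(1 - exp (-1)) * (1 - ?P) \<le> m / K" by (simp add: algebra_simps)
      moreover have "1 / 2 * (1 - ?P) \<le> (1 - exp (-1)) * (1 - ?P)"
        using e1 by (intro mult_right_mono) auto
      ultimately have "1 - ?P \<le> 2 * m / K" by simp
      also have "\<dots> < \<epsilon>" using K by (simp add: field_simps)
      finally show ?thesis by simp
    qed
    then show "\<exists>a b. a < b \<and> (\<forall>n. 1 - \<epsilon> < measure (Q n) {a<..b})"
      using K by (intro exI[of _ "-1"] exI[of _ K]) auto
  qed
  then obtain r M where r: "strict_mono (r :: nat \<Rightarrow> nat)" and M: "real_distribution M"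
    and "weak_conv_m (Q \<circ> id \<circ> r) M"
    using tight_imp_convergent_subsubsequence[of Q id] by (auto simp: strict_mono_def)
  then have conv: "weak_conv_m (\<lambda>n. Q (r n)) M" by (simp add: comp_def)
  interpret M: real_distribution M by fact
  note wconv = weak_conv_imp_integral_bdd_continuous_conv[OF rd M conv]
  \<comment> \<open>A bounded continuous function vanishing exactly on the nonnegative reals: its
    integral stays 0 in the limit, so the limit law has no negative mass.\<close>
  have "(\<lambda>n. LINT x|Q (r n). max 0 (min 1 (- x))) \<longlonglongrightarrow> (LINT x|M. max 0 (min 1 (- x)))"
    by (rule wconv[where B = 1]) (auto intro!: continuous_intros)
  moreover have "(LINT x|Q (r n). max 0 (min 1 (- x))) = 0" for n
    using nonneg[of "r n"] by (intro integral_eq_zero_AE) (auto elim: eventually_mono)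
  ultimately have "(LINT x|M. max 0 (min 1 (- x))) = 0" by (simp add: LIMSEQ_const_iff)
  moreover have "integrable M (\<lambda>x. max 0 (min 1 (- x)))"
    by (rule M.integrable_const_bound[where B = 1]) auto
  ultimately have "AE x in M. max 0 (min 1 (- x)) = 0"
    by (subst (asm) integral_nonneg_eq_0_iff_AE) auto
  then have M_nonneg: "AE x in M. 0 \<le> x" by eventually_elim (auto simp: max_def min_def split: if_splits)
  have "laplace_law N M"
    unfolding laplace_law_def
  proof (intro conjI allI impI M M_nonneg)
    fix u :: real assume u: "0 \<le> u"
    \<comment> \<open>Weak convergence needs a bounded test function, and
      \<open>exp (- u * x)\<close> is unbounded on the negative reals; the modification is invisible
      to laws on the half-line.\<close>
    have eq: "(LINT x|R. exp (- u * max 0 x)) = (LINT x|R. exp (- u * x))"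
      if "real_distribution R" "AE x in R. 0 \<le> x" for R
    proof -
      interpret R: real_distribution R by fact
      show ?thesis
      proof (rule integral_cong_AE)
        show "AE x in R. exp (- u * max 0 x) = exp (- u * x)" using that(2) by eventually_elim simp
      qed auto
    qed
    have "(\<lambda>n. LINT x|Q (r n). exp (- u * max 0 x)) \<longlonglongrightarrow> (LINT x|M. exp (- u * max 0 x))"
      by (rule wconv[where B = 1]) (use u in \<open>auto intro!: continuous_intros\<close>)
    then have "(\<lambda>n. exp (- \<phi> (r n) u)) \<longlonglongrightarrow> (LINT x|M. exp (- u * x))"
      by (simp only: eq[OF rd nonneg] eq[OF M M_nonneg] lap[OF u])
    moreover have "(\<lambda>n. exp (- \<phi> (r n) u)) \<longlonglongrightarrow> exp (- (LINT s|N. 1 - exp (- u * s)))"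
      using LIMSEQ_subseq_LIMSEQ[OF \<phi>_lim[OF u] r] by (auto intro!: tendsto_intros simp: comp_def)
    ultimately show "(LINT x|M. exp (- u * x)) = exp (- (LINT s|N. 1 - exp (- u * s)))"
      by (rule LIMSEQ_unique)
  qed
  then show ?thesis ..
qed

text \<open>The Esscher transform damps the Levy measure by \<open>exp (- \<sigma> * s)\<close>,
  because \<open>exp (- \<sigma> * s) * (1 - exp (- u * s))\<close> is the difference of the
  integrands of the exponent at \<open>u + \<sigma>\<close> and \<sigma>. The new measure enters
  only through its exponent, so it can be given in any form.\<close>

lemma laplace_law_tilt:
  assumes law: "laplace_law N \<mu>" and \<sigma>: "0 \<le> \<sigma>"
    and N': "\<And>u. 0 \<le> u \<Longrightarrow>
      (LINT s|N'. 1 - exp (- u * s)) = (LINT s|N. exp (- \<sigma> * s) * (1 - exp (- u * s)))"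
  shows "laplace_law N' (density \<mu> (\<lambda>x. ennreal (exp (- \<sigma> * x + (LINT s|N. 1 - exp (- \<sigma> * s)))))) "
proof -
  interpret real_distribution \<mu> using law by (simp add: laplace_law_def)
  have nonneg: "AE x in \<mu>. 0 \<le> x" using law by (simp add: laplace_law_def)
  define c where "c = (LINT s|N. 1 - exp (- \<sigma> * s))"
  let ?\<mu> = "density \<mu> (\<lambda>x. ennreal (exp (- \<sigma> * x + c)))"
  have nn: "(\<integral>\<^sup>+x. ennreal (exp (- u * x)) \<partial>?\<mu>) = ennreal (exp (- (LINT s|N'. 1 - exp (- u * s))))"
    if u: "0 \<le> u" for u
  proof -
    have "(\<integral>\<^sup>+x. ennreal (exp (- u * x)) \<partial>?\<mu>)
        = (\<integral>\<^sup>+x. ennreal (exp (- \<sigma> * x + c)) * ennreal (exp (- u * x)) \<partial>\<mu>)"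
      by (rule nn_integral_density) auto
    also have "\<dots> = (\<integral>\<^sup>+x. ennreal (exp c) * ennreal (exp (- (u + \<sigma>) * x)) \<partial>\<mu>)"
      by (intro nn_integral_cong) (simp add: ennreal_mult[symmetric] exp_add[symmetric] algebra_simps)
    also have "\<dots> = ennreal (exp c) * ennreal (exp (- (LINT s|N. 1 - exp (- (u + \<sigma>) * s))))"
      using laplace_law_nn[OF law, of "u + \<sigma>"] u \<sigma> by (simp add: nn_integral_cmult)
    also have "\<dots> = ennreal (exp (c - (LINT s|N. 1 - exp (- (u + \<sigma>) * s))))"
      by (simp add: ennreal_mult[symmetric] exp_diff exp_minus divide_simps)
    also have "(LINT s|N. 1 - exp (- (u + \<sigma>) * s)) - c
        = (LINT s|N. (1 - exp (- (u + \<sigma>) * s)) - (1 - exp (- \<sigma> * s)))"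
      unfolding c_def
      by (rule Bochner_Integration.integral_diff[symmetric]) (use u \<sigma> integrable_one_minus_exp[of "u + \<sigma>"] integrable_one_minus_exp[of \<sigma>] in auto)
    then have "c - (LINT s|N. 1 - exp (- (u + \<sigma>) * s))
        = - (LINT s|N. (1 - exp (- (u + \<sigma>) * s)) - (1 - exp (- \<sigma> * s)))" by linarith
    also have "(\<lambda>s. (1 - exp (- (u + \<sigma>) * s)) - (1 - exp (- \<sigma> * s))) = (\<lambda>s. exp (- \<sigma> * s) * (1 - exp (- u * s)))"
      by (auto simp: fun_eq_iff right_diff_distrib exp_add[symmetric] algebra_simps)
    finally show ?thesis using N'[OF u] by simp
  qed
  have "emeasure ?\<mu> (space ?\<mu>) = (\<integral>\<^sup>+x. ennreal (exp (- 0 * x)) \<partial>?\<mu>)" by simp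
  also have "\<dots> = 1" by (subst nn) auto
  finally have rd: "real_distribution ?\<mu>"
    by (auto simp: real_distribution_def real_distribution_axioms_def intro: prob_spaceI)
  have "laplace_law N' ?\<mu>"
  proof (rule laplace_lawI_nn[OF rd _ nn])
    show "AE x in ?\<mu>. 0 \<le> x" using nonneg by (subst AE_density) (auto elim: eventually_mono)
  qed
  then show ?thesis by (simp add: c_def)
qed

text \<open>The positive exponent is reached without continuing the Laplace transform to the left:
  the law with Levy measure \<open>exp (\<theta> * s) * N\<close> exists, tilting it by \<theta>
  restores \<open>N\<close>, and uniqueness identifies the result with \<mu>. Under this
  representation the integrand becomes constant.\<close>

lemma laplace_law_exp_moment:
  assumes law: "laplace_law N \<mu>" and \<theta>: "0 \<le> \<theta>" and supp: "AE s in N. s \<le> a"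
  shows "(\<integral>\<^sup>+x. ennreal (exp (\<theta> * x)) \<partial>\<mu>) = ennreal (exp (LINT s|N. exp (\<theta> * s) - 1))"
proof -
  define f where "f s = indicator {..a} s * exp (\<theta> * s)" for s :: real
  have f: "0 \<le> f s" "f s \<le> exp (\<theta> * a)" for s
    using \<theta> by (auto simp: f_def indicator_def mult_left_mono)
  have [measurable]: "f \<in> borel_measurable borel" unfolding f_def by measurable
  define N' where "N' = density N (\<lambda>s. ennreal (f s))"
  interpret N': levy_measure N' unfolding N'_def by (rule levy_measure_density) (auto intro: f)
  have "integrable N' (\<lambda>s. s)"
  proof (rule Bochner_Integration.integrable_bound)
    show "integrable N' (\<lambda>s. (1 + \<bar>a\<bar>) * min 1 s)" using N'.integrable_min by simp
    have "AE s in N'. s \<le> a" unfolding N'_def using supp by (subst AE_density) (auto elim: eventually_mono)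
    with N'.AE_pos show "AE s in N'. norm s \<le> norm ((1 + \<bar>a\<bar>) * min 1 s)"
    proof eventually_elim
      case (elim s)
      show ?case
      proof (cases "s \<le> 1")
        case True
        then have "min 1 s = s" by simp
        then show ?thesis using elim by (simp add: abs_mult algebra_simps)
      qed (use elim in auto)
    qed
  qed simp
  then obtain \<mu>' where law': "laplace_law N' \<mu>'" using N'.laplace_law_exists by blast
  interpret \<mu>': real_distribution \<mu>' using law' by (simp add: laplace_law_def)
  define c where "c = (LINT s|N'. 1 - exp (- \<theta> * s))"
  let ?\<mu> = "density \<mu>' (\<lambda>x. ennreal (exp (- \<theta> * x + c)))"
  have AE_f: "AE s in N. f s * exp (- \<theta> * s) = 1"
    using supp by eventually_elim (simp add: f_def exp_add[symmetric])
  have "laplace_law N ?\<mu>"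
    unfolding c_def
  proof (rule N'.laplace_law_tilt[OF law' \<theta>])
    fix u :: real assume "0 \<le> u"
    have "(LINT s|N'. exp (- \<theta> * s) * (1 - exp (- u * s))) = (LINT s|N. f s * (exp (- \<theta> * s) * (1 - exp (- u * s))))"
      unfolding N'_def by (rule integral_density_real) (auto simp: f)
    also have "\<dots> = (LINT s|N. 1 - exp (- u * s))"
    proof (rule integral_cong_AE)
      show "AE s in N. f s * (exp (- \<theta> * s) * (1 - exp (- u * s))) = 1 - exp (- u * s)"
        using AE_f by eventually_elim (simp only: mult.assoc[symmetric] mult_1)
    qed auto
    finally show "(LINT s|N. 1 - exp (- u * s)) = (LINT s|N'. exp (- \<theta> * s) * (1 - exp (- u * s)))" ..
  qed
  then have \<mu>: "\<mu> = ?\<mu>" by (rule laplace_law_unique[OF law])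
  have "(\<integral>\<^sup>+x. ennreal (exp (\<theta> * x)) \<partial>\<mu>) = (\<integral>\<^sup>+x. ennreal (exp (- \<theta> * x + c)) * ennreal (exp (\<theta> * x)) \<partial>\<mu>')"
    unfolding \<mu> by (rule nn_integral_density) auto
  also have "\<dots> = (\<integral>\<^sup>+x. ennreal (exp c) \<partial>\<mu>')"
    by (intro nn_integral_cong) (simp add: ennreal_mult[symmetric] exp_add[symmetric])
  also have "\<dots> = ennreal (exp c)" using \<mu>'.emeasure_space_1 by simp
  also have "c = (LINT s|N. f s * (1 - exp (- \<theta> * s)))"
    unfolding c_def N'_def by (rule integral_density_real) (auto simp: f)
  also have "\<dots> = (LINT s|N. exp (\<theta> * s) - 1)"
  proof (rule integral_cong_AE)
    show "AE s in N. f s * (1 - exp (- \<theta> * s)) = exp (\<theta> * s) - 1"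
      using supp by eventually_elim (simp add: f_def right_diff_distrib exp_add[symmetric])
  qed auto
  finally show ?thesis .
qed

end

subsection \<open>Splitting off the large jumps\<close>

lemma (in levy_measure) AE_density_atMost:
  "AE s in density N (\<lambda>s. ennreal (indicator {..a} s)). s \<le> a"
  by (subst AE_density) (auto simp: indicator_def)

text \<open>In the upper bound the second term is integrated over \<mu> itself: once a jump beyond
  \<open>a\<close> is taken out, the rest of the compound Poisson part recombines with the small
  jumps to the full law. In the lower bound there is exactly one such jump, which leaves
  \<mu>'.\<close>

lemma (in levy_measure) laplace_law_decomposition:
  assumes law: "laplace_law N \<mu>" and a: "0 < a"
  obtains \<mu>' where "laplace_law (density N (\<lambda>s. ennreal (indicator {..a} s))) \<mu>'"
    "\<And>g. g \<in> borel_measurable borel \<Longrightarrow> (\<integral>\<^sup>+x. g x \<partial>\<mu>) \<le>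
       (\<integral>\<^sup>+x. g x \<partial>\<mu>') + (\<integral>\<^sup>+x. \<integral>\<^sup>+s. ennreal (indicator {a<..} s) * g (s + x) \<partial>N \<partial>\<mu>)"
    "\<And>g. g \<in> borel_measurable borel \<Longrightarrow>
       ennreal (exp (- measure N {a<..})) * (\<integral>\<^sup>+x. \<integral>\<^sup>+s. ennreal (indicator {a<..} s) * g (s + x) \<partial>N \<partial>\<mu>')
       \<le> (\<integral>\<^sup>+x. g x \<partial>\<mu>)"
proof -
  define A where "A = density N (\<lambda>s. ennreal (indicator {..a} s))"
  define B where "B = density N (\<lambda>s. ennreal (indicator {a<..} s))"
  have [measurable_cong, simp]: "sets A = sets borel" "sets B = sets borel" by (simp_all add: A_def B_def)
  interpret A: levy_measure A unfolding A_def
    by (rule levy_measure_density[where B = 1]) (auto simp: indicator_def)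
  interpret B: finite_measure B unfolding B_def by (rule finite_measure_truncated[OF a])
  have "integrable A (\<lambda>s. s)"
  proof (rule Bochner_Integration.integrable_bound)
    show "integrable A (\<lambda>s. (1 + \<bar>a\<bar>) * min 1 s)" using A.integrable_min by simp
    show "AE s in A. norm s \<le> norm ((1 + \<bar>a\<bar>) * min 1 s)"
      using A.AE_pos AE_density_atMost[of a, folded A_def]
    proof eventually_elim
      case (elim s)
      show ?case
      proof (cases "s \<le> 1")
        case True
        then have "min 1 s = s" by simp
        then show ?thesis using elim by (simp add: abs_mult algebra_simps)
      qed (use elim in auto)
    qed
  qed simp
  then obtain \<mu>' where law': "laplace_law A \<mu>'" using A.laplace_law_exists by blast
  have "AE s in B. 0 \<le> s" unfolding B_def using AE_pos by (subst AE_density) (auto elim: eventually_mono)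
  then obtain Q where Q: "laplace_law B Q"
    and Q_le: "\<And>g. g \<in> borel_measurable borel \<Longrightarrow> (\<integral>\<^sup>+x. g x \<partial>Q) \<le> g 0 + (\<integral>\<^sup>+y. \<integral>\<^sup>+s. g (s + y) \<partial>B \<partial>Q)"
    and Q_ge: "\<And>g. g \<in> borel_measurable borel \<Longrightarrow>
        ennreal (exp (- measure B UNIV)) * (\<integral>\<^sup>+s. g s \<partial>B) \<le> (\<integral>\<^sup>+x. g x \<partial>Q)"
    using compound_poisson[OF B.finite_measure_axioms] by auto
  have "laplace_law N (\<mu>' \<star> Q)"
  proof (rule laplace_law_convolution[OF law' Q])
    fix u :: real assume u: "0 \<le> u"
    have "(LINT s|A. 1 - exp (- u * s)) + (LINT s|B. 1 - exp (- u * s))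
        = (LINT s|N. indicator {..a} s * (1 - exp (- u * s))) + (LINT s|N. indicator {a<..} s * (1 - exp (- u * s)))"
      unfolding A_def B_def by (intro arg_cong2[where f = "(+)"] integral_density_real) auto
    also have "\<dots> = (LINT s|N. indicator {..a} s * (1 - exp (- u * s)) + indicator {a<..} s * (1 - exp (- u * s)))"
      by (rule Bochner_Integration.integral_add[symmetric])
         (rule integrable_mult_bounded[OF integrable_one_minus_exp[OF u], where B = 1]; simp)+
    also have "\<dots> = (LINT s|N. 1 - exp (- u * s))"
      by (rule Bochner_Integration.integral_cong) (auto simp: indicator_def)
    finally show "(LINT s|N. 1 - exp (- u * s)) = (LINT s|A. 1 - exp (- u * s)) + (LINT s|B. 1 - exp (- u * s))" ..
  qed
  then have \<mu>: "\<mu> = (\<mu>' \<star> Q)" by (rule laplace_law_unique[OF law])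
  have rd: "real_distribution \<mu>" "real_distribution \<mu>'" "real_distribution Q"
    using law law' Q by (auto simp: laplace_law_def)
  interpret \<mu>: real_distribution \<mu> by fact
  interpret \<mu>': real_distribution \<mu>' by fact
  interpret Q: real_distribution Q by fact
  have nn\<mu>: "(\<integral>\<^sup>+x. g x \<partial>\<mu>) = (\<integral>\<^sup>+x. \<integral>\<^sup>+y. g (x + y) \<partial>Q \<partial>\<mu>')" if "g \<in> borel_measurable borel" for g
    unfolding \<mu> using that by (intro nn_integral_convolution) (auto simp: real_distribution_finite rd)
  have nnB: "(\<integral>\<^sup>+s. g s \<partial>B) = (\<integral>\<^sup>+s. ennreal (indicator {a<..} s) * g s \<partial>N)"
    if "g \<in> borel_measurable borel" for g
    unfolding B_def using that by (subst nn_integral_density) auto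
  show ?thesis
  proof (rule that[of \<mu>'])
    show "laplace_law (density N (\<lambda>s. ennreal (indicator {..a} s))) \<mu>'" using law' by (simp add: A_def)
    fix g :: "real \<Rightarrow> ennreal" assume g [measurable]: "g \<in> borel_measurable borel"
    have "(\<integral>\<^sup>+x. g x \<partial>\<mu>) \<le> (\<integral>\<^sup>+x. g x + (\<integral>\<^sup>+y. \<integral>\<^sup>+s. g (s + (x + y)) \<partial>B \<partial>Q) \<partial>\<mu>')"
      unfolding nn\<mu>[OF g]
    proof (rule nn_integral_mono)
      fix x
      show "(\<integral>\<^sup>+y. g (x + y) \<partial>Q) \<le> g x + (\<integral>\<^sup>+y. \<integral>\<^sup>+s. g (s + (x + y)) \<partial>B \<partial>Q)"
        using Q_le[of "\<lambda>y. g (x + y)"] by (simp add: add_ac)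
    qed
    also have "\<dots> = (\<integral>\<^sup>+x. g x \<partial>\<mu>') + (\<integral>\<^sup>+x. \<integral>\<^sup>+y. \<integral>\<^sup>+s. g (s + (x + y)) \<partial>B \<partial>Q \<partial>\<mu>')"
      by (rule nn_integral_add) auto
    also have "(\<integral>\<^sup>+x. \<integral>\<^sup>+y. \<integral>\<^sup>+s. g (s + (x + y)) \<partial>B \<partial>Q \<partial>\<mu>') = (\<integral>\<^sup>+x. \<integral>\<^sup>+s. g (s + x) \<partial>B \<partial>\<mu>)"
      by (rule nn\<mu>[symmetric]) measurable
    also have "\<dots> = (\<integral>\<^sup>+x. \<integral>\<^sup>+s. ennreal (indicator {a<..} s) * g (s + x) \<partial>N \<partial>\<mu>)"
      by (intro nn_integral_cong nnB) measurable
    finally show "(\<integral>\<^sup>+x. g x \<partial>\<mu>) \<le>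
       (\<integral>\<^sup>+x. g x \<partial>\<mu>') + (\<integral>\<^sup>+x. \<integral>\<^sup>+s. ennreal (indicator {a<..} s) * g (s + x) \<partial>N \<partial>\<mu>)" .
    have "ennreal (exp (- measure N {a<..})) * (\<integral>\<^sup>+x. \<integral>\<^sup>+s. ennreal (indicator {a<..} s) * g (s + x) \<partial>N \<partial>\<mu>')
        = ennreal (exp (- measure B UNIV)) * (\<integral>\<^sup>+x. \<integral>\<^sup>+s. g (s + x) \<partial>B \<partial>\<mu>')"
      unfolding B_def finite_measure_truncated(2)[OF a]
      by (intro arg_cong2[where f = "(*)"] nn_integral_cong nnB[symmetric, unfolded B_def] refl) measurable
    also have "\<dots> = (\<integral>\<^sup>+x. ennreal (exp (- measure B UNIV)) * (\<integral>\<^sup>+s. g (s + x) \<partial>B) \<partial>\<mu>')"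
      by (rule nn_integral_cmult[symmetric]) measurable
    also have "\<dots> \<le> (\<integral>\<^sup>+x. \<integral>\<^sup>+y. g (x + y) \<partial>Q \<partial>\<mu>')"
    proof (rule nn_integral_mono)
      fix x
      show "ennreal (exp (- measure B UNIV)) * (\<integral>\<^sup>+s. g (s + x) \<partial>B) \<le> (\<integral>\<^sup>+y. g (x + y) \<partial>Q)"
        using Q_ge[of "\<lambda>y. g (x + y)"] by (simp add: add_ac)
    qed
    finally show "ennreal (exp (- measure N {a<..})) * (\<integral>\<^sup>+x. \<integral>\<^sup>+s. ennreal (indicator {a<..} s) * g (s + x) \<partial>N \<partial>\<mu>')
        \<le> (\<integral>\<^sup>+x. g x \<partial>\<mu>)" unfolding nn\<mu>[OF g] .
  qed
qed

text \<open>The condition on \<open>A\<close> covers both signs: upper tails with positive \<theta>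
  and lower tails with negative \<theta>.\<close>

lemma emeasure_le_exp_moment:
  assumes [simp]: "sets \<mu> = sets borel" and mom: "(\<integral>\<^sup>+x. ennreal (exp (\<theta> * x)) \<partial>\<mu>) \<le> ennreal E"
    and [measurable]: "A \<in> sets borel" and A: "\<And>x. x \<in> A \<Longrightarrow> \<theta> * c \<le> \<theta> * x"
  shows "emeasure \<mu> A \<le> ennreal (exp (- \<theta> * c) * E)"
proof -
  have [measurable_cong]: "sets \<mu> = sets borel" by simp
  have "emeasure \<mu> A = (\<integral>\<^sup>+x. indicator A x \<partial>\<mu>)" by simp
  also have "\<dots> \<le> (\<integral>\<^sup>+x. ennreal (exp (- \<theta> * c)) * ennreal (exp (\<theta> * x)) \<partial>\<mu>)"
  proof (rule nn_integral_mono)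
    fix x
    show "indicator A x \<le> ennreal (exp (- \<theta> * c)) * ennreal (exp (\<theta> * x))"
      using A[of x] by (cases "x \<in> A") (auto simp: ennreal_mult[symmetric] exp_add[symmetric])
  qed
  also have "\<dots> = ennreal (exp (- \<theta> * c)) * (\<integral>\<^sup>+x. ennreal (exp (\<theta> * x)) \<partial>\<mu>)"
    by (rule nn_integral_cmult) measurable
  also have "\<dots> \<le> ennreal (exp (- \<theta> * c)) * ennreal E" using mom by (rule mult_left_mono) simp
  finally show ?thesis by (simp add: ennreal_mult')
qed

lemma exp_neg_le_quadratic: "exp (- v) \<le> 1 - v + v\<^sup>2" if "0 \<le> v" for v :: real
proof -
  have "exp (- v) \<le> 1 / (1 + v)"
    using exp_ge_add_one_self[of v] that by (simp add: exp_minus divide_simps)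
  also have "\<dots> \<le> 1 - v + v\<^sup>2"
  proof -
    have "(1 - v + v\<^sup>2) * (1 + v) = 1 + v ^ 3" by (simp add: power2_eq_square power3_eq_cube algebra_simps)
    then show ?thesis using that by (simp add: divide_le_eq)
  qed
  finally show ?thesis .
qed

text \<open>Conditionally on no jump exceeding \<open>a\<close>, Chernoff's bound with the parameter \<open>4 / D\<close> controls both tails.\<close>

lemma (in levy_measure) concentration_of_small_jumps:
  assumes law: "laplace_law (density N (\<lambda>s. ennreal (indicator {..a} s))) \<mu>"
    and a: "0 < a" "4 * a \<le> D"
    and m: "integrable N (\<lambda>s. indicator {..a} s * s)"
    and V: "integrable N (\<lambda>s. indicator {..a} s * s\<^sup>2)" "32 * (LINT s|N. indicator {..a} s * s\<^sup>2) \<le> D\<^sup>2"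
  defines "m \<equiv> (LINT s|N. indicator {..a} s * s)"
  shows "ennreal (1 / 2) \<le> emeasure \<mu> {m - D..m + D}"
proof -
  define A where "A = density N (\<lambda>s. ennreal (indicator {..a} s))"
  interpret A: levy_measure A unfolding A_def
    by (rule levy_measure_density[where B = 1]) (auto simp: indicator_def)
  have lawA: "laplace_law A \<mu>" using law by (simp add: A_def)
  interpret \<mu>: real_distribution \<mu> using law by (simp add: laplace_law_def)
  define v where "v = (LINT s|N. indicator {..a} s * s\<^sup>2)"
  \<comment> \<open>\<open>4 * a \<le> D\<close> keeps \<open>\<theta> * s \<le> 1\<close> for all
    jumps, where \<open>exp x \<le> 1 + x + x^2\<close>; the variance hypothesis gives
    \<open>\<theta>^2 * v \<le> 1 / 2\<close>. Each tail then has mass at most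
    \<open>exp (- 4 + 1 / 2)\<close>, which is below 1/4.\<close>
  define \<theta> where "\<theta> = 4 / D"
  have D: "0 < D" using a by linarith
  have \<theta>: "0 < \<theta>" "\<theta> * a \<le> 1" "\<theta> * D = 4" using D a by (auto simp: \<theta>_def field_simps)
  have "\<theta>\<^sup>2 * v \<le> 1 / 2" using V(2) D by (simp add: \<theta>_def v_def field_simps)
  have bound: "integrable N (\<lambda>s. indicator {..a} s * (\<theta> * s + \<theta>\<^sup>2 * s\<^sup>2))"
    "integrable N (\<lambda>s. indicator {..a} s * (- (\<theta> * s) + \<theta>\<^sup>2 * s\<^sup>2))"
    "(LINT s|N. indicator {..a} s * (\<theta> * s + \<theta>\<^sup>2 * s\<^sup>2)) = \<theta> * m + \<theta>\<^sup>2 * v"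
    "(LINT s|N. indicator {..a} s * (- (\<theta> * s) + \<theta>\<^sup>2 * s\<^sup>2)) = - (\<theta> * m) + \<theta>\<^sup>2 * v"
  proof -
    have *: "(\<lambda>s. indicator {..a} s * (c * s + d * s\<^sup>2)) = (\<lambda>s. c * (indicator {..a} s * s) + d * (indicator {..a} s * s\<^sup>2))"
      for c d :: real by (auto simp: fun_eq_iff algebra_simps)
    have 1: "integrable N (\<lambda>s. indicator {..a} s * (c * s + d * s\<^sup>2))" for c d :: real
      unfolding * using m V(1) by simp
    have 2: "(LINT s|N. indicator {..a} s * (c * s + d * s\<^sup>2)) = c * m + d * v" for c d :: real
      unfolding * m_def v_def using m V(1) by simp
    show "integrable N (\<lambda>s. indicator {..a} s * (\<theta> * s + \<theta>\<^sup>2 * s\<^sup>2))"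
      "integrable N (\<lambda>s. indicator {..a} s * (- (\<theta> * s) + \<theta>\<^sup>2 * s\<^sup>2))"
      "(LINT s|N. indicator {..a} s * (\<theta> * s + \<theta>\<^sup>2 * s\<^sup>2)) = \<theta> * m + \<theta>\<^sup>2 * v"
      "(LINT s|N. indicator {..a} s * (- (\<theta> * s) + \<theta>\<^sup>2 * s\<^sup>2)) = - (\<theta> * m) + \<theta>\<^sup>2 * v"
      using 1[of \<theta> "\<theta>\<^sup>2"] 1[of "- \<theta>" "\<theta>\<^sup>2"] 2[of \<theta> "\<theta>\<^sup>2"] 2[of "- \<theta>" "\<theta>\<^sup>2"] by simp_all
  qed
  have nonneg: "0 \<le> (LINT s|N. indicator {..a} s * (\<theta> * s + \<theta>\<^sup>2 * s\<^sup>2))"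
    using AE_pos by (intro integral_nonneg_AE) (use \<theta> in \<open>auto elim: eventually_mono\<close>)
  have up: "(LINT s|A. exp (\<theta> * s) - 1) \<le> \<theta> * m + \<theta>\<^sup>2 * v"
  proof -
    have "(LINT s|A. exp (\<theta> * s) - 1) = (LINT s|N. indicator {..a} s * (exp (\<theta> * s) - 1))"
      unfolding A_def by (rule integral_density_real) auto
    also have "\<dots> \<le> (LINT s|N. indicator {..a} s * (\<theta> * s + \<theta>\<^sup>2 * s\<^sup>2))"
    proof (rule integral_mono_AE')
      show "AE s in N. indicator {..a} s * (exp (\<theta> * s) - 1) \<le> indicator {..a} s * (\<theta> * s + \<theta>\<^sup>2 * s\<^sup>2)"
        using AE_pos
      proof eventually_elim
        case (elim s)
        show ?case
        proof (cases "s \<le> a")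
          case True
          then have "\<theta> * s \<le> \<theta> * a" using \<theta> by simp
          then have "\<theta> * s \<le> 1" using \<theta> by linarith
          then have "exp (\<theta> * s) \<le> 1 + \<theta> * s + (\<theta> * s)\<^sup>2"
            using \<theta> elim by (intro exp_bound) auto
          then show ?thesis by (simp add: power_mult_distrib indicator_def)
        qed simp
      qed
      show "AE s in N. 0 \<le> indicator {..a} s * (\<theta> * s + \<theta>\<^sup>2 * s\<^sup>2)"
        using AE_pos by eventually_elim (use \<theta> in auto)
    qed (rule bound)
    finally show ?thesis unfolding bound .
  qed
  have dn: "- (LINT s|A. 1 - exp (- \<theta> * s)) \<le> - (\<theta> * m) + \<theta>\<^sup>2 * v"
  proof -
    have "- (LINT s|A. 1 - exp (- \<theta> * s)) = - (LINT s|N. indicator {..a} s * (1 - exp (- \<theta> * s)))"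
      unfolding A_def by (subst integral_density_real) auto
    also have "\<dots> = (LINT s|N. - (indicator {..a} s * (1 - exp (- \<theta> * s))))" by simp
    also have "\<dots> \<le> (LINT s|N. indicator {..a} s * (- (\<theta> * s) + \<theta>\<^sup>2 * s\<^sup>2))"
    proof (rule integral_mono_AE)
      have "integrable N (\<lambda>s. indicator {..a} s * (1 - exp (- \<theta> * s)))"
        by (rule integrable_mult_bounded[OF integrable_one_minus_exp, where B = 1]) (use \<theta> in auto)
      then show "integrable N (\<lambda>s. - (indicator {..a} s * (1 - exp (- \<theta> * s))))" by simp
      show "AE s in N. - (indicator {..a} s * (1 - exp (- \<theta> * s))) \<le> indicator {..a} s * (- (\<theta> * s) + \<theta>\<^sup>2 * s\<^sup>2)"
        using AE_pos
      proof eventually_elim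
        case (elim s)
        show ?case using exp_neg_le_quadratic[of "\<theta> * s"] elim \<theta>
          by (auto simp: power_mult_distrib indicator_def)
      qed
    qed (rule bound)
    finally show ?thesis unfolding bound .
  qed
  have e: "exp (- 7 / 2) \<le> (1 / 4 :: real)"
  proof -
    have "(4::real) \<le> 1 + 7 / 2" by simp
    also have "\<dots> \<le> exp (7 / 2)" by (rule exp_ge_add_one_self)
    finally show ?thesis by (simp add: exp_minus divide_simps)
  qed
  have "emeasure \<mu> {m + D<..} \<le> ennreal (exp (- \<theta> * (m + D)) * exp (\<theta> * m + \<theta>\<^sup>2 * v))"
    using \<theta> up
    by (intro emeasure_le_exp_moment) (auto simp: A.laplace_law_exp_moment[OF lawA _ AE_density_atMost[of a, folded A_def]])
  also have "exp (- \<theta> * (m + D)) * exp (\<theta> * m + \<theta>\<^sup>2 * v) = exp (- 4 + \<theta>\<^sup>2 * v)"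
    using \<theta> by (simp add: exp_add[symmetric] distrib_left)
  also have "\<dots> \<le> exp (- 7 / 2)" using \<open>\<theta>\<^sup>2 * v \<le> 1 / 2\<close> by simp
  also note e
  finally have 1: "emeasure \<mu> {m + D<..} \<le> ennreal (1 / 4)" by (simp add: ennreal_leI)
  have "emeasure \<mu> {..<m - D} \<le> ennreal (exp (- (- \<theta>) * (m - D)) * exp (- (\<theta> * m) + \<theta>\<^sup>2 * v))"
    using \<theta> dn laplace_law_nn[OF lawA, of \<theta>]
    by (intro emeasure_le_exp_moment) auto
  also have "exp (- (- \<theta>) * (m - D)) * exp (- (\<theta> * m) + \<theta>\<^sup>2 * v) = exp (- 4 + \<theta>\<^sup>2 * v)"
    using \<theta> by (simp add: exp_add[symmetric] right_diff_distrib)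
  also have "\<dots> \<le> exp (- 7 / 2)" using \<open>\<theta>\<^sup>2 * v \<le> 1 / 2\<close> by simp
  also note e
  finally have 2: "emeasure \<mu> {..<m - D} \<le> ennreal (1 / 4)" by (simp add: ennreal_leI)
  have m1: "measure \<mu> {m + D<..} \<le> 1 / 4" "measure \<mu> {..<m - D} \<le> 1 / 4"
    using 1 2 by (simp_all add: \<mu>.emeasure_eq_measure)
  have "{..<m - D} \<union> {m - D..m + D} \<union> {m + D<..} = UNIV" using D by auto
  then have "1 = measure \<mu> ({..<m - D} \<union> {m - D..m + D} \<union> {m + D<..})"
    using \<mu>.prob_space by simp
  also have "\<dots> \<le> measure \<mu> ({..<m - D} \<union> {m - D..m + D}) + measure \<mu> {m + D<..}"
    by (rule measure_Un_le) auto
  also have "measure \<mu> ({..<m - D} \<union> {m - D..m + D}) \<le> measure \<mu> {..<m - D} + measure \<mu> {m - D..m + D}"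
    by (rule measure_Un_le) auto
  finally have "1 / 2 \<le> measure \<mu> {m - D..m + D}" using m1 by linarith
  then show ?thesis unfolding \<mu>.emeasure_eq_measure by (rule ennreal_leI)
qed

lemma nn_integral_lborel_translate:
  fixes g :: "real \<Rightarrow> ennreal"
  assumes "g \<in> borel_measurable borel"
  shows "(\<integral>\<^sup>+s. g (s + x) \<partial>lborel) = (\<integral>\<^sup>+s. g s \<partial>lborel)"
  using nn_integral_real_affine[OF assms, of 1 x] by (simp add: add.commute)

text \<open>With probability at least 1/2 the small jumps add up to within \<open>D\<close> of their
  mean \<open>m\<close>. From each such position an interval of jump sizes of length
  \<open>w\<close>, lying above \<open>a\<close>, leads to the target, and there the Levy density is
  at least \<open>k\<close>.\<close>

theorem (in levy_measure) one_big_jump_lower_bound: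
  assumes law: "laplace_law N \<mu>"
    and N: "N = density lborel (\<lambda>s. ennreal (n s))" and [measurable]: "n \<in> borel_measurable borel"
    and a: "0 < a" "4 * a \<le> D"
    and m: "integrable N (\<lambda>s. indicator {..a} s * s)"
    and V: "integrable N (\<lambda>s. indicator {..a} s * s\<^sup>2)" "32 * (LINT s|N. indicator {..a} s * s\<^sup>2) \<le> D\<^sup>2"
  defines "m \<equiv> (LINT s|N. indicator {..a} s * s)"
  assumes w: "0 \<le> w" and k: "0 \<le> k" and x0: "a \<le> x0 - m - D"
    and nk: "\<And>s. x0 - m - D \<le> s \<Longrightarrow> s \<le> x0 - m + D + w \<Longrightarrow> k \<le> n s"
  shows "ennreal (exp (- measure N {a<..}) / 2 * k * w) \<le> emeasure \<mu> {x0..x0 + w}"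
proof -
  obtain \<mu>' where law': "laplace_law (density N (\<lambda>s. ennreal (indicator {..a} s))) \<mu>'"
    and ge: "\<And>g. g \<in> borel_measurable borel \<Longrightarrow>
       ennreal (exp (- measure N {a<..})) * (\<integral>\<^sup>+x. \<integral>\<^sup>+s. ennreal (indicator {a<..} s) * g (s + x) \<partial>N \<partial>\<mu>')
       \<le> (\<integral>\<^sup>+x. g x \<partial>\<mu>)"
    by (rule laplace_law_decomposition[OF law a(1)]) (rule that; assumption)
  interpret \<mu>: real_distribution \<mu> using law by (simp add: laplace_law_def)
  interpret \<mu>': real_distribution \<mu>' using law' by (simp add: laplace_law_def)
  have half: "ennreal (1 / 2) \<le> emeasure \<mu>' {m - D..m + D}"
    unfolding m_def by (rule concentration_of_small_jumps[OF law' a m V])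
  have inner: "ennreal (k * w) * indicator {m - D..m + D} x
      \<le> (\<integral>\<^sup>+s. ennreal (indicator {a<..} s) * indicator {x0..x0 + w} (s + x) \<partial>N)" for x
  proof (cases "x \<in> {m - D..m + D}")
    case True
    \<comment> \<open>Left-open, so that its points exceed \<open>a\<close> strictly even when
      \<open>x0 - x = a\<close>.\<close>
    have "ennreal (k * w) = (\<integral>\<^sup>+s. ennreal k * indicator {x0 - x<..x0 - x + w} s \<partial>lborel)"
      using k w by (simp add: nn_integral_cmult ennreal_mult)
    also have "\<dots> \<le> (\<integral>\<^sup>+s. ennreal (n s) * (ennreal (indicator {a<..} s) * indicator {x0..x0 + w} (s + x)) \<partial>lborel)"
    proof (rule nn_integral_mono)
      fix s
      show "ennreal k * indicator {x0 - x<..x0 - x + w} s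
        \<le> ennreal (n s) * (ennreal (indicator {a<..} s) * indicator {x0..x0 + w} (s + x))"
        using nk[of s] True x0 by (auto simp: indicator_def ennreal_leI)
    qed
    also have "\<dots> = (\<integral>\<^sup>+s. ennreal (indicator {a<..} s) * indicator {x0..x0 + w} (s + x) \<partial>N)"
      unfolding N by (subst nn_integral_density) auto
    finally show ?thesis using True by simp
  qed simp
  have "ennreal (exp (- measure N {a<..}) / 2 * k * w)
      = ennreal (exp (- measure N {a<..})) * (ennreal (k * w) * ennreal (1 / 2))"
  proof -
    have "ennreal (k * w) * ennreal (1 / 2) = ennreal (k * w * (1 / 2))"
      by (rule ennreal_mult[symmetric]) (use k w in auto)
    moreover have "ennreal (exp (- measure N {a<..})) * ennreal (k * w * (1 / 2))
        = ennreal (exp (- measure N {a<..}) * (k * w * (1 / 2)))"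
      by (rule ennreal_mult[symmetric]) (use k w in auto)
    ultimately show ?thesis by (simp add: mult_ac)
  qed
  also have "\<dots> \<le> ennreal (exp (- measure N {a<..})) * (ennreal (k * w) * emeasure \<mu>' {m - D..m + D})"
    by (intro mult_left_mono half) auto
  also have "ennreal (k * w) * emeasure \<mu>' {m - D..m + D} = (\<integral>\<^sup>+x. ennreal (k * w) * indicator {m - D..m + D} x \<partial>\<mu>')"
    by (simp add: nn_integral_cmult)
  also have "\<dots> \<le> (\<integral>\<^sup>+x. \<integral>\<^sup>+s. ennreal (indicator {a<..} s) * indicator {x0..x0 + w} (s + x) \<partial>N \<partial>\<mu>')"
    by (intro nn_integral_mono inner)
  also have "ennreal (exp (- measure N {a<..})) * \<dots> \<le> (\<integral>\<^sup>+x. indicator {x0..x0 + w} x \<partial>\<mu>)"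
    by (rule ge) auto
  finally show ?thesis by (simp add: mult_left_mono)
qed

text \<open>\<open>g\<close> is a general function because the application uses an interval
  indicator smoothed by a second copy of the law. Without a large jump, Chernoff's bound at
  \<open>X\<close> applies; a large jump has density at most \<open>K\<close>, and by translation
  invariance of Lebesgue measure it does not matter where the other jumps lead.\<close>

theorem (in levy_measure) one_big_jump_upper_bound:
  fixes g :: "real \<Rightarrow> ennreal"
  assumes law: "laplace_law N \<mu>"
    and N: "N = density lborel (\<lambda>s. ennreal (n s))" and [measurable]: "n \<in> borel_measurable borel"
    and a: "0 < a" and K: "\<And>s. a < s \<Longrightarrow> n s \<le> K" "0 \<le> K"
    and \<theta>: "0 \<le> \<theta>"
    and g [measurable]: "g \<in> borel_measurable borel" and gG: "\<And>x. g x \<le> ennreal G" "0 \<le> G"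
    and gX: "\<And>x. x < X \<Longrightarrow> g x = 0"
  shows "(\<integral>\<^sup>+x. g x \<partial>\<mu>) \<le> ennreal (G * exp (- \<theta> * X + (LINT s|N. indicator {..a} s * (exp (\<theta> * s) - 1))))
    + ennreal K * (\<integral>\<^sup>+x. g x \<partial>lborel)"
proof -
  obtain \<mu>' where law': "laplace_law (density N (\<lambda>s. ennreal (indicator {..a} s))) \<mu>'"
    and le: "\<And>g. g \<in> borel_measurable borel \<Longrightarrow> (\<integral>\<^sup>+x. g x \<partial>\<mu>) \<le>
       (\<integral>\<^sup>+x. g x \<partial>\<mu>') + (\<integral>\<^sup>+x. \<integral>\<^sup>+s. ennreal (indicator {a<..} s) * g (s + x) \<partial>N \<partial>\<mu>)"
    by (rule laplace_law_decomposition[OF law a]) (rule that; assumption)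
  define A where "A = density N (\<lambda>s. ennreal (indicator {..a} s))"
  interpret A: levy_measure A unfolding A_def
    by (rule levy_measure_density[where B = 1]) (auto simp: indicator_def)
  have lawA: "laplace_law A \<mu>'" using law' by (simp add: A_def)
  interpret \<mu>: real_distribution \<mu> using law by (simp add: laplace_law_def)
  interpret \<mu>': real_distribution \<mu>' using law' by (simp add: laplace_law_def)
  define E where "E = (LINT s|N. indicator {..a} s * (exp (\<theta> * s) - 1))"
  have E: "(LINT s|A. exp (\<theta> * s) - 1) = E"
    unfolding A_def E_def by (rule integral_density_real) auto
  have "(\<integral>\<^sup>+x. g x \<partial>\<mu>') \<le> (\<integral>\<^sup>+x. ennreal (G * exp (- \<theta> * X)) * ennreal (exp (\<theta> * x)) \<partial>\<mu>')"
  proof (rule nn_integral_mono)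
    fix x
    show "g x \<le> ennreal (G * exp (- \<theta> * X)) * ennreal (exp (\<theta> * x))"
    proof (cases "x < X")
      case False
      then have "G * 1 \<le> G * exp (\<theta> * (x - X))" using gG \<theta> by (intro mult_left_mono) auto
      also have "\<dots> = G * exp (- \<theta> * X) * exp (\<theta> * x)" by (simp add: mult.assoc exp_add[symmetric] algebra_simps)
      finally show ?thesis using gG by (auto simp: ennreal_mult'[symmetric] intro!: order_trans[OF gG(1)] ennreal_leI)
    qed (simp add: gX)
  qed
  also have "\<dots> = ennreal (G * exp (- \<theta> * X)) * ennreal (exp E)"
    using A.laplace_law_exp_moment[OF lawA \<theta> AE_density_atMost[of a, folded A_def]] E
    by (simp add: nn_integral_cmult)
  also have "\<dots> = ennreal (G * exp (- \<theta> * X + E))"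
    unfolding exp_add using gG by (simp add: ennreal_mult[symmetric] mult.assoc)
  finally have 1: "(\<integral>\<^sup>+x. g x \<partial>\<mu>') \<le> ennreal (G * exp (- \<theta> * X + E))" .
  have "(\<integral>\<^sup>+x. \<integral>\<^sup>+s. ennreal (indicator {a<..} s) * g (s + x) \<partial>N \<partial>\<mu>) \<le> (\<integral>\<^sup>+x. ennreal K * (\<integral>\<^sup>+x. g x \<partial>lborel) \<partial>\<mu>)"
  proof (rule nn_integral_mono)
    fix x
    have "(\<integral>\<^sup>+s. ennreal (indicator {a<..} s) * g (s + x) \<partial>N)
        = (\<integral>\<^sup>+s. ennreal (n s) * (ennreal (indicator {a<..} s) * g (s + x)) \<partial>lborel)"
      unfolding N by (rule nn_integral_density) auto
    also have "\<dots> \<le> (\<integral>\<^sup>+s. ennreal K * g (s + x) \<partial>lborel)"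
      by (rule nn_integral_mono) (auto simp: indicator_def intro!: mult_right_mono ennreal_leI K)
    also have "\<dots> = ennreal K * (\<integral>\<^sup>+x. g x \<partial>lborel)"
      by (subst nn_integral_cmult) (auto simp: nn_integral_lborel_translate)
    finally show "(\<integral>\<^sup>+s. ennreal (indicator {a<..} s) * g (s + x) \<partial>N) \<le> ennreal K * (\<integral>\<^sup>+x. g x \<partial>lborel)" .
  qed
  also have "\<dots> = ennreal K * (\<integral>\<^sup>+x. g x \<partial>lborel)" using \<mu>.emeasure_space_1 by simp
  finally show ?thesis using le[OF g] 1 unfolding E_def[symmetric] by (meson add_mono order_trans)
qed

section \<open>The Laplace exponent and the function H\<close>

text \<open>The integral of \<open>w * exp (- w)\<close> from 0 to \<open>v\<close>. Integrating
  \<open>H_kernel (u * s)\<close> over the jumps gives \<open>H u\<close>; as the kernel is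
  comparable with \<open>min 1 (v^2)\<close>, \<open>H u\<close> is a truncated second moment of the
  jumps at scale \<open>1 / u\<close>.\<close>

definition H_kernel :: "real \<Rightarrow> real" where
  "H_kernel v = 1 - exp (- v) - v * exp (- v)"

lemma H_kernel_derivative: "(H_kernel has_real_derivative v * exp (- v)) (at v)"
  unfolding H_kernel_def by (auto intro!: derivative_eq_intros simp: algebra_simps)

lemma H_kernel_measurable [measurable]: "H_kernel \<in> borel_measurable borel"
  unfolding H_kernel_def by measurable

lemma H_kernel_strict_mono:
  assumes "0 \<le> u" "u < v"
  shows "H_kernel u < H_kernel v"
proof (rule DERIV_pos_imp_increasing_open[OF assms(2)])
  fix x assume "u < x" "x < v"
  then show "\<exists>y. (H_kernel has_real_derivative y) (at x) \<and> 0 < y"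
    using assms by (intro exI[of _ "x * exp (- x)"] conjI H_kernel_derivative) auto
next
  show "continuous_on {u..v} H_kernel"
    using H_kernel_derivative by (meson DERIV_isCont continuous_at_imp_continuous_on)
qed

lemma H_kernel_mono: "0 \<le> u \<Longrightarrow> u \<le> v \<Longrightarrow> H_kernel u \<le> H_kernel v"
  using H_kernel_strict_mono[of u v] by (cases "u = v") auto

lemma H_kernel_nonneg: "0 \<le> v \<Longrightarrow> 0 \<le> H_kernel v"
  using H_kernel_mono[of 0 v] by (simp add: H_kernel_def)

lemma H_kernel_le_1: "0 \<le> v \<Longrightarrow> H_kernel v \<le> 1"
  using mult_nonneg_nonneg[of v "exp (- v)"] exp_ge_zero[of "- v"] unfolding H_kernel_def by linarith

lemma H_kernel_le_square: "0 \<le> v \<Longrightarrow> H_kernel v \<le> v\<^sup>2"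
proof -
  assume v: "0 \<le> v"
  have "(1 - v) * (1 + v) \<le> exp (- v) * (1 + v)"
    using exp_ge_add_one_self[of "- v"] v by (intro mult_right_mono) auto
  then show ?thesis by (simp add: H_kernel_def algebra_simps power2_eq_square)
qed

text \<open>The difference of the two sides has derivative
  \<open>k^2 * v * (exp (- v) - exp (- (k * v)))\<close> in \<open>v\<close>. This is the source of
  the doubling property of \<open>H\<close>, which holds at all scales and for every \<nu>.\<close>

lemma H_kernel_scale:
  assumes "0 \<le> v" "1 \<le> k"
  shows "H_kernel (k * v) \<le> k\<^sup>2 * H_kernel v"
proof -
  have "k\<^sup>2 * H_kernel 0 - H_kernel (k * 0) \<le> k\<^sup>2 * H_kernel v - H_kernel (k * v)"
  proof (rule DERIV_nonneg_imp_nondecreasing[OF assms(1)])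
    fix x assume x: "0 \<le> x" "x \<le> v"
    have "((\<lambda>x. k\<^sup>2 * H_kernel x - H_kernel (k * x)) has_real_derivative
        k\<^sup>2 * (x * exp (- x)) - (k * x) * exp (- (k * x)) * k) (at x)"
      by (auto intro!: derivative_eq_intros DERIV_chain2[OF H_kernel_derivative] H_kernel_derivative)
    moreover have "k\<^sup>2 * (x * exp (- x)) - (k * x) * exp (- (k * x)) * k = k\<^sup>2 * x * (exp (- x) - exp (- (k * x)))"
      by (simp add: power2_eq_square algebra_simps)
    moreover have "x * 1 \<le> x * k" using x assms by (intro mult_left_mono) auto
    then have "0 \<le> k\<^sup>2 * x * (exp (- x) - exp (- (k * x)))"
      using x by (intro mult_nonneg_nonneg) (auto simp: mult.commute)
    ultimately show "\<exists>y. ((\<lambda>x. k\<^sup>2 * H_kernel x - H_kernel (k * x)) has_real_derivative y) (at x) \<and> 0 \<le> y"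
      by auto
  qed
  then show ?thesis by (simp add: H_kernel_def)
qed

text \<open>Up to 1 the derivatives compare, \<open>6 * v * exp (- v)\<close> being at least
  \<open>2 * v\<close> because e is at most 3; beyond 1 the left side is constant and the kernel
  increases.\<close>

lemma min_1_square_le_H_kernel:
  assumes "0 \<le> v"
  shows "min 1 (v\<^sup>2) \<le> 6 * H_kernel v"
proof -
  have small: "v\<^sup>2 \<le> 6 * H_kernel v" if v: "0 \<le> v" "v \<le> 1" for v
  proof -
    have "6 * H_kernel 0 - 0\<^sup>2 \<le> 6 * H_kernel v - v\<^sup>2"
    proof (rule DERIV_nonneg_imp_nondecreasing[OF v(1)])
      fix x assume x: "0 \<le> x" "x \<le> v"
      have "((\<lambda>x. 6 * H_kernel x - x\<^sup>2) has_real_derivative 6 * (x * exp (- x)) - 2 * x) (at x)"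
        by (auto intro!: derivative_eq_intros H_kernel_derivative)
      moreover have "1 / 3 \<le> exp (- x)"
      proof -
        have "exp x \<le> exp 1" using x v by simp
        then have "exp x \<le> 3" using exp_le by linarith
        then show ?thesis by (simp add: exp_minus divide_simps)
      qed
      then have "x * (1 / 3) \<le> x * exp (- x)" using x by (intro mult_left_mono) auto
      then have "0 \<le> 6 * (x * exp (- x)) - 2 * x" by simp
      ultimately show "\<exists>y. ((\<lambda>x. 6 * H_kernel x - x\<^sup>2) has_real_derivative y) (at x) \<and> 0 \<le> y" by blast
    qed
    then show ?thesis by (simp add: H_kernel_def)
  qed
  show ?thesis
  proof (cases "v \<le> 1")
    case True
    then show ?thesis using small[of v] assms by simp
  next
    case False
    then show ?thesis using small[of 1] H_kernel_mono[of 1 v] by simp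
  qed
qed

lemma square_exp_le_min:
  fixes v :: real
  assumes "0 \<le> v"
  shows "v\<^sup>2 * exp (- v) \<le> min 1 (v\<^sup>2)"
proof -
  have "v\<^sup>2 * exp (- v) \<le> v\<^sup>2 * 1" using assms by (intro mult_left_mono) auto
  moreover have "v\<^sup>2 * exp (- v) \<le> 1"
  proof -
    have "v / 2 \<le> exp (v / 2 - 1)" using exp_ge_add_one_self[of "v / 2 - 1"] by simp
    also have "\<dots> \<le> exp (v / 2) / 2"
      unfolding exp_diff by (intro divide_left_mono) (use exp_ge_add_one_self[of "1::real"] in auto)
    finally have "v\<^sup>2 \<le> (exp (v / 2))\<^sup>2" using assms by (intro power_mono) auto
    moreover have "(exp (v / 2))\<^sup>2 = exp v" by (simp add: exp_double[symmetric])
    ultimately show ?thesis by (simp add: exp_minus divide_simps)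
  qed
  ultimately show ?thesis by simp
qed

subsection \<open>Integrals against the Levy measure\<close>

text \<open>Extension by 0, since \<nu> is arbitrary outside the positive reals; the result is
  measurable and nonnegative on the whole line.\<close>

definition jump_density :: "(real \<Rightarrow> real) \<Rightarrow> real \<Rightarrow> real" where
  "jump_density \<nu> s = indicator {0<..} s * \<nu> s"

text \<open>With the factor \<open>t\<close> this is the Levy measure of the process at time
  \<open>t\<close>.\<close>

definition jumps :: "(real \<Rightarrow> real) \<Rightarrow> real \<Rightarrow> real measure" where
  "jumps \<nu> t = density lborel (\<lambda>s. ennreal (t * jump_density \<nu> s))"

locale levy_nu =
  fixes \<nu> :: "real \<Rightarrow> real"
  assumes levy: "levy_density \<nu>"
begin

abbreviation "L \<equiv> jumps \<nu> 1"

lemma jump_density_measurable [measurable]: "jump_density \<nu> \<in> borel_measurable borel"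
  using levy by (simp add: levy_density_def set_borel_measurable_def jump_density_def[abs_def])

lemma jump_density_nonneg: "0 \<le> jump_density \<nu> s"
  using levy by (auto simp: levy_density_def jump_density_def indicator_def)

lemma jump_density_pos [simp]: "0 < s \<Longrightarrow> jump_density \<nu> s = \<nu> s"
  by (simp add: jump_density_def)

lemma levy_measure_jumps:
  assumes t: "0 < t"
  shows "levy_measure (jumps \<nu> t)"
proof
  show "sets (jumps \<nu> t) = sets borel" by (simp add: jumps_def)
  show "AE s in jumps \<nu> t. 0 < s"
  proof -
    have "(\<lambda>s. ennreal (t * jump_density \<nu> s)) \<in> borel_measurable lborel" by measurable
    from AE_density[OF this] show ?thesis
      unfolding jumps_def by (auto simp: jump_density_def indicator_def)
  qed
  have "integrable lborel (\<lambda>s. indicator {0<..} s * (min 1 s * \<nu> s))"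
    using levy by (simp add: levy_density_def set_integrable_def)
  also have "(\<lambda>s. indicator {0<..} s * (min 1 s * \<nu> s)) = (\<lambda>s. jump_density \<nu> s * min 1 s)"
    by (auto simp: jump_density_def)
  finally have "integrable lborel (\<lambda>s. t * jump_density \<nu> s * min 1 s)" by (simp add: mult.assoc)
  then show "integrable (jumps \<nu> t) (\<lambda>s. min 1 s)"
    unfolding jumps_def using t jump_density_nonneg by (subst integrable_density) auto
qed

sublocale L: levy_measure L by (rule levy_measure_jumps) simp

lemma integral_jumps:
  fixes f :: "real \<Rightarrow> real"
  assumes t: "0 < t" and [measurable]: "f \<in> borel_measurable borel"
  shows "(LINT s|jumps \<nu> t. f s) = t * (LINT s|L. f s)"
  unfolding jumps_def using t jump_density_nonneg
  by (subst (1 2) integral_density) (auto simp: mult.assoc)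

lemma integrable_jumps:
  fixes f :: "real \<Rightarrow> real"
  assumes t: "0 < t" and [measurable]: "f \<in> borel_measurable borel" and "integrable L f"
  shows "integrable (jumps \<nu> t) f"
proof -
  have "integrable lborel (\<lambda>s. jump_density \<nu> s * f s)"
    using assms(3) jump_density_nonneg unfolding jumps_def by (subst (asm) integrable_density) auto
  then have "integrable lborel (\<lambda>s. t * jump_density \<nu> s * f s)" by (simp add: mult.assoc)
  then show ?thesis
    unfolding jumps_def using t jump_density_nonneg by (subst integrable_density) auto
qed

lemma integral_L:
  fixes f :: "real \<Rightarrow> real"
  assumes [measurable]: "f \<in> borel_measurable borel"
  shows "(LINT s|L. f s) = (LINT s|lborel. jump_density \<nu> s * f s)"
  unfolding jumps_def using jump_density_nonneg by (subst integral_density) auto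

lemma AE_L_I: "(\<And>s. 0 < s \<Longrightarrow> P s) \<Longrightarrow> AE s in L. P s"
  using L.AE_pos by (auto elim: eventually_mono)

lemma integrable_L_bound:
  fixes f :: "real \<Rightarrow> real"
  assumes [measurable]: "f \<in> borel_measurable borel" and f: "\<And>s. 0 < s \<Longrightarrow> \<bar>f s\<bar> \<le> C * min 1 s"
  shows "integrable L f"
proof (rule Bochner_Integration.integrable_bound)
  show "integrable L (\<lambda>s. C * min 1 s)" using L.integrable_min by simp
  show "AE s in L. norm (f s) \<le> norm (C * min 1 s)"
    by (rule AE_L_I) (metis f abs_ge_self order_trans real_norm_def)
qed simp

lemma integral_L_mono:
  fixes f g :: "real \<Rightarrow> real"
  assumes "integrable L f" "integrable L g" "\<And>s. 0 < s \<Longrightarrow> f s \<le> g s"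
  shows "(LINT s|L. f s) \<le> (LINT s|L. g s)"
  by (rule integral_mono_AE[OF assms(1,2) AE_L_I]) (rule assms(3))

lemma integral_L_nonneg:
  fixes f :: "real \<Rightarrow> real"
  assumes "\<And>s. 0 < s \<Longrightarrow> 0 \<le> f s"
  shows "0 \<le> (LINT s|L. f s)"
  by (rule integral_nonneg_AE[OF AE_L_I]) (rule assms)

section \<open>The Laplace exponent, its derivative and H as integrals over the jumps\<close>

definition \<phi> :: "real \<Rightarrow> real" where "\<phi> u = (LINT s|L. 1 - exp (- u * s))"
definition \<phi>' :: "real \<Rightarrow> real" where "\<phi>' u = (LINT s|L. s * exp (- u * s))"
definition H :: "real \<Rightarrow> real" where "H u = (LINT s|L. H_kernel (u * s))"

lemma laplace_exponent_eq: "laplace_exponent \<nu> u = \<phi> u"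
  unfolding laplace_exponent_def \<phi>_def set_lebesgue_integral_def
  by (subst integral_L) (auto intro!: Bochner_Integration.integral_cong simp: jump_density_def)

lemma min_mult_le: "0 < s \<Longrightarrow> 0 \<le> c \<Longrightarrow> min 1 (c * s) \<le> (1 + c) * min 1 s" for c s :: real
  by (cases "s \<le> 1") (auto simp: min_def algebra_simps)

lemma integrable_min_square: "integrable L (\<lambda>s. min 1 ((u * s)\<^sup>2))"
proof (rule integrable_L_bound)
  fix s :: real assume s: "0 < s"
  have "min 1 ((u * s)\<^sup>2) \<le> min 1 (\<bar>u\<bar> * s)"
  proof (cases "\<bar>u\<bar> * s \<le> 1")
    case True
    have "(u * s)\<^sup>2 = (\<bar>u\<bar> * s)\<^sup>2" by (simp add: power_mult_distrib)
    also have "\<dots> = (\<bar>u\<bar> * s) * (\<bar>u\<bar> * s)" by (rule power2_eq_square)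
    also have "\<dots> \<le> 1 * (\<bar>u\<bar> * s)" using True s by (intro mult_right_mono) auto
    finally show ?thesis by simp
  qed simp
  also have "\<dots> \<le> (1 + \<bar>u\<bar>) * min 1 s" using s by (intro min_mult_le) auto
  finally show "\<bar>min 1 ((u * s)\<^sup>2)\<bar> \<le> (1 + \<bar>u\<bar>) * min 1 s" by simp
qed measurable

lemma integrable_le_min_square:
  fixes f :: "real \<Rightarrow> real"
  assumes [measurable]: "f \<in> borel_measurable borel"
    and f: "\<And>s. 0 < s \<Longrightarrow> \<bar>f s\<bar> \<le> C * min 1 ((u * s)\<^sup>2)"
  shows "integrable L f"
proof (rule Bochner_Integration.integrable_bound)
  show "integrable L (\<lambda>s. C * min 1 ((u * s)\<^sup>2))" using integrable_min_square by simp
  show "AE s in L. norm (f s) \<le> norm (C * min 1 ((u * s)\<^sup>2))"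
    by (rule AE_L_I) (metis f abs_ge_self order_trans real_norm_def)
qed simp

lemma integrable_H_kernel: "0 \<le> u \<Longrightarrow> integrable L (\<lambda>s. H_kernel (u * s))"
  by (rule integrable_le_min_square[where C = 1 and u = u])
     (auto simp: H_kernel_nonneg H_kernel_le_1 H_kernel_le_square)

text \<open>Truncated variances, tail masses and damped second moments are all dominated by
  multiples of \<open>min 1 ((u * s)^2)\<close>; the factors 6 in the later estimates come from
  here.\<close>

lemma integral_le_H:
  assumes [measurable]: "f \<in> borel_measurable borel" and u: "0 \<le> u"
    and f: "\<And>s. 0 < s \<Longrightarrow> 0 \<le> f s" "\<And>s. 0 < s \<Longrightarrow> f s \<le> C * min 1 ((u * s)\<^sup>2)" and C: "0 \<le> C"
  shows "integrable L f" "(LINT s|L. f s) \<le> 6 * C * H u"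
proof -
  show *: "integrable L f" by (rule integrable_le_min_square[where C = C and u = u]) (use f in auto)
  have "(LINT s|L. f s) \<le> (LINT s|L. 6 * C * H_kernel (u * s))"
  proof (rule integral_L_mono[OF *])
    fix s :: real assume s: "0 < s"
    have "f s \<le> C * min 1 ((u * s)\<^sup>2)" by (rule f(2)[OF s])
    also have "\<dots> \<le> C * (6 * H_kernel (u * s))"
      using s u C by (intro mult_left_mono min_1_square_le_H_kernel) auto
    finally show "f s \<le> 6 * C * H_kernel (u * s)" by simp
  qed (use integrable_H_kernel u in auto)
  then show "(LINT s|L. f s) \<le> 6 * C * H u" by (simp add: H_def)
qed

text \<open>The integral is minus the second derivative of \<open>\<phi>\<close>: the variance per
  unit time of the process tilted by \<open>u\<close>.\<close>

lemma integral_square_exp_le: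
  assumes u: "0 < u"
  shows "integrable L (\<lambda>s. s\<^sup>2 * exp (- u * s))" "(LINT s|L. s\<^sup>2 * exp (- u * s)) \<le> 6 * H u / u\<^sup>2"
proof -
  have *: "s\<^sup>2 * exp (- u * s) \<le> 1 / u\<^sup>2 * min 1 ((u * s)\<^sup>2)" if "0 < s" for s
    using square_exp_le_min[of "u * s"] u that by (simp add: field_simps power_mult_distrib)
  show "integrable L (\<lambda>s. s\<^sup>2 * exp (- u * s))" "(LINT s|L. s\<^sup>2 * exp (- u * s)) \<le> 6 * H u / u\<^sup>2"
    using integral_le_H[of "\<lambda>s. s\<^sup>2 * exp (- u * s)" u "1 / u\<^sup>2", OF _ _ _ *] u by auto
qed

lemma integral_square_atMost_le:
  assumes a: "0 < a"
  shows "integrable L (\<lambda>s. indicator {..a} s * s\<^sup>2)" "(LINT s|L. indicator {..a} s * s\<^sup>2) \<le> 6 * a\<^sup>2 * H (1 / a)"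
proof -
  have *: "indicator {..a} s * s\<^sup>2 \<le> a\<^sup>2 * min 1 ((1 / a * s)\<^sup>2)" if s: "0 < s" for s
  proof (cases "s \<le> a")
    case True
    then have "s\<^sup>2 / a\<^sup>2 \<le> 1" using s a by (simp add: divide_le_eq power_mono)
    then show ?thesis using True a by (simp add: power_divide)
  qed (use a in simp)
  show "integrable L (\<lambda>s. indicator {..a} s * s\<^sup>2)" "(LINT s|L. indicator {..a} s * s\<^sup>2) \<le> 6 * a\<^sup>2 * H (1 / a)"
    using integral_le_H[of "\<lambda>s. indicator {..a} s * s\<^sup>2" "1 / a" "a\<^sup>2", OF _ _ _ *] a by auto
qed

lemma measure_greater_le:
  assumes a: "0 < a" and t: "0 < t"
  shows "measure (jumps \<nu> t) {a<..} \<le> 6 * t * H (1 / a)"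
proof -
  have *: "indicator {a<..} s \<le> 1 * min 1 ((1 / a * s)\<^sup>2)" if s: "0 < s" for s :: real
  proof (cases "a < s")
    case True
    then have "1 \<le> (s / a)\<^sup>2" using a by (intro one_le_power) auto
    then show ?thesis using True by simp
  qed simp
  have "measure (jumps \<nu> t) {a<..} = (LINT s|jumps \<nu> t. indicator {a<..} s)" by (simp add: jumps_def)
  also have "\<dots> = t * (LINT s|L. indicator {a<..} s)" by (rule integral_jumps[OF t]) simp
  also have "\<dots> \<le> t * (6 * 1 * H (1 / a))"
    using integral_le_H(2)[of "indicator {a<..}" "1 / a" 1, OF _ _ _ *] a t by (intro mult_left_mono) auto
  finally show ?thesis by simp
qed

lemma \<phi>_derivative:
  assumes u: "0 < u"
  shows "(\<phi> has_real_derivative \<phi>' u) (at u)"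
  unfolding \<phi>_def \<phi>'_def
proof (rule has_field_derivative_integral[where U = "{u / 2<..}" and g = "\<lambda>s. s * exp (- (u / 2) * s)"])
  show "AE s in L. \<forall>w\<in>{u / 2<..}. norm (s * exp (- w * s)) \<le> s * exp (- (u / 2) * s)"
    by (rule AE_L_I) (auto simp: abs_mult mult_right_mono)
  show "AE s in L. \<forall>w\<in>{u / 2<..}. ((\<lambda>w. 1 - exp (- w * s)) has_real_derivative s * exp (- w * s)) (at w)"
    by (intro AE_I2 ballI) (auto intro!: derivative_eq_intros)
  show "integrable L (\<lambda>s. 1 - exp (- w * s))" if "w \<in> {u / 2<..}" for w
    using L.integrable_one_minus_exp[of w] that u by simp
  show "integrable L (\<lambda>s. s * exp (- (u / 2) * s))" using L.integrable_mult_exp[of "u / 2"] u by simp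
qed (use u in auto)

lemma \<phi>'_derivative:
  assumes u: "0 < u"
  shows "(\<phi>' has_real_derivative (LINT s|L. - (s\<^sup>2 * exp (- u * s)))) (at u)"
  unfolding \<phi>'_def
proof (rule has_field_derivative_integral[where U = "{u / 2<..}" and g = "\<lambda>s. s\<^sup>2 * exp (- (u / 2) * s)"])
  show "AE s in L. \<forall>w\<in>{u / 2<..}. norm (- (s\<^sup>2 * exp (- w * s))) \<le> s\<^sup>2 * exp (- (u / 2) * s)"
    by (rule AE_L_I) (auto simp: abs_mult mult_right_mono)
  show "AE s in L. \<forall>w\<in>{u / 2<..}. ((\<lambda>w. s * exp (- w * s)) has_real_derivative - (s\<^sup>2 * exp (- w * s))) (at w)"
    by (intro AE_I2 ballI) (auto intro!: derivative_eq_intros simp: power2_eq_square)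
  show "integrable L (\<lambda>s. s * exp (- w * s))" if "w \<in> {u / 2<..}" for w
    using L.integrable_mult_exp[of w] that u by simp
  show "integrable L (\<lambda>s. s\<^sup>2 * exp (- (u / 2) * s))" using integral_square_exp_le(1)[of "u / 2"] u by simp
qed (use u in auto)

lemma phi_deriv_eq: "0 < u \<Longrightarrow> phi_deriv \<nu> u = \<phi>' u"
  unfolding phi_deriv_def laplace_exponent_eq[abs_def] by (rule DERIV_imp_deriv[OF \<phi>_derivative])

lemma H_eq:
  assumes u: "0 < u"
  shows "H u = \<phi> u - u * \<phi>' u"
proof -
  have "H u = (LINT s|L. (1 - exp (- u * s)) - u * (s * exp (- u * s)))"
    unfolding H_def H_kernel_def by (simp add: mult.assoc)
  also have "\<dots> = (LINT s|L. 1 - exp (- u * s)) - (LINT s|L. u * (s * exp (- u * s)))"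
    using L.integrable_one_minus_exp[of u] L.integrable_mult_exp[of u] u
    by (intro Bochner_Integration.integral_diff) auto
  finally show ?thesis by (simp add: \<phi>_def \<phi>'_def)
qed

lemma H_phi_eq: "0 < u \<Longrightarrow> H_phi \<nu> u = H u"
  by (simp add: H_phi_def laplace_exponent_eq phi_deriv_eq H_eq)

lemma continuous_on_H: "continuous_on {0<..} H"
proof -
  have "continuous_on {0<..} (\<lambda>u. \<phi> u - u * \<phi>' u)"
    by (intro continuous_intros continuous_at_imp_continuous_on ballI DERIV_isCont[OF \<phi>_derivative] DERIV_isCont[OF \<phi>'_derivative]) auto
  then show ?thesis by (rule continuous_on_eq) (simp add: H_eq)
qed

lemma H_mono: "0 \<le> u \<Longrightarrow> u \<le> v \<Longrightarrow> H u \<le> H v"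
  unfolding H_def by (intro integral_L_mono integrable_H_kernel) (auto intro!: H_kernel_mono mult_right_mono)

lemma H_scale:
  assumes "0 \<le> u" "1 \<le> k"
  shows "H (k * u) \<le> k\<^sup>2 * H u"
proof -
  have "H (k * u) \<le> (LINT s|L. k\<^sup>2 * H_kernel (u * s))"
    unfolding H_def using assms H_kernel_scale[of "u * s" k for s]
    by (intro integral_L_mono integrable_mult_right integrable_H_kernel) (auto simp: mult.assoc)
  then show ?thesis by (simp add: H_def)
qed

lemma H_nonneg: "0 \<le> u \<Longrightarrow> 0 \<le> H u"
  unfolding H_def by (intro integral_L_nonneg H_kernel_nonneg) auto

lemma H_lim_0: "(\<lambda>n. H (1 / real (Suc n))) \<longlonglongrightarrow> 0"
proof -
  have "(\<lambda>n. LINT s|L. H_kernel (1 / real (Suc n) * s)) \<longlonglongrightarrow> (LINT s|L. 0)"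
  proof (rule integral_dominated_convergence[where w = "\<lambda>s. H_kernel (1 * s)"])
    show "AE s in L. (\<lambda>n. H_kernel (1 / real (Suc n) * s)) \<longlonglongrightarrow> 0"
    proof (intro AE_I2)
      fix s
      have "(\<lambda>n. 1 / real (Suc n) * s) \<longlonglongrightarrow> 0 * s" by (intro tendsto_intros LIMSEQ_Suc[OF lim_1_over_n])
      then have "(\<lambda>n. H_kernel (1 / real (Suc n) * s)) \<longlonglongrightarrow> H_kernel 0"
        using isCont_tendsto_compose[OF DERIV_isCont[OF H_kernel_derivative]] by fastforce
      then show "(\<lambda>n. H_kernel (1 / real (Suc n) * s)) \<longlonglongrightarrow> 0" by (simp add: H_kernel_def)
    qed
    show "AE s in L. norm (H_kernel (1 / real (Suc n) * s)) \<le> H_kernel (1 * s)" for n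
    proof (rule AE_L_I)
      fix s :: real assume "0 < s"
      then have "H_kernel (1 / real (Suc n) * s) \<le> H_kernel (1 * s)"
        by (intro H_kernel_mono) (auto intro!: mult_right_mono simp: field_simps)
      then show "norm (H_kernel (1 / real (Suc n) * s)) \<le> H_kernel (1 * s)"
        using \<open>0 < s\<close> by (simp add: H_kernel_nonneg)
    qed
  qed (use integrable_H_kernel[of 1] in auto)
  then show ?thesis by (simp add: H_def)
qed

end

lemma one_minus_cos_le: "1 - cos v \<le> 2 * min 1 (v\<^sup>2)" for v :: real
proof -
  have "1 - cos v = 2 * (sin (v / 2))\<^sup>2" using cos_double_sin[of "v / 2"] by simp
  moreover have "(sin (v / 2))\<^sup>2 \<le> (v / 2)\<^sup>2"
    using abs_sin_x_le_abs_x[of "v / 2"] by (rule abs_le_square_iff[THEN iffD1])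
  ultimately have A: "1 - cos v \<le> v\<^sup>2 / 2" by (simp add: power_divide)
  have B: "1 - cos v \<le> 2" using cos_ge_minus_one[of v] by linarith
  show ?thesis
  proof (cases "1 \<le> v\<^sup>2")
    case True
    then have "min 1 (v\<^sup>2) = 1" by simp
    then show ?thesis using B by linarith
  next
    case False
    then have "min 1 (v\<^sup>2) = v\<^sup>2" by simp
    then show ?thesis using A zero_le_power2[of v] by linarith
  qed
qed

context levy_nu
begin

lemma integral_L_ge_interval:
  assumes [measurable]: "f \<in> borel_measurable borel" and int: "integrable L f"
    and ab: "0 < a" "a \<le> b" and k: "0 \<le> k" "\<And>s. a \<le> s \<Longrightarrow> s \<le> b \<Longrightarrow> k \<le> \<nu> s"
    and f: "\<And>s. 0 < s \<Longrightarrow> 0 \<le> f s" and d: "\<And>s. a \<le> s \<Longrightarrow> s \<le> b \<Longrightarrow> d \<le> f s"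
  shows "k * d * (b - a) \<le> (LINT s|L. f s)"
proof (cases "0 \<le> d")
  case True
  have "k * d * (b - a) = (LINT s|lborel. k * d * indicator {a..b} s)" using ab by simp
  also have "\<dots> \<le> (LINT s|lborel. jump_density \<nu> s * f s)"
  proof (rule integral_mono)
    show "integrable lborel (\<lambda>s. jump_density \<nu> s * f s)"
      using int jump_density_nonneg unfolding jumps_def by (subst (asm) integrable_density) auto
    fix s
    show "k * d * indicator {a..b} s \<le> jump_density \<nu> s * f s"
    proof (cases "a \<le> s \<and> s \<le> b")
      case True
      then have "k * d \<le> \<nu> s * f s"
        using k(1) k(2)[of s] d[of s] \<open>0 \<le> d\<close> ab by (intro mult_mono) auto
      then show ?thesis using True ab by simp
    next
      case False
      then have eq0: "k * d * indicator {a..b} s = 0" by auto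
      have "0 \<le> jump_density \<nu> s * f s"
        using f[of s] jump_density_nonneg[of s] by (cases "0 < s") (auto simp: jump_density_def)
      then show ?thesis unfolding eq0 .
    qed
    show "integrable lborel (\<lambda>s. k * d * indicator {a..b} s)"
      by (intro integrable_mult_right integrable_real_indicator) (auto simp: emeasure_lborel_Icc_eq)
  qed
  also have "\<dots> = (LINT s|L. f s)" by (rule integral_L[symmetric]) simp
  finally show ?thesis .
next
  case False
  then have "k * d * (b - a) \<le> 0" using k ab by (simp add: mult_nonneg_nonpos mult_nonneg_nonpos2)
  also have "0 \<le> (LINT s|L. f s)" by (rule integral_L_nonneg[OF f])
  finally show ?thesis .
qed

lemma integral_one_minus_cos_le_H: "0 \<le> \<xi> \<Longrightarrow> (LINT s|L. 1 - cos (\<xi> * s)) \<le> 12 * H \<xi>"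
  using integral_le_H(2)[of "\<lambda>s. 1 - cos (\<xi> * s)" \<xi> 2] one_minus_cos_le by simp

end

section \<open>Consequences of the singularity of the Levy density at 0\<close>

locale levy_nu_singular = levy_nu +
  fixes c0 \<delta> :: real
  assumes c0: "0 < c0" and \<delta>: "0 < \<delta>" and singular: "\<And>s. 0 < s \<Longrightarrow> s \<le> \<delta> \<Longrightarrow> c0 \<le> s * \<nu> s"
begin

text \<open>Between \<open>1 / \<xi>\<close> and \<delta> the Levy density is at least
  \<open>c0 / s\<close>, which makes the integral grow logarithmically with slope \<open>c0\<close>.
  The integral is the real part of the characteristic exponent, so at time \<open>t\<close> the
  characteristic function decays at least like the power \<open>- c0 * t\<close> of \<xi>.\<close>

lemma integral_one_minus_cos_ge:
  assumes \<xi>: "0 < \<xi>" "1 \<le> \<xi> * \<delta>"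
  shows "c0 * (ln (\<xi> * \<delta>) - 1) \<le> (LINT s|L. 1 - cos (\<xi> * s))"
proof -
  \<comment> \<open>The derivative \<open>f\<close> of \<open>F\<close> is at most \<open>(1 - cos (\<xi> s)) / s\<close>, because \<open>sin \<le> 1\<close>.\<close>
  define F where "F s = ln s - sin (\<xi> * s) / (\<xi> * s) + 1 / (\<xi> * s)" for s
  define f where "f s = 1 / s - cos (\<xi> * s) / s + sin (\<xi> * s) / (\<xi> * s\<^sup>2) - 1 / (\<xi> * s\<^sup>2)" for s
  have le: "1 / \<xi> \<le> \<delta>" using \<xi> by (simp add: field_simps)
  have pos: "0 < s" if "1 / \<xi> \<le> s" for s using that \<xi> by (meson less_le_trans zero_less_divide_1_iff)
  have F: "(F has_vector_derivative f s) (at s within {1 / \<xi>..\<delta>})" if "1 / \<xi> \<le> s" "s \<le> \<delta>" for s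
    unfolding F_def f_def has_real_derivative_iff_has_vector_derivative[symmetric]
    using pos[OF that(1)] \<xi>
    by (auto intro!: derivative_eq_intros simp: field_simps power2_eq_square)
  have f: "continuous_on {1 / \<xi>..\<delta>} f"
    unfolding f_def using pos \<xi> by (intro continuous_intros) (auto dest!: pos)
  have FTC: "(LINT s|lborel. indicator {1 / \<xi>..\<delta>} s *\<^sub>R f s) = F \<delta> - F (1 / \<xi>)"
    by (rule integral_FTC_atLeastAtMost[OF le F f])
  \<comment> \<open>\<open>F \<delta>\<close> is at least \<open>ln \<delta>\<close> because the
    sine is at most 1, and \<open>F (1 / \<xi>)\<close> equals \<open>1 - ln \<xi> - sin 1\<close>
    with \<open>sin 1\<close> nonnegative.\<close>
  have "ln (\<xi> * \<delta>) - 1 \<le> F \<delta> - F (1 / \<xi>)"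
  proof -
    have "0 \<le> (1 - sin (\<xi> * \<delta>)) / (\<xi> * \<delta>)" using \<xi> by (intro divide_nonneg_nonneg) auto
    moreover have "0 \<le> sin (1::real)" using sin_gt_zero[of "1::real"] pi_gt3 by simp
    ultimately show ?thesis
      using \<xi> \<delta> by (simp add: F_def ln_mult ln_div diff_divide_distrib)
  qed
  then have "c0 * (ln (\<xi> * \<delta>) - 1) \<le> (LINT s|lborel. c0 * (indicator {1 / \<xi>..\<delta>} s *\<^sub>R f s))"
    using c0 unfolding integral_mult_right_zero FTC by (intro mult_left_mono) auto
  also have "\<dots> \<le> (LINT s|lborel. jump_density \<nu> s * (1 - cos (\<xi> * s)))"
  proof (rule integral_mono)
    show "integrable lborel (\<lambda>s. c0 * (indicator {1 / \<xi>..\<delta>} s *\<^sub>R f s))"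
      using borel_integrable_atLeastAtMost'[OF f] by (simp add: set_integrable_def)
    show "integrable lborel (\<lambda>s. jump_density \<nu> s * (1 - cos (\<xi> * s)))"
      using L.integrable_one_minus_cos[of \<xi>] jump_density_nonneg
      unfolding jumps_def by (subst (asm) integrable_density) auto
    fix s
    show "c0 * (indicator {1 / \<xi>..\<delta>} s *\<^sub>R f s) \<le> jump_density \<nu> s * (1 - cos (\<xi> * s))"
    proof (cases "1 / \<xi> \<le> s \<and> s \<le> \<delta>")
      case True
      then have s: "0 < s" using pos by blast
      have "(sin (\<xi> * s) - 1) / (\<xi> * s\<^sup>2) \<le> 0" using s \<xi> by (intro divide_nonpos_pos) auto
      then have "f s \<le> (1 - cos (\<xi> * s)) / s" by (simp add: f_def diff_divide_distrib)
      then have "c0 * f s \<le> c0 * ((1 - cos (\<xi> * s)) / s)" using c0 by (intro mult_left_mono) auto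
      also have "\<dots> = c0 / s * (1 - cos (\<xi> * s))" by simp
      also have "\<dots> \<le> \<nu> s * (1 - cos (\<xi> * s))"
        using singular[of s] True s by (intro mult_right_mono) (auto simp: divide_le_eq mult.commute)
      finally show ?thesis using True s by simp
    next
      case False
      then have eq0: "c0 * (indicator {1 / \<xi>..\<delta>} s *\<^sub>R f s) = 0" by auto
      show ?thesis unfolding eq0 using jump_density_nonneg[of s] by simp
    qed
  qed
  also have "\<dots> = (LINT s|L. 1 - cos (\<xi> * s))" by (rule integral_L[symmetric]) simp
  finally show ?thesis .
qed

text \<open>\<open>12 * H\<close> dominates the integral of \<open>1 - cos\<close>, and \<xi> is
  chosen so that the logarithm in its lower bound equals \<open>2 + 12 * \<bar>B\<bar> / c0\<close>.
  This makes \<open>H\<close> map onto the positive reals.\<close>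

lemma H_unbounded: "\<exists>u>0. B < H u"
proof -
  define \<xi> where "\<xi> = exp (2 + 12 * \<bar>B\<bar> / c0) / \<delta>"
  have "0 < \<xi>" "\<xi> * \<delta> = exp (2 + 12 * \<bar>B\<bar> / c0)" using \<delta> by (auto simp: \<xi>_def)
  moreover have "1 \<le> exp (2 + 12 * \<bar>B\<bar> / c0)" using c0 by (simp add: add_nonneg_nonneg)
  ultimately have "c0 * (1 + 12 * \<bar>B\<bar> / c0) \<le> (LINT s|L. 1 - cos (\<xi> * s))"
    using integral_one_minus_cos_ge[of \<xi>] by simp
  also have "\<dots> \<le> 12 * H \<xi>" using \<open>0 < \<xi>\<close> by (intro integral_one_minus_cos_le_H) auto
  also have "c0 * (1 + 12 * \<bar>B\<bar> / c0) = c0 + 12 * \<bar>B\<bar>" using c0 by (simp add: field_simps)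
  finally have "B < H \<xi>" using c0 by linarith
  with \<open>0 < \<xi>\<close> show ?thesis by blast
qed

text \<open>If the integral vanished, the Levy measure would be null and \<open>H\<close>
  identically 0, although \<open>H\<close> is unbounded. The strict monotonicity of \<open>H\<close>
  and \<open>\<phi>'\<close> rests on this.\<close>

lemma integral_L_pos:
  fixes f :: "real \<Rightarrow> real"
  assumes int: "integrable L f" and f: "\<And>s. 0 < s \<Longrightarrow> 0 < f s"
  shows "0 < (LINT s|L. f s)"
proof -
  have nonneg: "AE s in L. 0 \<le> f s" by (rule AE_L_I) (use f in force)
  have "(LINT s|L. f s) \<noteq> 0"
  proof
    assume "(LINT s|L. f s) = 0"
    then have "AE s in L. f s = 0" using integral_nonneg_eq_0_iff_AE[OF int nonneg] by simp
    with L.AE_pos have False: "AE s in L. False" by eventually_elim (use f in fastforce)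
    obtain u where "0 < H u" using H_unbounded by blast
    moreover have "H u = 0" unfolding H_def using False by (intro integral_eq_zero_AE) (auto elim: eventually_mono)
    ultimately show False by simp
  qed
  moreover have "0 \<le> (LINT s|L. f s)" by (rule integral_nonneg_AE[OF nonneg])
  ultimately show ?thesis by simp
qed

lemma H_strict_mono:
  assumes "0 \<le> u" "u < v"
  shows "H u < H v"
proof -
  have "0 < (LINT s|L. H_kernel (v * s) - H_kernel (u * s))"
    by (rule integral_L_pos)
       (use assms in \<open>auto intro!: Bochner_Integration.integrable_diff integrable_H_kernel H_kernel_strict_mono\<close>)
  also have "\<dots> = H v - H u"
    unfolding H_def using assms by (intro Bochner_Integration.integral_diff integrable_H_kernel) auto
  finally show ?thesis by simp
qed

lemma H_pos: "0 < u \<Longrightarrow> 0 < H u"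
  using H_strict_mono[of 0 u] H_nonneg[of 0] by simp

lemma \<phi>'_strict_antimono:
  assumes "0 < u" "u < v"
  shows "\<phi>' v < \<phi>' u"
proof -
  have "0 < (LINT s|L. s * exp (- u * s) - s * exp (- v * s))"
    by (rule integral_L_pos)
       (use assms L.integrable_mult_exp[of u] L.integrable_mult_exp[of v] in
         \<open>auto intro!: Bochner_Integration.integrable_diff\<close>)
  also have "\<dots> = \<phi>' u - \<phi>' v"
    unfolding \<phi>'_def using assms L.integrable_mult_exp[of u] L.integrable_mult_exp[of v]
    by (intro Bochner_Integration.integral_diff) auto
  finally show ?thesis by simp
qed

lemma \<phi>'_pos: "0 < u \<Longrightarrow> 0 < \<phi>' u"
  unfolding \<phi>'_def using L.integrable_mult_exp[of u] by (intro integral_L_pos) auto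

lemma \<phi>'_antimono: "0 < u \<Longrightarrow> u \<le> v \<Longrightarrow> \<phi>' v \<le> \<phi>' u"
  using \<phi>'_strict_antimono[of u v] by (cases "u = v") auto

lemma H_surj:
  assumes y: "0 < y"
  obtains u where "0 < u" "H u = y"
proof -
  have "eventually (\<lambda>n. H (1 / real (Suc n)) < y) sequentially"
    using H_lim_0 y by (rule order_tendstoD)
  then obtain n where n: "H (1 / real (Suc n)) < y" by (auto simp: eventually_sequentially)
  obtain v where v: "0 < v" "y < H v" using H_unbounded by blast
  have l: "0 < 1 / real (Suc n)" by simp
  have lv: "1 / real (Suc n) \<le> v"
    using H_mono[of v "1 / real (Suc n)"] n v by (cases "1 / real (Suc n) \<le> v") auto
  have cont: "continuous_on {1 / real (Suc n)..v} H"
    by (rule continuous_on_subset[OF continuous_on_H]) (use l in \<open>meson atLeastAtMost_iff greaterThan_iff less_le_trans subsetI\<close>)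
  have "\<exists>u. 1 / real (Suc n) \<le> u \<and> u \<le> v \<and> H u = y"
    by (rule IVT'[of H _ y v]) (use n v lv cont in simp_all)
  then show ?thesis using that l by (metis less_le_trans)
qed

lemma H_inj: "0 < u \<Longrightarrow> 0 < v \<Longrightarrow> H u = H v \<Longrightarrow> u = v"
  using H_strict_mono[of u v] H_strict_mono[of v u] by (cases u v rule: linorder_cases) auto

lemma H_less_iff: "0 < u \<Longrightarrow> 0 < v \<Longrightarrow> H u \<le> H v \<longleftrightarrow> u \<le> v"
  using H_strict_mono[of v u] H_mono[of u v] by (auto simp: not_less[symmetric])

lemma H_phi_inv_eq: "0 < u \<Longrightarrow> H_phi_inv \<nu> (H u) = u"
  unfolding H_phi_inv_def
  by (rule the_inv_into_f_eq) (auto simp: inj_on_def H_phi_eq intro: H_inj)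

text \<open>By monotonicity the limit exists and is a supremum, which can be compared with
  \<open>x / t\<close> without separating finite from infinite values.\<close>

lemma phi_deriv0_eq: "phi_deriv0 \<nu> = (SUP u\<in>{0<..}. ereal (\<phi>' u))"
proof -
  let ?S = "SUP u\<in>{0<..}. ereal (\<phi>' u)"
  have pd: "eventually (\<lambda>u. phi_deriv \<nu> u = \<phi>' u) (at_right 0)"
    using eventually_at_right_less[of "0::real"] by eventually_elim (simp add: phi_deriv_eq)
  have "((\<lambda>u. ereal (\<phi>' u)) \<longlongrightarrow> ?S) (at_right 0)"
  proof (rule order_tendstoI)
    fix a assume "a < ?S"
    then obtain u where u: "0 < u" "a < ereal (\<phi>' u)" by (auto simp: less_SUP_iff)
    have "eventually (\<lambda>v. v \<in> {0<..<u}) (at_right 0)"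
      by (rule eventually_at_right_real[OF u(1)])
    then show "eventually (\<lambda>v. a < ereal (\<phi>' v)) (at_right 0)"
      by eventually_elim (use u \<phi>'_antimono in \<open>force intro: less_le_trans\<close>)
  next
    fix a assume a: "?S < a"
    show "eventually (\<lambda>v. ereal (\<phi>' v) < a) (at_right 0)"
      using eventually_at_right_less[of "0::real"]
    proof eventually_elim
      case (elim v)
      then have "ereal (\<phi>' v) \<le> ?S" by (intro SUP_upper) auto
      then show ?case using a by (rule le_less_trans)
    qed
  qed
  then have "((\<lambda>u. ereal (phi_deriv \<nu> u)) \<longlongrightarrow> ?S) (at_right 0)"
    by (rule Lim_transform_eventually) (use pd in eventually_elim, simp)
  then show ?thesis unfolding phi_deriv0_def by (intro tendsto_Lim) auto
qed

lemma less_phi_deriv0_iff: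
  assumes t: "0 < t"
  shows "ereal x < ereal t * phi_deriv0 \<nu> \<longleftrightarrow> (\<exists>u>0. x < t * \<phi>' u)"
proof
  assume lt: "ereal x < ereal t * phi_deriv0 \<nu>"
  show "\<exists>u>0. x < t * \<phi>' u"
  proof (rule ccontr)
    assume n: "\<not> (\<exists>u>0. x < t * \<phi>' u)"
    have "\<phi>' u \<le> x / t" if "0 < u" for u
      using n that t by (subst pos_le_divide_eq) (simp, metis mult.commute not_less)
    then have "phi_deriv0 \<nu> \<le> ereal (x / t)"
      unfolding phi_deriv0_eq by (intro SUP_least) auto
    then have "ereal t * phi_deriv0 \<nu> \<le> ereal t * ereal (x / t)"
      using t by (intro ereal_mult_left_mono) auto
    then show False using lt t by simp
  qed
next
  assume "\<exists>u>0. x < t * \<phi>' u"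
  then obtain u where u: "0 < u" "x < t * \<phi>' u" by blast
  have "ereal x < ereal t * ereal (\<phi>' u)" using u by simp
  also have "\<dots> \<le> ereal t * phi_deriv0 \<nu>"
    unfolding phi_deriv0_eq using t u by (intro ereal_mult_left_mono SUP_upper) auto
  finally show "ereal x < ereal t * phi_deriv0 \<nu>" .
qed

lemma sigma_phi_eq:
  assumes "0 < t" "0 < u"
  shows "sigma_phi \<nu> t (t * \<phi>' u) = u"
proof -
  have "t * \<phi>' u < t * \<phi>' (u / 2)" using \<phi>'_strict_antimono[of "u / 2" u] assms by simp
  then have "ereal (t * \<phi>' u) < ereal t * phi_deriv0 \<nu>"
    unfolding less_phi_deriv0_iff[OF assms(1)] using assms by (intro exI[of _ "u / 2"]) auto
  moreover have "inj_on (phi_deriv \<nu>) {0<..}"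
    using \<phi>'_strict_antimono by (intro linorder_inj_onI) (auto simp: phi_deriv_eq, fastforce+)
  then have "the_inv_into {0<..} (phi_deriv \<nu>) (\<phi>' u) = u"
    using assms by (intro the_inv_into_f_eq) (auto simp: phi_deriv_eq)
  ultimately show ?thesis using assms by (simp add: sigma_phi_def)
qed

text \<open>Trades the inverse function for a parameter: either \<open>x\<close> is a value of
  \<open>t * \<phi>'\<close> at some \<open>u \<le> \<Lambda>\<close>, by the intermediate value
  theorem, or it lies at or beyond all these values and the default 0 applies.\<close>

lemma sigma_phi_cases:
  assumes t: "0 < t" and \<Lambda>: "0 < \<Lambda>" and x: "t * \<phi>' \<Lambda> \<le> x"
  obtains u where "0 < u" "u \<le> \<Lambda>" "x = t * \<phi>' u" "sigma_phi \<nu> t x = u"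
  | "sigma_phi \<nu> t x = 0" "\<And>u. 0 < u \<Longrightarrow> t * \<phi>' u \<le> x"
proof (cases "ereal x < ereal t * phi_deriv0 \<nu>")
  case True
  then obtain v where v: "0 < v" "x < t * \<phi>' v" using less_phi_deriv0_iff[OF t] by blast
  have xt: "\<phi>' \<Lambda> \<le> x / t" "x / t < \<phi>' v" using x v t by (auto simp: field_simps)
  have v\<Lambda>: "v \<le> \<Lambda>" using \<phi>'_antimono[of \<Lambda> v] xt \<Lambda> by (cases "v \<le> \<Lambda>") auto
  have "continuous_on {v..\<Lambda>} \<phi>'"
    using v by (intro continuous_at_imp_continuous_on ballI DERIV_isCont[OF \<phi>'_derivative]) auto
  then have "\<exists>u. v \<le> u \<and> u \<le> \<Lambda> \<and> \<phi>' u = x / t"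
    using v\<Lambda> xt by (intro IVT2'[of \<phi>']) auto
  then obtain u where u: "v \<le> u" "u \<le> \<Lambda>" "\<phi>' u = x / t" by blast
  have x_eq: "x = t * \<phi>' u" using t u(3) by simp
  have "0 < u" using v u by linarith
  then show ?thesis
    by (rule that(1)[OF _ u(2) x_eq]) (simp add: x_eq sigma_phi_eq[OF t \<open>0 < u\<close>])
next
  case False
  then have "t * \<phi>' u \<le> x" if "0 < u" for u using less_phi_deriv0_iff[OF t] that by (meson not_less)
  moreover have "sigma_phi \<nu> t x = 0" using False by (simp add: sigma_phi_def)
  ultimately show ?thesis using that(2) by blast
qed

end

section \<open>Scaling\<close>

text \<open>The behaviour of \<nu> below \<open>R2\<close> is represented only by the singularity
  and by the floor \<open>\<epsilon>\<close>.\<close>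

locale levy_nu_scaling = levy_nu_singular +
  fixes R2 \<epsilon> a6 a7 \<alpha>3 \<alpha>4 :: real
  assumes R2: "0 < R2" and \<epsilon>: "0 < \<epsilon>" "\<And>s. 0 < s \<Longrightarrow> s \<le> R2 \<Longrightarrow> \<epsilon> \<le> \<nu> s"
    and a67: "0 < a6" "0 < a7" and \<alpha>34: "0 < \<alpha>3" "\<alpha>3 \<le> \<alpha>4" "\<alpha>4 < 2"
    and \<nu>_pos': "\<And>r. R2 \<le> r \<Longrightarrow> 0 < \<nu> r"
    and scaling: "\<And>r R. R2 \<le> r \<Longrightarrow> r \<le> R \<Longrightarrow>
      a6 * (R / r) powr (1 + \<alpha>3) \<le> \<nu> r / \<nu> R \<and> \<nu> r / \<nu> R \<le> a7 * (R / r) powr (1 + \<alpha>4)"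
begin

lemma \<nu>_pos: "0 < s \<Longrightarrow> 0 < \<nu> s"
  using \<epsilon> \<nu>_pos' by (cases "s \<le> R2") force+

lemma \<nu>_lower: "R2 \<le> r \<Longrightarrow> r \<le> R \<Longrightarrow> a6 * (R / r) powr (1 + \<alpha>3) * \<nu> R \<le> \<nu> r"
  using scaling[of r R] \<nu>_pos'[of R] by (simp add: pos_le_divide_eq)

lemma \<nu>_upper: "R2 \<le> r \<Longrightarrow> r \<le> R \<Longrightarrow> \<nu> r \<le> a7 * (R / r) powr (1 + \<alpha>4) * \<nu> R"
  using scaling[of r R] \<nu>_pos'[of R] by (simp add: pos_divide_le_eq)

lemma \<nu>_almost_decreasing: 
  assumes "R2 \<le> r" "r \<le> R"
  shows "a6 * \<nu> R \<le> \<nu> r"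
proof -
  have "1 \<le> (R / r) powr (1 + \<alpha>3)" using assms R2 \<alpha>34 by (intro ge_one_powr_ge_zero) auto
  then have "a6 * 1 * \<nu> R \<le> a6 * (R / r) powr (1 + \<alpha>3) * \<nu> R"
    using a67 \<nu>_pos'[of R] assms by (intro mult_right_mono mult_left_mono) auto
  also have "\<dots> \<le> \<nu> r" by (rule \<nu>_lower[OF assms])
  finally show ?thesis by simp
qed

text \<open>Three ranges of \<open>s\<close> give the three terms of the constant: the floor up to
  \<open>R2\<close>, almost monotonicity from there to \<open>y\<close>, and the upper power bound
  between \<open>y\<close> and \<open>K * y\<close>.\<close>

lemma \<nu>_ge_of_le_mult:
  assumes "1 \<le> K"
  obtains c where "0 < c" "\<And>s y. R2 \<le> y \<Longrightarrow> 0 < s \<Longrightarrow> s \<le> K * y \<Longrightarrow> c * \<nu> y \<le> \<nu> s"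
proof -
  define c where "c = min (min a6 (\<epsilon> * a6 / \<nu> R2)) (1 / (a7 * K powr (1 + \<alpha>4)))"
  have Kp: "0 < a7 * K powr (1 + \<alpha>4)" using a67 assms by simp
  have c: "0 < c" using a67 \<epsilon> \<nu>_pos'[of R2] Kp by (simp add: c_def)
  show ?thesis
  proof (rule that[OF c])
    fix s y assume y: "R2 \<le> y" and s: "0 < s" "s \<le> K * y"
    have ny: "0 < \<nu> y" using y by (rule \<nu>_pos')
    show "c * \<nu> y \<le> \<nu> s"
    proof (cases "s \<le> R2")
      case True
      have "c * \<nu> y \<le> \<epsilon> * a6 / \<nu> R2 * \<nu> y" using ny by (intro mult_right_mono) (auto simp: c_def)
      also have "\<dots> = \<epsilon> / \<nu> R2 * (a6 * \<nu> y)" by simp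
      also have "\<dots> \<le> \<epsilon> / \<nu> R2 * \<nu> R2"
        using \<epsilon> \<nu>_pos'[of R2] y by (intro mult_left_mono \<nu>_almost_decreasing) auto
      also have "\<dots> = \<epsilon>" using \<nu>_pos'[of R2] by simp
      also have "\<dots> \<le> \<nu> s" using \<epsilon>(2) s True by simp
      finally show ?thesis .
    next
      case sR: False
      show ?thesis
      proof (cases "s \<le> y")
        case True
        have "c * \<nu> y \<le> a6 * \<nu> y" using ny by (intro mult_right_mono) (auto simp: c_def)
        also have "\<dots> \<le> \<nu> s" using sR True by (intro \<nu>_almost_decreasing) auto
        finally show ?thesis .
      next
        case False
        have "(s / y) powr (1 + \<alpha>4) \<le> K powr (1 + \<alpha>4)"
          using s y R2 \<alpha>34 False by (intro powr_mono2) (auto simp: field_simps)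
        then have "a7 * (s / y) powr (1 + \<alpha>4) * \<nu> s \<le> a7 * K powr (1 + \<alpha>4) * \<nu> s"
          using a67 \<nu>_pos[OF s(1)] by (intro mult_right_mono mult_left_mono) auto
        with \<nu>_upper[OF y, of s] False have "\<nu> y \<le> a7 * K powr (1 + \<alpha>4) * \<nu> s" by simp
        then have "1 / (a7 * K powr (1 + \<alpha>4)) * \<nu> y \<le> \<nu> s" using Kp by (simp add: field_simps)
        moreover have "c * \<nu> y \<le> 1 / (a7 * K powr (1 + \<alpha>4)) * \<nu> y"
          using ny by (intro mult_right_mono) (auto simp: c_def)
        ultimately show ?thesis by linarith
      qed
    qed
  qed
qed

text \<open>On \<open>[r, 2 * r]\<close> the upper power bound keeps \<nu> above a multiple of
  \<open>\<nu> r\<close>, and there \<open>min 1 ((s / r)^2)\<close> equals 1.\<close>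

lemma \<nu>_le_H:
  obtains C where "0 < C" "\<And>r. R2 \<le> r \<Longrightarrow> r * \<nu> r \<le> C * H (1 / r)"
proof -
  define K where "K = a7 * 2 powr (1 + \<alpha>4)"
  have K: "0 < K" using a67 by (simp add: K_def)
  have "r * \<nu> r \<le> 6 * K * H (1 / r)" if r: "R2 \<le> r" for r
  proof -
    have r0: "0 < r" using r R2 by linarith
    have *: "indicator {r..2 * r} s \<le> 1 * min 1 ((1 / r * s)\<^sup>2)" if "0 < s" for s :: real
    proof (cases "r \<le> s")
      case True
      then have "1 \<le> (s / r)\<^sup>2" using r0 by (intro one_le_power) auto
      then show ?thesis by (simp add: indicator_def)
    qed simp
    have "\<nu> r / K * 1 * (2 * r - r) \<le> (LINT s|L. indicator {r..2 * r} s)"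
    proof (rule integral_L_ge_interval)
      show "integrable L (indicator {r..2 * r} :: real \<Rightarrow> real)"
        using integral_le_H(1)[of "indicator {r..2 * r}" "1 / r" 1, OF _ _ _ *] r0 by auto
      fix s assume s: "r \<le> s" "s \<le> 2 * r"
      have "\<nu> r \<le> a7 * (s / r) powr (1 + \<alpha>4) * \<nu> s" using s r by (intro \<nu>_upper) auto
      also have "\<dots> \<le> a7 * 2 powr (1 + \<alpha>4) * \<nu> s"
        using s r0 \<alpha>34 a67 \<nu>_pos[of s] by (intro mult_right_mono mult_left_mono powr_mono2) (auto simp: field_simps)
      finally show "\<nu> r / K \<le> \<nu> s" using K by (simp add: K_def pos_divide_le_eq mult.commute)
    qed (use r0 K \<nu>_pos[OF r0] in auto)
    also have "\<dots> \<le> 6 * 1 * H (1 / r)"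
      using integral_le_H(2)[of "indicator {r..2 * r}" "1 / r" 1, OF _ _ _ *] r0 by auto
    finally show ?thesis using K by (simp add: field_simps)
  qed
  then show ?thesis using that[of "6 * K"] K by auto
qed

lemma nn_integral_powr_tail:
  assumes "0 < r" "0 < p"
  shows "(\<integral>\<^sup>+s. ennreal ((s / r) powr (- (1 + p))) * indicator {r..} s \<partial>lborel) = ennreal (r / p)"
proof -
  have "(\<integral>\<^sup>+s. ennreal ((s / r) powr (- (1 + p))) * indicator {r..} s \<partial>lborel) = ennreal (0 - (- (r / p) * (r / r) powr (- p)))"
  proof (rule nn_integral_FTC_atLeast[where F = "\<lambda>x. - (r / p) * (x / r) powr (- p)"])
    fix x assume "r \<le> x"
    then show "((\<lambda>x. - (r / p) * (x / r) powr (- p)) has_real_derivative (x / r) powr (- (1 + p))) (at x)"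
      using assms by (auto intro!: derivative_eq_intros simp: field_simps powr_diff powr_add powr_minus)
  next
    have "((\<lambda>x. (x / r) powr (- p)) \<longlongrightarrow> 0) at_top"
      using assms by real_asymp
    then have "((\<lambda>x. - (r / p) * (x / r) powr (- p)) \<longlongrightarrow> - (r / p) * 0) at_top"
      by (intro tendsto_intros)
    then show "((\<lambda>x. - (r / p) * (x / r) powr (- p)) \<longlongrightarrow> 0) at_top" by simp
  qed auto
  then show ?thesis using assms by simp
qed

lemma nn_integral_powr_head:
  assumes "0 < q" "q \<le> r" "0 < p"
  shows "(\<integral>\<^sup>+s. ennreal ((s / r) powr (p - 1)) * indicator {q..r} s \<partial>lborel) \<le> ennreal (r / p)"
proof -
  have "(\<integral>\<^sup>+s. ennreal ((s / r) powr (p - 1)) * indicator {q..r} s \<partial>lborel)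
      = ennreal (r / p * (r / r) powr p - r / p * (q / r) powr p)"
  proof (rule nn_integral_FTC_Icc[where F = "\<lambda>x. r / p * (x / r) powr p"])
    fix x assume "x \<in> {q..r}"
    then show "((\<lambda>x. r / p * (x / r) powr p) has_real_derivative (x / r) powr (p - 1)) (at x)"
      using assms by (auto intro!: derivative_eq_intros simp: field_simps powr_diff)
  qed (use assms in auto)
  also have "\<dots> \<le> ennreal (r / p)" using assms by (intro ennreal_leI) auto
  finally show ?thesis .
qed

text \<open>Karamata's argument. From \<open>R2\<close> to \<open>r\<close> the integrand is at most
  a power of \<open>s\<close> with exponent \<open>1 - \<alpha>4\<close>, whose integral is governed
  by the upper end as \<alpha>4 < 2; beyond \<open>r\<close> the exponent is
  \<open>- 1 - \<alpha>3\<close>, integrable as 0 < \<alpha>3. Both parts are of order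
  \<open>r * \<nu> r\<close>. The jumps below \<open>R2\<close> contribute a multiple of
  \<open>1 / r^2\<close>, which decays no slower.\<close>

lemma H_le_\<nu>:
  obtains C where "0 < C" "\<And>r. R2 \<le> r \<Longrightarrow> H (1 / r) \<le> C * (r * \<nu> r)"
proof -
  define C1 where "C1 = 6 * R2\<^sup>2 * H (1 / R2) * a7 / (R2 * \<nu> R2) / R2\<^sup>2"
  \<comment> \<open>The terms belong to the jumps below \<open>R2\<close>, between \<open>R2\<close>
    and \<open>r\<close>, and beyond \<open>r\<close>.\<close>
  define C where "C = C1 + a7 / (2 - \<alpha>4) + 1 / (a6 * \<alpha>3)"
  have n2: "0 < \<nu> R2" by (simp add: \<nu>_pos')
  have C1: "0 \<le> C1" using R2 a67 n2 H_nonneg[of "1 / R2"] by (simp add: C1_def)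
  have C2: "0 < a7 / (2 - \<alpha>4)" "0 < 1 / (a6 * \<alpha>3)" using a67 \<alpha>34 by auto
  have "H (1 / r) \<le> C * (r * \<nu> r)" if r: "R2 \<le> r" for r
  proof -
    have r0: "0 < r" using r R2 by linarith
    have nr: "0 < \<nu> r" using r by (rule \<nu>_pos')
    define A where "A s = indicator {..R2} s * s\<^sup>2" for s :: real
    have PA: "(\<integral>\<^sup>+s. ennreal (jump_density \<nu> s) * ennreal (A s) \<partial>lborel) \<le> ennreal (6 * R2\<^sup>2 * H (1 / R2))"
    proof -
      have "(\<integral>\<^sup>+s. ennreal (jump_density \<nu> s) * ennreal (A s) \<partial>lborel) = (\<integral>\<^sup>+s. ennreal (A s) \<partial>L)"
        unfolding jumps_def A_def by (subst nn_integral_density) auto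
      also have "\<dots> = ennreal (LINT s|L. A s)"
        unfolding A_def by (rule nn_integral_eq_integral[OF integral_square_atMost_le(1)[OF R2]]) simp
      also have "\<dots> \<le> ennreal (6 * R2\<^sup>2 * H (1 / R2))"
        unfolding A_def by (rule ennreal_leI[OF integral_square_atMost_le(2)[OF R2]])
      finally show ?thesis .
    qed
    have "ennreal (H (1 / r)) = (\<integral>\<^sup>+s. ennreal (H_kernel (1 / r * s)) \<partial>L)"
      unfolding H_def
      by (rule nn_integral_eq_integral[symmetric])
         (use r0 integrable_H_kernel[of "1 / r"] in \<open>auto intro!: AE_L_I H_kernel_nonneg\<close>)
    also have "\<dots> = (\<integral>\<^sup>+s. ennreal (jump_density \<nu> s) * ennreal (H_kernel (1 / r * s)) \<partial>lborel)"
      unfolding jumps_def by (subst nn_integral_density) auto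
    also have "\<dots> \<le> (\<integral>\<^sup>+s. ennreal (1 / r\<^sup>2) * (ennreal (jump_density \<nu> s) * ennreal (A s))
        + ennreal (a7 * \<nu> r) * (ennreal ((s / r) powr ((2 - \<alpha>4) - 1)) * indicator {R2..r} s)
        + ennreal (\<nu> r / a6) * (ennreal ((s / r) powr (- (1 + \<alpha>3))) * indicator {r..} s) \<partial>lborel)"
    proof (rule nn_integral_mono)
      fix s
      consider "s \<le> 0" | "0 < s" "s \<le> R2" | "R2 < s" "s \<le> r" | "r < s" by linarith
      then show "ennreal (jump_density \<nu> s) * ennreal (H_kernel (1 / r * s)) \<le>
        ennreal (1 / r\<^sup>2) * (ennreal (jump_density \<nu> s) * ennreal (A s))
        + ennreal (a7 * \<nu> r) * (ennreal ((s / r) powr ((2 - \<alpha>4) - 1)) * indicator {R2..r} s)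
        + ennreal (\<nu> r / a6) * (ennreal ((s / r) powr (- (1 + \<alpha>3))) * indicator {r..} s)" (is "?l \<le> ?x + ?y + ?z")
      proof cases
        case 1
        then show ?thesis by (simp add: jump_density_def)
      next
        case 2
        have "H_kernel (1 / r * s) \<le> (1 / r * s)\<^sup>2" using 2 r0 by (intro H_kernel_le_square) auto
        then have "\<nu> s * H_kernel (1 / r * s) \<le> \<nu> s * (1 / r * s)\<^sup>2"
          using \<nu>_pos[of s] 2 by (intro mult_left_mono) auto
        then have "\<nu> s * H_kernel (1 / r * s) \<le> 1 / r\<^sup>2 * (\<nu> s * s\<^sup>2)"
          by (simp add: power_divide)
        then have "?l \<le> ?x"
          using 2 \<nu>_pos[of s] r0
          by (simp add: A_def ennreal_mult'[symmetric] ennreal_leI)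
        also have "\<dots> \<le> ?x + ?y + ?z" by (simp add: add.assoc)
        finally show ?thesis .
      next
        case 3
        then have s0: "0 < s" using R2 by linarith
        have "H_kernel (1 / r * s) \<le> (s / r)\<^sup>2" using s0 r0 H_kernel_le_square[of "1 / r * s"] by simp
        moreover have "\<nu> s \<le> a7 * (r / s) powr (1 + \<alpha>4) * \<nu> r" using 3 by (intro \<nu>_upper) auto
        ultimately have "\<nu> s * H_kernel (1 / r * s) \<le> a7 * (r / s) powr (1 + \<alpha>4) * \<nu> r * (s / r)\<^sup>2"
          using s0 r0 \<nu>_pos[OF s0] by (intro mult_mono H_kernel_nonneg) auto
        also have "\<dots> = a7 * \<nu> r * (s / r) powr ((2 - \<alpha>4) - 1)"
        proof -
          have "(r / s) powr (1 + \<alpha>4) * (s / r)\<^sup>2 = (s / r) powr (- (1 + \<alpha>4)) * (s / r) powr 2"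
          proof -
            have "(r / s) powr (1 + \<alpha>4) = inverse (s / r) powr (1 + \<alpha>4)" by simp
            also have "\<dots> = (s / r) powr (- (1 + \<alpha>4))"
              using s0 r0 by (simp only: inverse_powr powr_minus divide_nonneg_nonneg less_imp_le)
            finally show ?thesis using s0 r0 by simp
          qed
          also have "\<dots> = (s / r) powr ((2 - \<alpha>4) - 1)" by (simp add: powr_add[symmetric])
          finally show ?thesis by (simp add: mult_ac)
        qed
        finally have "?l \<le> ?y"
          using 3 s0 \<nu>_pos[of s] a67 nr by (simp add: ennreal_mult'[symmetric] ennreal_leI)
        also have "\<dots> \<le> ?x + ?y + ?z" by (simp add: add.assoc add_increasing)
        finally show ?thesis .
      next
        case 4
        then have s0: "0 < s" using r0 by linarith
        have "a6 * (s / r) powr (1 + \<alpha>3) * \<nu> s \<le> \<nu> r" using 4 r by (intro \<nu>_lower) auto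
        then have "\<nu> s \<le> \<nu> r / a6 * (s / r) powr (- (1 + \<alpha>3))"
          using a67 s0 r0 unfolding powr_minus by (simp add: field_simps)
        moreover have "\<nu> s * H_kernel (1 / r * s) \<le> \<nu> s * 1"
          using s0 r0 \<nu>_pos[OF s0] by (intro mult_left_mono H_kernel_le_1) auto
        ultimately have "\<nu> s * H_kernel (1 / r * s) \<le> \<nu> r / a6 * (s / r) powr (- (1 + \<alpha>3))" by linarith
        then have "?l \<le> ?z"
          using 4 s0 \<nu>_pos[of s] a67 nr by (simp add: ennreal_mult'[symmetric] ennreal_leI)
        also have "\<dots> \<le> ?x + ?y + ?z" by (simp add: add_increasing)
        finally show ?thesis .
      qed
    qed
    also have "\<dots> = ennreal (1 / r\<^sup>2) * (\<integral>\<^sup>+s. ennreal (jump_density \<nu> s) * ennreal (A s) \<partial>lborel)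
        + ennreal (a7 * \<nu> r) * (\<integral>\<^sup>+s. ennreal ((s / r) powr ((2 - \<alpha>4) - 1)) * indicator {R2..r} s \<partial>lborel)
        + ennreal (\<nu> r / a6) * (\<integral>\<^sup>+s. ennreal ((s / r) powr (- (1 + \<alpha>3))) * indicator {r..} s \<partial>lborel)"
      by (subst nn_integral_add nn_integral_cmult; (simp add: A_def)?)+ 
    also have "\<dots>
      \<le> ennreal (1 / r\<^sup>2) * ennreal (6 * R2\<^sup>2 * H (1 / R2))
        + ennreal (a7 * \<nu> r) * ennreal (r / (2 - \<alpha>4)) + ennreal (\<nu> r / a6) * ennreal (r / \<alpha>3)"
      using R2 r r0 \<alpha>34 
      by (intro add_mono mult_left_mono order_refl nn_integral_powr_head PA) (auto simp: nn_integral_powr_tail simp del: minus_add_distrib)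
    also have "\<dots> = ennreal (1 / r\<^sup>2 * (6 * R2\<^sup>2 * H (1 / R2)) + a7 * \<nu> r * (r / (2 - \<alpha>4)) + \<nu> r / a6 * (r / \<alpha>3))"
      using r0 nr a67 \<alpha>34 R2 H_nonneg[of "1 / R2"]
      by (subst (1 2 3) ennreal_mult[symmetric], simp_all)
    finally have "H (1 / r) \<le> 1 / r\<^sup>2 * (6 * R2\<^sup>2 * H (1 / R2)) + a7 * \<nu> r * (r / (2 - \<alpha>4)) + \<nu> r / a6 * (r / \<alpha>3)"
      using r0 nr a67 \<alpha>34 R2 H_nonneg[of "1 / R2"]
      by (subst (asm) ennreal_le_iff) (auto intro!: add_nonneg_nonneg mult_nonneg_nonneg)
    moreover have "1 / r\<^sup>2 * (6 * R2\<^sup>2 * H (1 / R2)) \<le> C1 * (r * \<nu> r)"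
    proof -
      \<comment> \<open>Here \<alpha>4 < 2 enters again: the square is at most the power \<alpha>4,
        which the upper bound for \<open>\<nu> R2 / \<nu> r\<close> converts into a multiple of
        \<open>r * \<nu> r\<close>.\<close>
      have "(R2 / r)\<^sup>2 = (R2 / r) powr 2" using R2 r0 by simp
      also have "\<dots> \<le> (R2 / r) powr \<alpha>4" using R2 r r0 \<alpha>34 by (intro powr_mono') auto
      finally have "(R2 / r)\<^sup>2 * (R2 * \<nu> R2) \<le> (R2 / r) powr \<alpha>4 * (R2 * \<nu> R2)"
        using R2 n2 by (intro mult_right_mono) auto
      also have "\<dots> = (R2 / r) powr (1 + \<alpha>4) * (r * \<nu> R2)"
        using R2 r0 by (simp add: powr_add)
      also have "\<dots> \<le> (R2 / r) powr (1 + \<alpha>4) * (r * (a7 * (r / R2) powr (1 + \<alpha>4) * \<nu> r))"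
        using r r0 by (intro mult_left_mono \<nu>_upper) auto
      also have "\<dots> = a7 * (r * \<nu> r)"
        using R2 r0 by (simp add: powr_divide)
      finally have "R2\<^sup>2 / r\<^sup>2 \<le> a7 / (R2 * \<nu> R2) * (r * \<nu> r)"
        using R2 n2 by (simp add: power_divide pos_le_divide_eq)
      then have "6 * H (1 / R2) * (R2\<^sup>2 / r\<^sup>2) \<le> 6 * H (1 / R2) * (a7 / (R2 * \<nu> R2) * (r * \<nu> r))"
        using H_nonneg[of "1 / R2"] R2 by (intro mult_left_mono) auto
      then show ?thesis using R2 by (simp add: C1_def mult_ac)
    qed
    ultimately show ?thesis by (simp add: C_def algebra_simps)
  qed
  moreover have "0 < C" unfolding C_def using C1 C2 by linarith
  ultimately show ?thesis using that by blast
qed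

end

text \<open>A single term of the exponential series, of index \<open>n\<close> with
  \<open>2 \<le> n * \<alpha>\<close>, already dominates the square.\<close>

lemma exp_neg_powr_le:
  assumes "0 < c" "0 < \<alpha>"
  obtains K where "0 < K" "\<And>v::real. 1 \<le> v \<Longrightarrow> exp (- c * v powr \<alpha>) \<le> K / v\<^sup>2"
proof -
  obtain n :: nat where n: "2 / \<alpha> \<le> real n" using real_arch_simple by blast
  show ?thesis
  proof (rule that[of "fact n / c ^ n"])
    show "0 < fact n / c ^ n" using assms by simp
    fix v :: real assume v: "1 \<le> v"
    have "v\<^sup>2 = v powr 2" using v by simp
    also have "\<dots> \<le> v powr (\<alpha> * real n)" using n v assms by (intro powr_mono) (auto simp: field_simps)
    also have "\<dots> = (v powr \<alpha>) ^ n" using v by (simp add: powr_powr[symmetric] powr_realpow)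
    finally have "c ^ n * v\<^sup>2 \<le> (c * v powr \<alpha>) ^ n" using assms by (simp add: power_mult_distrib)
    also have "\<dots> \<le> fact n * exp (c * v powr \<alpha>)"
    proof -
      have "(c * v powr \<alpha>) ^ n / fact n \<le> exp (c * v powr \<alpha>)"
        using sum_le_suminf[OF summable_exp, of "{n}" "c * v powr \<alpha>"] assms
        by (simp add: exp_def scaleR_conv_of_real divide_inverse mult.commute)
      then show ?thesis by (simp add: field_simps)
    qed
    finally have "c ^ n * v\<^sup>2 \<le> fact n * exp (c * v powr \<alpha>)" .
    then show "exp (- c * v powr \<alpha>) \<le> fact n / c ^ n / v\<^sup>2"
      using assms v by (simp add: exp_minus field_simps)
  qed
qed

section \<open>Power bounds for H and the truncated variance\<close>

context levy_nu_scaling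
begin

text \<open>Serves as a lower bound for \<nu> on all of \<open>(0, r]\<close>, from the scale of
  \<open>r\<close> alone. The constants \<open>A\<close>, \<open>B\<close> and \<open>D\<close>
  belong to the cases \<open>R2 \<le> s\<close>, \<open>s < R2 \<le> r\<close> and
  \<open>r < R2\<close>.\<close>

lemma H_le_\<nu>_below:
  assumes r0: "0 < r0"
  obtains C where "0 < C" "\<And>r s. r0 \<le> r \<Longrightarrow> 0 < s \<Longrightarrow> s \<le> r \<Longrightarrow> H (1 / r) \<le> C * (r * \<nu> s)"
proof -
  obtain C1 where C1: "0 < C1" "\<And>r. R2 \<le> r \<Longrightarrow> H (1 / r) \<le> C1 * (r * \<nu> r)" using H_le_\<nu> by blast
  define A where "A = C1 / a6"
  define B where "B = C1 * \<nu> R2 / (a6 * \<epsilon>)"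
  define D where "D = H (1 / r0) / (r0 * \<epsilon>)"
  have n2: "0 < \<nu> R2" by (simp add: \<nu>_pos')
  have ABD: "0 < A" "0 < B" "0 \<le> D"
    using C1 a67 \<epsilon> n2 r0 H_nonneg[of "1 / r0"] by (auto simp: A_def B_def D_def)
  show ?thesis
  proof (rule that[of "A + B + D"])
    show "0 < A + B + D" using ABD by linarith
    fix r s assume r: "r0 \<le> r" and s: "0 < s" "s \<le> r"
    have rs: "0 < r * \<nu> s" using r r0 s \<nu>_pos[OF s(1)] by simp
    consider "R2 \<le> s" | "s < R2" "R2 \<le> r" | "r < R2" using s by linarith
    then have "\<exists>E\<in>{A, B, D}. H (1 / r) \<le> E * (r * \<nu> s)"
    proof cases
      case 1
      have "H (1 / r) \<le> C1 * (r * \<nu> r)" using 1 s by (intro C1) auto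
      also have "\<dots> \<le> C1 * (r * (\<nu> s / a6))"
        using \<nu>_almost_decreasing[of s r] 1 s a67 C1 by (intro mult_left_mono) (auto simp: field_simps)
      finally show ?thesis by (simp add: A_def mult_ac)
    next
      case 2
      have "\<nu> r \<le> \<nu> R2 / a6" using \<nu>_almost_decreasing[of R2 r] 2 a67 by (simp add: field_simps)
      also have "\<dots> \<le> \<nu> R2 / a6 * (\<nu> s / \<epsilon>)"
        using \<epsilon> 2 s n2 a67 by (intro mult_le_cancel_left1[THEN iffD2]) (auto simp: field_simps)
      finally have "\<nu> r \<le> \<nu> R2 / a6 * (\<nu> s / \<epsilon>)" .
      then have "C1 * (r * \<nu> r) \<le> C1 * (r * (\<nu> R2 / a6 * (\<nu> s / \<epsilon>)))"
        using C1 s by (intro mult_left_mono) auto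
      with C1(2)[OF 2(2)] have "H (1 / r) \<le> C1 * (r * (\<nu> R2 / a6 * (\<nu> s / \<epsilon>)))" by linarith
      also have "\<dots> = B * (r * \<nu> s)" by (simp add: B_def)
      finally show ?thesis by blast
    next
      case 3
      have "r0 * \<epsilon> \<le> r * \<nu> s" using 3 s r r0 \<epsilon> by (intro mult_mono) auto
      then have "D * (r0 * \<epsilon>) \<le> D * (r * \<nu> s)" using ABD by (intro mult_left_mono) auto
      moreover have "H (1 / r) \<le> H (1 / r0)" using r r0 by (intro H_mono) (auto simp: field_simps)
      moreover have "D * (r0 * \<epsilon>) = H (1 / r0)" using r0 \<epsilon> by (simp add: D_def)
      ultimately show ?thesis by force
    qed
    moreover have "E * (r * \<nu> s) \<le> (A + B + D) * (r * \<nu> s)" if "E \<in> {A, B, D}" for E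
      using that ABD rs by (intro mult_right_mono) auto
    ultimately show "H (1 / r) \<le> (A + B + D) * (r * \<nu> s)" by (meson order_trans)
  qed
qed

text \<open>Up to \<open>1 / R2\<close> both values of \<open>H\<close> are exchanged for values of
  \<nu>. Between \<open>1 / R2\<close> and \<Lambda> a quotient of scales is at most
  \<open>B\<close>, so it suffices to cut \<open>k\<close> down to the part below
  \<open>1 / R2\<close> and to use the monotonicity of \<open>H\<close> for the rest.\<close>

lemma H_ge_power:
  assumes \<Lambda>: "0 < \<Lambda>"
  obtains c where "0 < c" "\<And>k l. 1 \<le> k \<Longrightarrow> 0 < l \<Longrightarrow> k * l \<le> \<Lambda> \<Longrightarrow> c * k powr \<alpha>3 * H l \<le> H (k * l)"
proof -
  obtain C where C: "0 < C" "\<And>r. R2 \<le> r \<Longrightarrow> H (1 / r) \<le> C * (r * \<nu> r)" using H_le_\<nu> by blast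
  obtain D where D: "0 < D" "\<And>r. R2 \<le> r \<Longrightarrow> r * \<nu> r \<le> D * H (1 / r)" using \<nu>_le_H by blast
  define c where "c = a6 / (C * D)"
  have c: "0 < c" using a67 C D by (simp add: c_def)
  have base: "c * k powr \<alpha>3 * H l \<le> H (k * l)" if k: "1 \<le> k" and l: "0 < l" and kl: "k * l \<le> 1 / R2" for k l
  proof -
    define r where "r = 1 / (k * l)"
    have r: "R2 \<le> r" "0 < r" using k l kl R2 by (auto simp: r_def field_simps)
    have "1 * r \<le> k * r" using k r by (intro mult_right_mono) auto
    then have kr: "1 / (k * r) = l" "1 / r = k * l" "r \<le> k * r" using k l by (auto simp: r_def)
    have "H l \<le> C * (k * r * \<nu> (k * r))" using C(2)[of "k * r"] kr r by simp
    moreover have "a6 * k powr (1 + \<alpha>3) * \<nu> (k * r) \<le> \<nu> r" using \<nu>_lower[of r "k * r"] r kr by simp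
    then have "r * (a6 * k powr (1 + \<alpha>3) * \<nu> (k * r)) \<le> r * \<nu> r" using r by (intro mult_left_mono) auto
    then have "a6 * k powr \<alpha>3 * (k * r * \<nu> (k * r)) \<le> r * \<nu> r" using k by (simp add: powr_add mult_ac)
    then have "a6 * k powr \<alpha>3 * (k * r * \<nu> (k * r)) \<le> D * H (k * l)" using D(2)[OF r(1)] kr by simp
    ultimately have "a6 * k powr \<alpha>3 * H l \<le> C * (D * H (k * l))"
    proof -
      have "a6 * k powr \<alpha>3 * H l \<le> a6 * k powr \<alpha>3 * (C * (k * r * \<nu> (k * r)))"
        using a67 \<open>H l \<le> _\<close> by (intro mult_left_mono) auto
      also have "\<dots> = C * (a6 * k powr \<alpha>3 * (k * r * \<nu> (k * r)))" by simp
      also have "\<dots> \<le> C * (D * H (k * l))" using C \<open>a6 * k powr \<alpha>3 * _ \<le> D * _\<close> by (intro mult_left_mono) auto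
      finally show ?thesis .
    qed
    then show ?thesis using C D by (simp add: c_def field_simps)
  qed
  define B where "B = max 1 (\<Lambda> * R2)"
  have B: "1 \<le> B" "\<Lambda> * R2 \<le> B" by (auto simp: B_def)
  define d where "d = min 1 c / B powr \<alpha>3"
  have d: "0 < d" using c B by (simp add: d_def)
  show ?thesis
  proof (rule that[OF d])
    fix k l :: real assume k: "1 \<le> k" and l: "0 < l" and kl: "k * l \<le> \<Lambda>"
    have Hl: "0 < H l" by (rule H_pos[OF l])
    show "d * k powr \<alpha>3 * H l \<le> H (k * l)"
    proof (cases "1 / R2 \<le> l")
      case True
      have "k * (1 / R2) \<le> k * l" using True k by (intro mult_left_mono) auto
      then have "k * (1 / R2) * R2 \<le> \<Lambda> * R2" using kl R2 by (intro mult_right_mono) auto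
      then have "k \<le> B" using B R2 by simp
      then have "k powr \<alpha>3 \<le> B powr \<alpha>3" using k \<alpha>34 by (intro powr_mono2) auto
      then have "d * k powr \<alpha>3 \<le> d * B powr \<alpha>3" using d by (intro mult_left_mono) auto
      also have "\<dots> \<le> 1" using B by (simp add: d_def)
      finally have "d * k powr \<alpha>3 * H l \<le> 1 * H l" using Hl by (intro mult_right_mono) auto
      also have "\<dots> \<le> H (k * l)" using k l by (simp add: H_mono)
      finally show ?thesis .
    next
      case False
      define k' where "k' = min k (1 / (R2 * l))"
      have k': "1 \<le> k'" "k' \<le> k" "k' * l \<le> 1 / R2"
        using False k l R2 by (auto simp: k'_def field_simps min_def)
      have "k \<le> B * k'"
      proof (cases "k \<le> 1 / (R2 * l)")
        case True
        then show ?thesis using B k by (simp add: k'_def mult_le_cancel_right1)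
      next
        case False
        have "k = k * l * R2 * (1 / (R2 * l))" using l R2 by simp
        also have "\<dots> \<le> \<Lambda> * R2 * (1 / (R2 * l))" using kl l R2 by (intro mult_right_mono) auto
        also have "\<dots> \<le> B * (1 / (R2 * l))" using B l R2 by (intro mult_right_mono) auto
        finally show ?thesis using False by (simp add: k'_def)
      qed
      then have "k powr \<alpha>3 \<le> (B * k') powr \<alpha>3" using k \<alpha>34 by (intro powr_mono2) auto
      also have "\<dots> = B powr \<alpha>3 * k' powr \<alpha>3" using B k' by (simp add: powr_mult)
      finally have "d * k powr \<alpha>3 \<le> d * (B powr \<alpha>3 * k' powr \<alpha>3)" using d by (intro mult_left_mono) auto
      also have "\<dots> = min 1 c * k' powr \<alpha>3" using B by (simp add: d_def)
      also have "\<dots> \<le> c * k' powr \<alpha>3" by (intro mult_right_mono) auto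
      finally have "d * k powr \<alpha>3 * H l \<le> c * k' powr \<alpha>3 * H l" using Hl by (intro mult_right_mono) auto
      also have "\<dots> \<le> H (k' * l)" by (rule base[OF k'(1) l k'(3)])
      also have "\<dots> \<le> H (k * l)" using k' l by (intro H_mono) auto
      finally show ?thesis .
    qed
  qed
qed

text \<open>The range ends at \<open>1 / R2\<close> because beyond it \<open>H\<close> reflects
  \<nu> near 0, for which no upper power bound is available.\<close>

lemma H_le_power:
  obtains C where "0 < C" "\<And>k l. 1 \<le> k \<Longrightarrow> 0 < l \<Longrightarrow> k * l \<le> 1 / R2 \<Longrightarrow> H (k * l) \<le> C * k powr \<alpha>4 * H l"
proof -
  obtain C where C: "0 < C" "\<And>r. R2 \<le> r \<Longrightarrow> H (1 / r) \<le> C * (r * \<nu> r)" using H_le_\<nu> by blast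
  obtain D where D: "0 < D" "\<And>r. R2 \<le> r \<Longrightarrow> r * \<nu> r \<le> D * H (1 / r)" using \<nu>_le_H by blast
  show ?thesis
  proof (rule that[of "C * a7 * D"])
    show "0 < C * a7 * D" using C D a67 by simp
    fix k l :: real assume k: "1 \<le> k" and l: "0 < l" and kl: "k * l \<le> 1 / R2"
    define r where "r = 1 / (k * l)"
    have r: "R2 \<le> r" "0 < r" using k l kl R2 by (auto simp: r_def field_simps)
    have "1 * r \<le> k * r" using k r by (intro mult_right_mono) auto
    then have kr: "1 / (k * r) = l" "1 / r = k * l" "r \<le> k * r" using k l by (auto simp: r_def)
    have "H (k * l) \<le> C * (r * \<nu> r)" using C(2)[OF r(1)] kr by simp
    also have "\<dots> \<le> C * (r * (a7 * k powr (1 + \<alpha>4) * \<nu> (k * r)))"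
      using \<nu>_upper[of r "k * r"] r kr C by (intro mult_left_mono) auto
    also have "\<dots> = C * a7 * k powr \<alpha>4 * (k * r * \<nu> (k * r))" using k by (simp add: powr_add mult_ac)
    also have "\<dots> \<le> C * a7 * k powr \<alpha>4 * (D * H l)"
      using D(2)[of "k * r"] kr r C a67 by (intro mult_left_mono) auto
    finally show "H (k * l) \<le> C * a7 * D * k powr \<alpha>4 * H l" by (simp add: mult_ac)
  qed
qed

lemma integral_square_atMost_mono:
  assumes "0 < a" "a \<le> b"
  shows "(LINT s|L. indicator {..a} s * s\<^sup>2) \<le> (LINT s|L. indicator {..b} s * s\<^sup>2)"
  using assms by (intro integral_L_mono integral_square_atMost_le(1)) (auto simp: indicator_def)

text \<open>For \<open>l / \<kappa>1 \<le> 1 / R2\<close> the variance bound and the upper power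
  bound of \<open>H\<close> leave the factor \<open>\<kappa>1 powr (2 - \<alpha>4)\<close>, small
  because \<alpha>4 < 2. For larger \<open>l\<close> the level \<open>\<kappa> / l\<close> is at
  most \<open>b\<close>; the second moment below \<open>b\<close> is small by integrability of
  \<open>min 1 s\<close>, while \<open>H l / l^2\<close> is at least
  \<open>H \<Lambda> / \<Lambda>^2\<close>.\<close>

lemma truncated_variance_small:
  assumes \<eta>: "0 < \<eta>" and \<Lambda>: "0 < \<Lambda>"
  obtains \<kappa> where "0 < \<kappa>" "\<kappa> \<le> 1"
    "\<And>l. 0 < l \<Longrightarrow> l \<le> \<Lambda> \<Longrightarrow> (LINT s|L. indicator {..\<kappa> / l} s * s\<^sup>2) \<le> \<eta> * H l / l\<^sup>2"
proof -
  obtain C where C: "0 < C" "\<And>k l. 1 \<le> k \<Longrightarrow> 0 < l \<Longrightarrow> k * l \<le> 1 / R2 \<Longrightarrow> H (k * l) \<le> C * k powr \<alpha>4 * H l"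
    using H_le_power by blast
  define \<kappa>1 where "\<kappa>1 = min 1 ((\<eta> / (6 * C)) powr (1 / (2 - \<alpha>4)))"
  have k1: "0 < \<kappa>1" "\<kappa>1 \<le> 1" using \<eta> C by (auto simp: \<kappa>1_def)
  have "\<kappa>1 powr (2 - \<alpha>4) \<le> ((\<eta> / (6 * C)) powr (1 / (2 - \<alpha>4))) powr (2 - \<alpha>4)"
    using k1 \<alpha>34 by (intro powr_mono2) (auto simp: \<kappa>1_def)
  also have "\<dots> = \<eta> / (6 * C)" using \<alpha>34 \<eta> C by (simp add: powr_powr)
  finally have k1p: "6 * C * \<kappa>1 powr (2 - \<alpha>4) \<le> \<eta>" using C by (simp add: field_simps)
  define m where "m = (LINT s|L. min 1 s)"
  have m: "0 \<le> m" unfolding m_def by (rule integral_L_nonneg) auto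
  define e where "e = \<eta> * H \<Lambda> / \<Lambda>\<^sup>2"
  have e: "0 < e" using \<eta> \<Lambda> H_pos[OF \<Lambda>] by (simp add: e_def)
  define b where "b = min 1 (e / (m + 1))"
  have b: "0 < b" "b \<le> 1" using e m by (auto simp: b_def)
  have "b * m \<le> e / (m + 1) * m" using m by (intro mult_right_mono) (auto simp: b_def)
  also have "\<dots> \<le> e" using m e by (simp add: field_simps)
  finally have bm: "b * m \<le> e" .
  have small: "(LINT s|L. indicator {..b} s * s\<^sup>2) \<le> e"
  proof -
    have "(LINT s|L. indicator {..b} s * s\<^sup>2) \<le> (LINT s|L. b * min 1 s)"
    proof (rule integral_L_mono[OF integral_square_atMost_le(1)[OF b(1)]])
      fix s :: real assume s: "0 < s"
      show "indicator {..b} s * s\<^sup>2 \<le> b * min 1 s"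
      proof (cases "s \<le> b")
        case True
        then have "s * s \<le> b * s" using s by (intro mult_right_mono) auto
        then show ?thesis using True b by (simp add: power2_eq_square)
      qed (use b s in simp)
    qed (use L.integrable_min in simp)
    then show ?thesis using bm by (simp add: m_def)
  qed
  define \<kappa> where "\<kappa> = min \<kappa>1 (b * \<kappa>1 / R2)"
  have \<kappa>: "0 < \<kappa>" "\<kappa> \<le> \<kappa>1" "\<kappa> \<le> b * \<kappa>1 / R2" using k1 b R2 by (auto simp: \<kappa>_def)
  show ?thesis
  proof (rule that[OF \<kappa>(1)])
    show "\<kappa> \<le> 1" using \<kappa> k1 by linarith
    fix l assume l: "0 < l" "l \<le> \<Lambda>"
    show "(LINT s|L. indicator {..\<kappa> / l} s * s\<^sup>2) \<le> \<eta> * H l / l\<^sup>2"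
    proof (cases "l / \<kappa>1 \<le> 1 / R2")
      case True
      have "(LINT s|L. indicator {..\<kappa> / l} s * s\<^sup>2) \<le> (LINT s|L. indicator {..\<kappa>1 / l} s * s\<^sup>2)"
        using \<kappa> l by (intro integral_square_atMost_mono) (auto simp: divide_right_mono)
      also have "\<dots> \<le> 6 * (\<kappa>1 / l)\<^sup>2 * H (1 / (\<kappa>1 / l))" using k1 l by (intro integral_square_atMost_le) auto
      also have "H (1 / (\<kappa>1 / l)) \<le> C * (1 / \<kappa>1) powr \<alpha>4 * H l"
        using C(2)[of "1 / \<kappa>1" l] True k1 l by simp
      then have "6 * (\<kappa>1 / l)\<^sup>2 * H (1 / (\<kappa>1 / l)) \<le> 6 * (\<kappa>1 / l)\<^sup>2 * (C * (1 / \<kappa>1) powr \<alpha>4 * H l)"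
        by (intro mult_left_mono) auto
      also have "\<dots> = 6 * C * \<kappa>1 powr (2 - \<alpha>4) * (H l / l\<^sup>2)"
        using k1 l by (simp add: powr_diff powr_divide power_divide mult_ac)
      also have "\<dots> \<le> \<eta> * (H l / l\<^sup>2)"
        using k1p H_nonneg[of l] l by (intro mult_right_mono) auto
      finally show ?thesis by simp
    next
      case False
      then have "\<kappa> / l \<le> b"
      proof -
        have "\<kappa>1 / R2 \<le> l" using False k1 R2 by (simp add: field_simps)
        then have "b * (\<kappa>1 / R2) \<le> b * l" using b by (intro mult_left_mono) auto
        then show ?thesis using \<kappa> l by (simp add: field_simps)
      qed
      then have "(LINT s|L. indicator {..\<kappa> / l} s * s\<^sup>2) \<le> (LINT s|L. indicator {..b} s * s\<^sup>2)"
        using \<kappa> l by (intro integral_square_atMost_mono) auto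
      also have "\<dots> \<le> \<eta> * (H \<Lambda> / \<Lambda>\<^sup>2)" using small by (simp add: e_def)
      also have "\<dots> \<le> \<eta> * (H l / l\<^sup>2)"
      proof -
        have "H (\<Lambda> / l * l) \<le> (\<Lambda> / l)\<^sup>2 * H l" using l by (intro H_scale) auto
        then have "H \<Lambda> / \<Lambda>\<^sup>2 \<le> H l / l\<^sup>2" using l \<Lambda> by (simp add: field_simps)
        then show ?thesis using \<eta> by (intro mult_left_mono) auto
      qed
      finally show ?thesis by simp
    qed
  qed
qed

section \<open>Decay of the characteristic function\<close>

definition R :: "real \<Rightarrow> real" where "R \<xi> = (LINT s|L. 1 - cos (\<xi> * s))"

lemma R_nonneg: "0 \<le> R \<xi>"
  unfolding R_def by (rule integral_L_nonneg) simp

lemma R_abs: "R \<bar>\<xi>\<bar> = R \<xi>"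
  by (cases "0 \<le> \<xi>") (auto simp: R_def)

text \<open>Only the jumps in \<open>[1 / \<xi>, 2 / \<xi>]\<close> are used, where the cosine is at
  most \<open>cos 1\<close>. The 8 collects a factor 2 from \<open>r = 2 / \<xi>\<close> and a
  factor 4 from \<open>H \<xi> \<le> 4 * H (\<xi> / 2)\<close>.\<close>

lemma R_ge_H:
  assumes X: "0 < X"
  obtains c where "0 < c" "\<And>\<xi>. 0 < \<xi> \<Longrightarrow> \<xi> \<le> X \<Longrightarrow> c * H \<xi> \<le> R \<xi>"
proof -
  obtain C where C: "0 < C" "\<And>r s. 2 / X \<le> r \<Longrightarrow> 0 < s \<Longrightarrow> s \<le> r \<Longrightarrow> H (1 / r) \<le> C * (r * \<nu> s)"
    using H_le_\<nu>_below[of "2 / X"] X by auto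
  have cos1: "0 < 1 - cos (1::real)"
    using cos_monotone_0_pi[of 0 1] pi_gt3 by simp
  show ?thesis
  proof (rule that[of "(1 - cos 1) / (8 * C)"])
    show "0 < (1 - cos 1) / (8 * C)" using cos1 C by simp
    fix \<xi> assume \<xi>: "0 < \<xi>" "\<xi> \<le> X"
    have "\<xi> * H \<xi> / (8 * C) * (1 - cos 1) * (2 / \<xi> - 1 / \<xi>) \<le> (LINT s|L. 1 - cos (\<xi> * s))"
    proof (rule integral_L_ge_interval)
      fix s assume s: "1 / \<xi> \<le> s" "s \<le> 2 / \<xi>"
      have s0: "0 < s" using s \<xi> by (meson less_le_trans zero_less_divide_1_iff)
      have "H (1 / (2 / \<xi>)) \<le> C * (2 / \<xi> * \<nu> s)"
        using s s0 \<xi> X by (intro C) (auto simp: frac_le)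
      moreover have "H (2 * (\<xi> / 2)) \<le> 2\<^sup>2 * H (\<xi> / 2)" using \<xi> by (intro H_scale) auto
      ultimately have "H \<xi> \<le> 4 * (C * (2 / \<xi> * \<nu> s))" by simp
      then show "\<xi> * H \<xi> / (8 * C) \<le> \<nu> s" using \<xi> C by (simp add: field_simps)
      have "1 \<le> \<xi> * s" "\<xi> * s \<le> 2" using s \<xi> by (auto simp: field_simps)
      then have "cos (\<xi> * s) \<le> cos 1" using pi_gt3 by (intro cos_monotone_0_pi_le) auto
      then show "1 - cos 1 \<le> 1 - cos (\<xi> * s)" by simp
    qed (use \<xi> C H_nonneg[of \<xi>] L.integrable_one_minus_cos[of \<xi>] in \<open>auto simp: divide_right_mono\<close>)
    moreover have "2 / \<xi> - 1 / \<xi> = 1 / \<xi>" by (simp add: diff_divide_distrib[symmetric])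
    ultimately have "\<xi> * H \<xi> / (8 * C) * (1 - cos 1) * (1 / \<xi>) \<le> R \<xi>" unfolding R_def by simp
    moreover have "\<xi> * H \<xi> / (8 * C) * (1 - cos 1) * (1 / \<xi>) = (1 - cos 1) / (8 * C) * H \<xi>"
      using \<xi> by simp
    ultimately show "(1 - cos 1) / (8 * C) * H \<xi> \<le> R \<xi>" by simp
  qed
qed

text \<open>The exponent belongs to half the time of \<open>l\<close>. Up to \<open>X\<close> the
  power bound of \<open>H\<close> makes the left side a stretched exponential in
  \<open>\<xi> / l\<close>. Beyond \<open>X\<close> there is only the logarithmic bound, and the
  exponent is split into two equal parts, one for \<open>1 / \<xi>^2\<close> and one for
  \<open>l^2\<close>.\<close>

lemma exp_R_decay:
  assumes T: "0 < T" "8 \<le> c0 * T" and \<Lambda>: "0 < \<Lambda>" "H \<Lambda> \<le> 1 / T"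
  obtains K where "0 < K"
    "\<And>l \<xi>. 0 < l \<Longrightarrow> l \<le> \<Lambda> \<Longrightarrow> l \<le> \<xi> \<Longrightarrow> exp (- (1 / (2 * H l)) * R \<xi>) \<le> K * l\<^sup>2 / \<xi>\<^sup>2"
proof -
  \<comment> \<open>Beyond \<open>exp 2 / \<delta>\<close> the logarithm is at least 2, so the lower
    bound for \<open>R\<close> is at least \<open>c0\<close>.\<close>
  define X where "X = max \<Lambda> (exp 2 / \<delta>)"
  have X: "0 < X" "\<Lambda> \<le> X" "exp 2 / \<delta> \<le> X" using \<Lambda> by (auto simp: X_def)
  obtain cR where cR: "0 < cR" "\<And>\<xi>. 0 < \<xi> \<Longrightarrow> \<xi> \<le> X \<Longrightarrow> cR * H \<xi> \<le> R \<xi>" using R_ge_H[OF X(1)] by blast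
  obtain c3 where c3: "0 < c3"
    "\<And>k l. 1 \<le> k \<Longrightarrow> 0 < l \<Longrightarrow> k * l \<le> X \<Longrightarrow> c3 * k powr \<alpha>3 * H l \<le> H (k * l)"
    using H_ge_power[OF X(1)] by blast
  have H\<Lambda>: "0 < H \<Lambda>" by (rule H_pos[OF \<Lambda>(1)])
  obtain K1 where K1: "0 < K1" "\<And>v::real. 1 \<le> v \<Longrightarrow> exp (- (cR * c3 / 2) * v powr \<alpha>3) \<le> K1 / v\<^sup>2"
    using exp_neg_powr_le[of "cR * c3 / 2" \<alpha>3] cR c3 \<alpha>34 by auto
  obtain K2 where K2: "0 < K2" "\<And>v::real. 1 \<le> v \<Longrightarrow> exp (- (c0 * c3 / (4 * H \<Lambda>)) * v powr \<alpha>3) \<le> K2 / v\<^sup>2"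
    using exp_neg_powr_le[of "c0 * c3 / (4 * H \<Lambda>)" \<alpha>3] c0 c3 H\<Lambda> \<alpha>34 by auto
  define K3 where "K3 = K2 / \<Lambda>\<^sup>2 * (exp 2 / \<delta>\<^sup>2)"
  have K3: "0 < K3" using K2 \<Lambda> \<delta> by (simp add: K3_def)
  show ?thesis
  proof (rule that[of "K1 + K3"])
    show "0 < K1 + K3" using K1 K3 by simp
    fix l \<xi> assume l: "0 < l" "l \<le> \<Lambda>" and \<xi>: "l \<le> \<xi>"
    have \<xi>0: "0 < \<xi>" using l \<xi> by linarith
    have Hl: "0 < H l" "H l \<le> H \<Lambda>" using l by (auto intro: H_pos H_mono)
    show "exp (- (1 / (2 * H l)) * R \<xi>) \<le> (K1 + K3) * l\<^sup>2 / \<xi>\<^sup>2"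
    proof (cases "\<xi> \<le> X")
      case True
      have "c3 * (\<xi> / l) powr \<alpha>3 * H l \<le> H \<xi>" using c3(2)[of "\<xi> / l" l] \<xi> l True by simp
      then have "cR * (c3 * (\<xi> / l) powr \<alpha>3 * H l) \<le> cR * H \<xi>" using cR by (intro mult_left_mono) auto
      also have "\<dots> \<le> R \<xi>" using cR(2)[OF \<xi>0 True] .
      finally have "1 / (2 * H l) * (cR * (c3 * (\<xi> / l) powr \<alpha>3 * H l)) \<le> 1 / (2 * H l) * R \<xi>"
        using Hl by (intro mult_left_mono) auto
      then have "cR * c3 / 2 * (\<xi> / l) powr \<alpha>3 \<le> 1 / (2 * H l) * R \<xi>" using Hl by simp
      then have "exp (- (1 / (2 * H l)) * R \<xi>) \<le> exp (- (cR * c3 / 2) * (\<xi> / l) powr \<alpha>3)" by simp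
      also have "\<dots> \<le> K1 / (\<xi> / l)\<^sup>2" using \<xi> l by (intro K1) auto
      also have "\<dots> = K1 * l\<^sup>2 / \<xi>\<^sup>2" using l by (simp add: power_divide)
      also have "\<dots> \<le> (K1 + K3) * l\<^sup>2 / \<xi>\<^sup>2" using K3 by (intro divide_right_mono mult_right_mono) auto
      finally show ?thesis .
    next
      case False
      then have "X * \<delta> \<le> \<xi> * \<delta>" using \<delta> by (intro mult_right_mono) auto
      moreover have "exp 2 \<le> X * \<delta>" using X \<delta> by (simp add: pos_divide_le_eq)
      ultimately have e2: "exp 2 \<le> \<xi> * \<delta>" by linarith
      then have pos: "0 < \<xi> * \<delta>" using \<xi>0 \<delta> by simp
      have ln2: "2 \<le> ln (\<xi> * \<delta>)" using e2 pos by (simp add: ln_ge_iff)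
      have "1 \<le> \<xi> * \<delta>" using e2 one_le_exp_iff[of "2::real"] by linarith
      then have Rge: "c0 * (ln (\<xi> * \<delta>) - 1) \<le> R \<xi>"
        unfolding R_def using \<xi>0 by (intro integral_one_minus_cos_ge) auto
      have TH: "T \<le> 1 / H l" using Hl \<Lambda>(2) T by (simp add: field_simps) (smt (verit) mult_left_mono)
      have A: "exp (- (1 / (4 * H l)) * R \<xi>) \<le> exp 2 / (\<xi> * \<delta>)\<^sup>2"
      proof -
        \<comment> \<open>The place where \<open>8 \<le> c0 * T\<close> is used: a quarter of the
          time must still produce the power 2.\<close>
        have "2 * (ln (\<xi> * \<delta>) - 1) \<le> c0 * T / 4 * (ln (\<xi> * \<delta>) - 1)"
          using T ln2 by (intro mult_right_mono) auto
        also have "\<dots> = T / 4 * (c0 * (ln (\<xi> * \<delta>) - 1))" by simp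
        also have "\<dots> \<le> T / 4 * R \<xi>" using Rge T by (intro mult_left_mono) auto
        also have "\<dots> \<le> (1 / H l) / 4 * R \<xi>" using TH R_nonneg[of \<xi>] by (intro mult_right_mono) auto
        finally have "- (1 / (4 * H l)) * R \<xi> \<le> 2 - 2 * ln (\<xi> * \<delta>)" by (simp add: algebra_simps)
        then have "exp (- (1 / (4 * H l)) * R \<xi>) \<le> exp (2 - 2 * ln (\<xi> * \<delta>))" by simp
        also have "\<dots> = exp 2 / (\<xi> * \<delta>)\<^sup>2"
          using pos by (simp add: exp_diff exp_double)
        finally show ?thesis .
      qed
      \<comment> \<open>From \<xi> this part takes only \<open>c0 \<le> R \<xi>\<close>; the decay
        in \<open>l\<close> comes from the length \<open>1 / H l\<close> of the time.\<close>
      have B: "exp (- (1 / (4 * H l)) * R \<xi>) \<le> K2 / (\<Lambda> / l)\<^sup>2"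
      proof -
        have "c3 * (\<Lambda> / l) powr \<alpha>3 * H l \<le> H \<Lambda>" using c3(2)[of "\<Lambda> / l" l] l X by simp
        then have "c3 * (\<Lambda> / l) powr \<alpha>3 / H \<Lambda> \<le> 1 / H l" using Hl H\<Lambda> by (simp add: field_simps)
        then have "c3 * (\<Lambda> / l) powr \<alpha>3 / H \<Lambda> * (c0 / 4) \<le> 1 / H l * (c0 / 4)"
          using c0 by (intro mult_right_mono) auto
        moreover have "c0 * 1 \<le> c0 * (ln (\<xi> * \<delta>) - 1)" using ln2 c0 by (intro mult_left_mono) auto
        then have "1 / (4 * H l) * c0 \<le> 1 / (4 * H l) * R \<xi>" using Rge Hl by (intro mult_left_mono) auto
        ultimately have "c0 * c3 / (4 * H \<Lambda>) * (\<Lambda> / l) powr \<alpha>3 \<le> 1 / (4 * H l) * R \<xi>" by (simp add: field_simps)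
        then have "exp (- (1 / (4 * H l)) * R \<xi>) \<le> exp (- (c0 * c3 / (4 * H \<Lambda>)) * (\<Lambda> / l) powr \<alpha>3)" by simp
        also have "\<dots> \<le> K2 / (\<Lambda> / l)\<^sup>2" using l by (intro K2) auto
        finally show ?thesis .
      qed
      have "exp (- (1 / (2 * H l)) * R \<xi>) = exp (- (1 / (4 * H l)) * R \<xi>) * exp (- (1 / (4 * H l)) * R \<xi>)"
        by (simp add: exp_add[symmetric])
      also have "\<dots> \<le> K2 / (\<Lambda> / l)\<^sup>2 * (exp 2 / (\<xi> * \<delta>)\<^sup>2)" using K2 by (intro mult_mono A B) auto
      also have "\<dots> = K3 * l\<^sup>2 / \<xi>\<^sup>2" by (simp add: K3_def power_divide power_mult_distrib mult_ac)
      also have "\<dots> \<le> (K1 + K3) * l\<^sup>2 / \<xi>\<^sup>2" using K1 by (intro divide_right_mono mult_right_mono) auto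
      finally show ?thesis .
    qed
  qed
qed

end

section \<open>Boundedness of the transition density\<close>

text \<open>The kernel of the inversion formula has modulus at most \<open>b - a\<close>. Working
  with a majorant \<open>g\<close> allows an explicit antiderivative.\<close>

lemma (in real_distribution) measure_le_integral_char:
  assumes ab: "a \<le> b" and null: "measure M {a} = 0" "measure M {b} = 0"
    and g: "\<And>t. norm (char M t) \<le> g t" "continuous_on UNIV g"
    and B: "\<And>T. 0 \<le> T \<Longrightarrow> (LINT t|lborel. indicator {-T..T} t * g t) \<le> B"
  shows "measure M {a<..b} \<le> (b - a) * B / (2 * pi)"
proof -
  let ?F = "\<lambda>t. (iexp (- (t * a)) - iexp (- (t * b))) / (\<i> * t) * char M t"
  have lim: "(\<lambda>n. 1 / (2 * pi) * (CLBINT t=- real n..real n. ?F t)) \<longlonglongrightarrow> measure M {a<..b}"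
    using Levy_Inversion[OF ab null] by simp
  have "norm (1 / (2 * pi) * (CLBINT t=- real n..real n. ?F t)) \<le> (b - a) * B / (2 * pi)" for n
  proof -
    have "norm (CLBINT t=- real n..real n. ?F t) = norm (CLINT t|lborel. indicator {- real n..real n} t *\<^sub>R ?F t)"
      using interval_integral_Icc[of "- real n" "real n" ?F] by (simp add: set_lebesgue_integral_def)
    also have "\<dots> \<le> (LINT t|lborel. norm (indicator {- real n..real n} t *\<^sub>R ?F t))"
      by (rule integral_norm_bound)
    also have "\<dots> \<le> (LINT t|lborel. (b - a) * (indicator {- real n..real n} t * g t))"
    proof (rule integral_mono')
      have "continuous_on {- real n..real n} g" using g(2) continuous_on_subset by blast
      then show "integrable lborel (\<lambda>t. (b - a) * (indicator {- real n..real n} t * g t))"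
        using borel_integrable_atLeastAtMost'[of "- real n" "real n" g] by (simp add: set_integrable_def)
      fix t :: real
      have g0: "0 \<le> g t" using g(1)[of t] norm_ge_zero order_trans by blast
      then show "0 \<le> (b - a) * (indicator {- real n..real n} t * g t)" using ab by simp
      have "norm ((iexp (- (t * a)) - iexp (- (t * b))) / (\<i> * t)) \<le> b - a"
        using Levy_Inversion_aux2[of "- b" "- a" t] ab by (cases "t = 0") auto
      then have "norm (?F t) \<le> (b - a) * g t"
        unfolding norm_mult using g(1)[of t] ab by (intro mult_mono) auto
      then show "norm (indicator {- real n..real n} t *\<^sub>R ?F t) \<le> (b - a) * (indicator {- real n..real n} t * g t)"
        by (cases "t \<in> {- real n..real n}") auto
    qed
    also have "\<dots> \<le> (b - a) * B" using B[of "real n"] ab by (simp add: mult_left_mono)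
    finally show ?thesis by (simp add: norm_mult norm_divide divide_right_mono)
  qed
  then have "norm (complex_of_real (measure M {a<..b})) \<le> (b - a) * B / (2 * pi)"
    by (intro tendsto_le[OF _ tendsto_const tendsto_norm[OF lim]]) auto
  then show ?thesis by simp
qed

lemma (in real_distribution) nonatom_between:
  assumes "x < y"
  obtains z where "x < z" "z < y" "measure M {z} = 0"
proof -
  have "countable {z. measure M {z} \<noteq> 0}" by (rule countable_support)
  then have "\<not> {x<..<y} \<subseteq> {z. measure M {z} \<noteq> 0}"
    using uncountable_open_interval[of x y] assms countable_subset by blast
  then show ?thesis using that by (auto simp: subset_eq)
qed

text \<open>Inversion needs endpoints without mass. All but countably many points qualify, so the
  interval can be enlarged by less than any given amount.\<close>

lemma (in real_distribution) measure_interval_le_of_nonatoms: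
  assumes w: "0 \<le> w" and le: "\<And>a b. a \<le> b \<Longrightarrow> measure M {a} = 0 \<Longrightarrow> measure M {b} = 0 \<Longrightarrow> measure M {a<..b} \<le> (b - a) * C"
  shows "measure M {x..x + w} \<le> w * C"
proof (rule field_le_epsilon)
  fix e :: real assume e: "0 < e"
  define d where "d = e / (2 * (\<bar>C\<bar> + 1))"
  have d: "0 < d" using e by (simp add: d_def)
  obtain a where a: "x - d < a" "a < x" "measure M {a} = 0" using nonatom_between[of "x - d" x] d by auto
  obtain b where b: "x + w < b" "b < x + w + d" "measure M {b} = 0" using nonatom_between[of "x + w" "x + w + d"] d by auto
  have "measure M {x..x + w} \<le> measure M {a<..b}" using a b by (intro finite_measure_mono) auto
  also have "\<dots> \<le> (b - a) * C" using a b w by (intro le) auto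
  also have "\<dots> = w * C + (b - a - w) * C" by (simp add: algebra_simps)
  also have "(b - a - w) * C \<le> (b - a - w) * (\<bar>C\<bar> + 1)" using a b by (intro mult_left_mono) auto
  also have "\<dots> \<le> (2 * d) * (\<bar>C\<bar> + 1)" using a b by (intro mult_right_mono) auto
  also have "\<dots> = e"
  proof -
    have "\<bar>C\<bar> + 1 \<noteq> 0" by linarith
    then show ?thesis by (simp add: d_def divide_simps)
  qed
  finally show "measure M {x..x + w} \<le> w * C + e" by simp
qed

context levy_nu_scaling
begin

text \<open>Formulated at \<open>1 / (2 * H l)\<close>, half the time belonging to \<open>l\<close>,
  because the law at the full time is treated as a convolution of two copies.\<close>

theorem laplace_law_sup_bound:
  assumes T: "0 < T" "8 \<le> c0 * T" and \<Lambda>: "0 < \<Lambda>" "H \<Lambda> \<le> 1 / T"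
  obtains C where "0 < C" "\<And>l \<mu> x w. 0 < l \<Longrightarrow> l \<le> \<Lambda> \<Longrightarrow> laplace_law (jumps \<nu> (1 / (2 * H l))) \<mu> \<Longrightarrow>
    0 \<le> w \<Longrightarrow> emeasure \<mu> {x..x + w} \<le> ennreal (C * l * w)"
proof -
  obtain K where K: "0 < K"
    "\<And>l \<xi>. 0 < l \<Longrightarrow> l \<le> \<Lambda> \<Longrightarrow> l \<le> \<xi> \<Longrightarrow> exp (- (1 / (2 * H l)) * R \<xi>) \<le> K * l\<^sup>2 / \<xi>\<^sup>2"
    using exp_R_decay[OF T \<Lambda>] by blast
  show ?thesis
  proof (rule that[of "1 + K"])
    fix l \<mu> x w assume l: "0 < l" "l \<le> \<Lambda>" and law: "laplace_law (jumps \<nu> (1 / (2 * H l))) \<mu>" and w: "0 \<le> (w::real)"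
    have t: "0 < 1 / (2 * H l)" using H_pos[OF l(1)] by simp
    interpret N: levy_measure "jumps \<nu> (1 / (2 * H l))" by (rule levy_measure_jumps[OF t])
    interpret \<mu>: real_distribution \<mu> using law by (simp add: laplace_law_def)
    \<comment> \<open>A Cauchy profile of width \<open>l\<close>: it exceeds the trivial bound 1 up
      to \<open>l\<close> and \<open>K * l^2 / \<xi>^2\<close> beyond. Its integral
      \<open>2 * (1 + K) * l * pi\<close> meets the \<open>2 * pi\<close> of the inversion
      formula.\<close>
    define g where "g \<xi> = 2 * (1 + K) * (l\<^sup>2 / (l\<^sup>2 + \<xi>\<^sup>2))" for \<xi>
    have den: "0 < l\<^sup>2 + \<xi>\<^sup>2" for \<xi> using l by (simp add: add_pos_nonneg)
    have "norm (char \<mu> \<xi>) \<le> g \<xi>" for \<xi>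
    proof -
      have ch: "norm (char \<mu> \<xi>) = exp (- (1 / (2 * H l)) * R \<bar>\<xi>\<bar>)"
        unfolding N.norm_char_laplace_law[OF law] R_abs
        by (subst integral_jumps[OF t]) (auto simp: R_def)
      show ?thesis
      proof (cases "l \<le> \<bar>\<xi>\<bar>")
        case True
        then have "norm (char \<mu> \<xi>) \<le> K * l\<^sup>2 / \<xi>\<^sup>2" unfolding ch using K(2)[OF l True] by simp
        also have "\<dots> \<le> g \<xi>"
        proof -
          have le: "l\<^sup>2 \<le> \<xi>\<^sup>2" using True l abs_le_square_iff[of l \<xi>] by simp
          have x0: "0 < \<xi>\<^sup>2" using True l by (simp add: zero_less_power2) 
          have "1 / \<xi>\<^sup>2 \<le> 2 * (1 / (l\<^sup>2 + \<xi>\<^sup>2))" using le x0 den[of \<xi>] by (simp add: field_simps)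
          then have "K * l\<^sup>2 * (1 / \<xi>\<^sup>2) \<le> K * l\<^sup>2 * (2 * (1 / (l\<^sup>2 + \<xi>\<^sup>2)))"
            using K by (intro mult_left_mono) auto
          moreover have "0 \<le> 2 * (l\<^sup>2 / (l\<^sup>2 + \<xi>\<^sup>2))" using den[of \<xi>] by simp
          moreover have "g \<xi> = 2 * (l\<^sup>2 / (l\<^sup>2 + \<xi>\<^sup>2)) + K * l\<^sup>2 * (2 * (1 / (l\<^sup>2 + \<xi>\<^sup>2)))"
            by (simp add: g_def distrib_right distrib_left add_divide_distrib mult_ac)
          moreover have "K * l\<^sup>2 / \<xi>\<^sup>2 = K * l\<^sup>2 * (1 / \<xi>\<^sup>2)" by simp
          ultimately show ?thesis by linarith
        qed
        finally show ?thesis .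
      next
        case False
        then have "\<xi>\<^sup>2 \<le> l\<^sup>2" using abs_le_square_iff[of \<xi> l] l by simp
        then have "1 \<le> 2 * (l\<^sup>2 / (l\<^sup>2 + \<xi>\<^sup>2))" using den[of \<xi>] by (simp add: field_simps)
        moreover have "2 * (l\<^sup>2 / (l\<^sup>2 + \<xi>\<^sup>2)) * 1 \<le> 2 * (l\<^sup>2 / (l\<^sup>2 + \<xi>\<^sup>2)) * (1 + K)"
          using K den[of \<xi>] by (intro mult_left_mono) auto
        moreover have "g \<xi> = 2 * (l\<^sup>2 / (l\<^sup>2 + \<xi>\<^sup>2)) * (1 + K)"
          by (simp only: g_def mult.assoc mult.commute mult.left_commute)
        ultimately have "1 \<le> g \<xi>" by linarith
        then show ?thesis using \<mu>.cmod_char_le_1[of \<xi>] by linarith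
      qed
    qed
    moreover have g_cont: "continuous_on UNIV g"
      unfolding g_def using den by (intro continuous_intros) (metis less_irrefl)
    moreover have "(LINT t|lborel. indicator {-T..T} t * g t) \<le> 2 * (1 + K) * (l * pi)" if "0 \<le> T" for T
    proof -
      have "(LINT t|lborel. indicator {-T..T} t *\<^sub>R g t) = 2 * (1 + K) * l * arctan (T / l) - 2 * (1 + K) * l * arctan (- T / l)"
      proof (rule integral_FTC_atLeastAtMost)
        fix t
        have "((\<lambda>t. 2 * (1 + K) * l * arctan (t / l)) has_real_derivative
            2 * (1 + K) * l * (inverse (1 + (t / l)\<^sup>2) * (1 / l))) (at t)"
          by (intro DERIV_cmult DERIV_chain2[OF DERIV_arctan] DERIV_cdivide DERIV_ident)
        moreover have "inverse (1 + (t / l)\<^sup>2) = l\<^sup>2 / (l\<^sup>2 + t\<^sup>2)"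
          using l den[of t] by (simp add: power_divide field_simps)
        then have "2 * (1 + K) * l * (inverse (1 + (t / l)\<^sup>2) * (1 / l)) = g t"
          using l by (simp add: g_def)
        ultimately have "((\<lambda>t. 2 * (1 + K) * l * arctan (t / l)) has_real_derivative g t) (at t)" by simp
        then show "((\<lambda>t. 2 * (1 + K) * l * arctan (t / l)) has_vector_derivative g t) (at t within {-T..T})"
          by (simp add: has_real_derivative_iff_has_vector_derivative[symmetric] has_field_derivative_at_within)
      qed (use that g_cont continuous_on_subset in auto)
      also have "\<dots> = 2 * (1 + K) * l * (2 * arctan (T / l))" by (simp add: arctan_minus algebra_simps)
      also have "\<dots> \<le> 2 * (1 + K) * l * pi"
        using arctan_ubound[of "T / l"] K l by (intro mult_left_mono) auto
      finally show ?thesis by (simp add: mult.assoc)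
    qed
    ultimately have "measure \<mu> {a<..b} \<le> (b - a) * (2 * (1 + K) * (l * pi)) / (2 * pi)"
      if "a \<le> b" "measure \<mu> {a} = 0" "measure \<mu> {b} = 0" for a b
      by (intro \<mu>.measure_le_integral_char[OF that])
    moreover have "(b - a) * (2 * (1 + K) * (l * pi)) / (2 * pi) = (b - a) * ((1 + K) * l)" for a b
      by (simp add: divide_simps)
    ultimately have "measure \<mu> {a<..b} \<le> (b - a) * ((1 + K) * l)"
      if "a \<le> b" "measure \<mu> {a} = 0" "measure \<mu> {b} = 0" for a b
      using that by metis
    then have "measure \<mu> {x..x + w} \<le> w * ((1 + K) * l)"
      by (rule \<mu>.measure_interval_le_of_nonatoms[OF w])
    then show "emeasure \<mu> {x..x + w} \<le> ennreal ((1 + K) * l * w)"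
      by (simp add: \<mu>.emeasure_eq_measure ennreal_leI mult_ac)
  qed (use K in simp)
qed

end

section \<open>Upper bounds\<close>

text \<open>A property of a measure, not of a random variable, so that it can be transferred to
  tilted laws.\<close>

definition cont_density :: "real measure \<Rightarrow> (real \<Rightarrow> real) \<Rightarrow> bool" where
  "cont_density \<mu> f \<longleftrightarrow> (\<forall>x>0. 0 \<le> f x) \<and> continuous_on {0<..} f \<and>
     \<mu> = density lborel (\<lambda>x. ennreal (indicator {0<..} x * f x))"

lemma cont_density_emeasure:
  assumes f: "cont_density \<mu> f" and x: "0 < x"
  shows "emeasure \<mu> {x..x + w} = (\<integral>\<^sup>+y. ennreal (f y) * indicator {x..x + w} y \<partial>lborel)"
proof -
  have "continuous_on {0<..} f" using f by (simp add: cont_density_def)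
  then have "(\<lambda>y. indicator {0<..} y *\<^sub>R f y) \<in> borel_measurable borel"
    by (intro borel_measurable_continuous_on_indicator) auto
  then have [measurable]: "(\<lambda>y. indicator {0<..} y * f y) \<in> borel_measurable borel" by simp
  have "\<mu> = density lborel (\<lambda>y. ennreal (indicator {0<..} y * f y))" using f by (simp add: cont_density_def)
  then have "emeasure \<mu> {x..x + w} = (\<integral>\<^sup>+y. ennreal (indicator {0<..} y * f y) * indicator {x..x + w} y \<partial>lborel)"
    by (simp add: emeasure_density)
  also have "\<dots> = (\<integral>\<^sup>+y. ennreal (f y) * indicator {x..x + w} y \<partial>lborel)"
    using x by (intro nn_integral_cong) (auto simp: indicator_def)
  finally show ?thesis .
qed

text \<open>The bound may depend on the width \<open>w\<close> since the half-line in Chernoff's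
  bound moves with it; only the limit \<open>B0\<close> survives.\<close>

lemma cont_density_le:
  assumes f: "cont_density \<mu> f" and x: "0 < x"
    and le: "\<And>w. 0 < w \<Longrightarrow> emeasure \<mu> {x..x + w} \<le> ennreal (B w * w)"
    and B: "(B \<longlongrightarrow> B0) (at_right 0)" "\<And>w. 0 \<le> B w"
  shows "f x \<le> B0"
proof (rule field_le_epsilon)
  fix e :: real assume e: "0 < e"
  show "f x \<le> B0 + e"
  proof (cases "f x \<le> e")
    case True
    have "0 \<le> B0" by (rule tendsto_lowerbound[OF B(1)]) (use B(2) in auto)
    then show ?thesis using True by simp
  next
    case False
    have "isCont f x" using f x unfolding cont_density_def
      by (metis continuous_on_eq_continuous_at greaterThan_iff open_greaterThan)
    then obtain d where d: "0 < d" "\<And>y. dist y x < d \<Longrightarrow> dist (f y) (f x) < e"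
      using e unfolding continuous_at_eps_delta by blast
    have "f x - e \<le> B w" if w: "0 < w" "w < d" for w
    proof -
      have "ennreal ((f x - e) * w) = (\<integral>\<^sup>+y. ennreal (f x - e) * indicator {x..x + w} y \<partial>lborel)"
        using False w by (simp add: nn_integral_cmult ennreal_mult)
      also have "\<dots> \<le> (\<integral>\<^sup>+y. ennreal (f y) * indicator {x..x + w} y \<partial>lborel)"
      proof (rule nn_integral_mono)
        fix y show "ennreal (f x - e) * indicator {x..x + w} y \<le> ennreal (f y) * indicator {x..x + w} y"
          using d(2)[of y] w by (auto simp: indicator_def dist_real_def intro!: ennreal_leI)
      qed
      also have "\<dots> \<le> ennreal (B w * w)" using le[OF w(1)] by (simp add: cont_density_emeasure[OF f x])
      finally have "(f x - e) * w \<le> B w * w"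
        using B(2)[of w] w by (subst (asm) ennreal_le_iff) auto
      then show ?thesis using w by simp
    qed
    then have "eventually (\<lambda>w. f x - e \<le> B w) (at_right 0)"
      using eventually_at_right_real[OF d(1)] by (auto elim: eventually_mono)
    then have "f x - e \<le> B0" by (rule tendsto_lowerbound[OF B(1)]) simp
    then show ?thesis by simp
  qed
qed

lemma cont_density_ge:
  assumes f: "cont_density \<mu> f" and x: "0 < x" and w0: "0 < w0" and B: "0 \<le> B"
    and ge: "\<And>w. 0 < w \<Longrightarrow> w \<le> w0 \<Longrightarrow> ennreal (B * w) \<le> emeasure \<mu> {x..x + w}"
  shows "B \<le> f x"
proof (rule field_le_epsilon)
  fix e :: real assume e: "0 < e"
  have fx: "0 \<le> f x" using f x by (simp add: cont_density_def)
  have "isCont f x" using f x unfolding cont_density_def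
    by (metis continuous_on_eq_continuous_at greaterThan_iff open_greaterThan)
  then obtain d where d: "0 < d" "\<And>y. dist y x < d \<Longrightarrow> dist (f y) (f x) < e"
    using e unfolding continuous_at_eps_delta by blast
  define w where "w = min w0 (d / 2)"
  have w: "0 < w" "w \<le> w0" "w < d" using d(1) w0 by (auto simp: w_def)
  have "ennreal (B * w) \<le> (\<integral>\<^sup>+y. ennreal (f y) * indicator {x..x + w} y \<partial>lborel)"
    using ge[OF w(1,2)] by (simp add: cont_density_emeasure[OF f x])
  also have "\<dots> \<le> (\<integral>\<^sup>+y. ennreal (f x + e) * indicator {x..x + w} y \<partial>lborel)"
  proof (rule nn_integral_mono)
    fix y show "ennreal (f y) * indicator {x..x + w} y \<le> ennreal (f x + e) * indicator {x..x + w} y"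
      using d(2)[of y] w by (auto simp: indicator_def dist_real_def intro!: ennreal_leI)
  qed
  also have "\<dots> = ennreal ((f x + e) * w)" using fx e w by (simp add: nn_integral_cmult ennreal_mult)
  finally have "B * w \<le> (f x + e) * w" using fx e w by (subst (asm) ennreal_le_iff) auto
  then show "B \<le> f x + e" using w by simp
qed

lemma emeasure_translated_interval:
  fixes \<rho> :: "real measure"
  assumes [measurable_cong, simp]: "sets \<rho> = sets borel"
  shows "emeasure \<rho> {x - z..x - z + w} = (\<integral>\<^sup>+y. indicator {x..x + w} (y + z) \<partial>\<rho>)"
proof -
  have "emeasure \<rho> {x - z..x - z + w} = (\<integral>\<^sup>+y. indicator {x - z..x - z + w} y \<partial>\<rho>)" by simp
  also have "\<dots> = (\<integral>\<^sup>+y. indicator {x..x + w} (y + z) \<partial>\<rho>)"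
    by (intro nn_integral_cong) (auto simp: indicator_def)
  finally show ?thesis .
qed

text \<open>The summand that lies in \<open>A\<close> is kept, the other one only has to hit a
  translate of the interval; the factor 2 accounts for the symmetric case.\<close>

lemma emeasure_convolution_self_le:
  assumes rd: "real_distribution \<rho>" and [measurable]: "A \<in> sets borel"
    and A: "\<And>y z. x \<le> y + z \<Longrightarrow> y + z \<le> x + w \<Longrightarrow> y \<in> A \<or> z \<in> A"
  shows "emeasure (\<rho> \<star> \<rho>) {x..x + w} \<le> 2 * (\<integral>\<^sup>+z. indicator A z * emeasure \<rho> {x - z..x - z + w} \<partial>\<rho>)"
proof -
  interpret real_distribution \<rho> by fact
  interpret P: pair_sigma_finite \<rho> \<rho> ..
  have em: "emeasure \<rho> {x - z..x - z + w} = (\<integral>\<^sup>+y. indicator {x..x + w} (y + z) \<partial>\<rho>)" for z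
    by (rule emeasure_translated_interval) simp
  have "emeasure (\<rho> \<star> \<rho>) {x..x + w} = (\<integral>\<^sup>+y. \<integral>\<^sup>+z. indicator {x..x + w} (y + z) \<partial>\<rho> \<partial>\<rho>)"
    by (rule convolution_emeasure') (auto simp: finite_measure_axioms)
  also have "\<dots> \<le> (\<integral>\<^sup>+y. \<integral>\<^sup>+z. indicator A y * indicator {x..x + w} (y + z) + indicator A z * indicator {x..x + w} (y + z) \<partial>\<rho> \<partial>\<rho>)"
    by (intro nn_integral_mono) (use A in \<open>fastforce simp: indicator_def\<close>)
  also have "\<dots> = (\<integral>\<^sup>+y. \<integral>\<^sup>+z. indicator A y * indicator {x..x + w} (y + z) \<partial>\<rho> \<partial>\<rho>)
      + (\<integral>\<^sup>+y. \<integral>\<^sup>+z. indicator A z * indicator {x..x + w} (y + z) \<partial>\<rho> \<partial>\<rho>)"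
    by (simp add: nn_integral_add)
  also have "(\<integral>\<^sup>+y. \<integral>\<^sup>+z. indicator A z * indicator {x..x + w} (y + z) \<partial>\<rho> \<partial>\<rho>)
      = (\<integral>\<^sup>+z. \<integral>\<^sup>+y. indicator A z * indicator {x..x + w} (y + z) \<partial>\<rho> \<partial>\<rho>)"
    by (rule P.Fubini') measurable
  also have "\<dots> = (\<integral>\<^sup>+z. indicator A z * emeasure \<rho> {x - z..x - z + w} \<partial>\<rho>)"
    by (simp add: nn_integral_cmult em)
  also have "(\<integral>\<^sup>+y. \<integral>\<^sup>+z. indicator A y * indicator {x..x + w} (y + z) \<partial>\<rho> \<partial>\<rho>)
      = (\<integral>\<^sup>+z. indicator A z * emeasure \<rho> {x - z..x - z + w} \<partial>\<rho>)"
  proof (rule nn_integral_cong)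
    fix y
    have "(\<integral>\<^sup>+z. indicator A y * indicator {x..x + w} (y + z) \<partial>\<rho>) = indicator A y * (\<integral>\<^sup>+z. indicator {x..x + w} (z + y) \<partial>\<rho>)"
      by (subst nn_integral_cmult[symmetric]) (auto simp: add.commute[of y])
    then show "(\<integral>\<^sup>+z. indicator A y * indicator {x..x + w} (y + z) \<partial>\<rho>) = indicator A y * emeasure \<rho> {x - y..x - y + w}"
      unfolding em .
  qed
  finally show ?thesis by (simp add: mult_2)
qed

text \<open>In the power series, \<open>(L * r)^k \<le> r^2 * L^k\<close> for every \<open>k\<close>
  from 2 on. The proof differentiates in \<open>L\<close> and uses that the chord of the exponential
  lies above it.\<close>

lemma exp_minus_affine_le:
  fixes L r :: real
  assumes L: "0 \<le> L" and r: "0 \<le> r" "r \<le> 1"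
  shows "exp (L * r) - 1 - L * r \<le> r\<^sup>2 * exp L"
proof -
  have chord: "exp (K * r) - 1 \<le> r * (exp K - 1)" if K: "0 \<le> K" for K :: real
  proof -
    have "r * (exp 0 - 1) - (exp (0 * r) - 1) \<le> r * (exp K - 1) - (exp (K * r) - 1)"
    proof (rule DERIV_nonneg_imp_nondecreasing[OF K])
      fix k assume k: "0 \<le> k" "k \<le> K"
      have "((\<lambda>k. r * (exp k - 1) - (exp (k * r) - 1)) has_real_derivative r * (exp k - exp (k * r))) (at k)"
        by (auto intro!: derivative_eq_intros simp: algebra_simps)
      moreover have "0 \<le> r * (exp k - exp (k * r))"
        using k r by (intro mult_nonneg_nonneg) (auto simp: mult_left_le)
      ultimately show "\<exists>y. ((\<lambda>k. r * (exp k - 1) - (exp (k * r) - 1)) has_real_derivative y) (at k) \<and> 0 \<le> y" by blast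
    qed
    then show ?thesis by simp
  qed
  have "r\<^sup>2 * exp 0 - (exp (0 * r) - 1 - 0 * r) \<le> r\<^sup>2 * exp L - (exp (L * r) - 1 - L * r)"
  proof (rule DERIV_nonneg_imp_nondecreasing[OF L])
    fix k assume k: "0 \<le> k" "k \<le> L"
    have "((\<lambda>k. r\<^sup>2 * exp k - (exp (k * r) - 1 - k * r)) has_real_derivative r * (r * exp k - exp (k * r) + 1)) (at k)"
      by (auto intro!: derivative_eq_intros simp: algebra_simps power2_eq_square)
    moreover have "0 \<le> r * (r * exp k - exp (k * r) + 1)"
      using chord[OF k(1)] r by (intro mult_nonneg_nonneg) (auto simp: algebra_simps)
    ultimately show "\<exists>y. ((\<lambda>k. r\<^sup>2 * exp k - (exp (k * r) - 1 - k * r)) has_real_derivative y) (at k) \<and> 0 \<le> y" by blast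
  qed
  moreover have "r\<^sup>2 * exp 0 - (exp (0 * r) - 1 - 0 * r) = r\<^sup>2" by simp
  ultimately show ?thesis using zero_le_power2[of r] by linarith
qed

lemma (in levy_nu) laplace_exponent_jumps:
  assumes t: "0 < t"
  shows "(LINT s|jumps \<nu> t. 1 - exp (- u * s)) = t * \<phi> u"
  unfolding \<phi>_def by (rule integral_jumps[OF t]) simp

text \<open>\<open>T\<close> is the earliest time considered, and the times from \<open>T\<close> on
  belong to parameters \<open>l \<le> \<Lambda>\<close> once
  \<open>H \<Lambda> = 1 / T\<close>.\<close>

locale levy_nu_laws = levy_nu_scaling +
  fixes \<mu> :: "real \<Rightarrow> real measure" and T \<Lambda> :: real
  assumes law: "\<And>t. 0 < t \<Longrightarrow> laplace_law (jumps \<nu> t) (\<mu> t)"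
    and T: "0 < T" "8 \<le> c0 * T" and \<Lambda>: "0 < \<Lambda>" "H \<Lambda> \<le> 1 / T"
begin

lemma rd: "0 < t \<Longrightarrow> real_distribution (\<mu> t)"
  using law by (simp add: laplace_law_def)

lemma \<mu>_double:
  assumes t: "0 < t"
  shows "\<mu> (2 * t) = (\<mu> t \<star> \<mu> t)"
proof -
  interpret N: levy_measure "jumps \<nu> (2 * t)" by (rule levy_measure_jumps) (use t in simp)
  have "laplace_law (jumps \<nu> (2 * t)) (\<mu> t \<star> \<mu> t)"
    by (rule laplace_law_convolution[OF law[OF t] law[OF t]])
       (use t laplace_exponent_jumps[of t] laplace_exponent_jumps[of "2 * t"] in simp)
  then show ?thesis using t by (intro N.laplace_law_unique law) auto
qed

lemma \<mu>_half:
  assumes l: "0 < l"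
  shows "\<mu> (1 / H l) = (\<mu> (1 / (2 * H l)) \<star> \<mu> (1 / (2 * H l)))"
  using \<mu>_double[of "1 / (2 * H l)"] H_pos[OF l] by simp

lemma density_sup_bound:
  obtains C where "0 < C"
    "\<And>l x w. 0 < l \<Longrightarrow> l \<le> \<Lambda> \<Longrightarrow> 0 \<le> w \<Longrightarrow> emeasure (\<mu> (1 / (2 * H l))) {x..x + w} \<le> ennreal (C * l * w)"
    "\<And>l f x. 0 < l \<Longrightarrow> l \<le> \<Lambda> \<Longrightarrow> cont_density (\<mu> (1 / H l)) f \<Longrightarrow> 0 < x \<Longrightarrow> f x \<le> 2 * C * l"
    "\<And>l f \<sigma>. 0 < l \<Longrightarrow> l \<le> \<Lambda> \<Longrightarrow> cont_density (\<mu> (1 / H l)) f \<Longrightarrow> 0 < \<sigma> \<Longrightarrow>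
       f (1 / H l * \<phi>' \<sigma>) \<le> 2 * C * l * exp (- (1 / H l / 2) * H \<sigma>)"
proof -
  obtain C where C: "0 < C" "\<And>l \<mu> x w. 0 < l \<Longrightarrow> l \<le> \<Lambda> \<Longrightarrow> laplace_law (jumps \<nu> (1 / (2 * H l))) \<mu> \<Longrightarrow>
    0 \<le> w \<Longrightarrow> emeasure \<mu> {x..x + w} \<le> ennreal (C * l * w)"
    using laplace_law_sup_bound[OF T \<Lambda>] by blast
  have half: "emeasure (\<mu> (1 / (2 * H l))) {x..x + w} \<le> ennreal (C * l * w)"
    if "0 < l" "l \<le> \<Lambda>" "0 \<le> w" for l x w
    using that H_pos[of l] by (intro C law) auto
  have A_bound: "emeasure (\<mu> (1 / H l)) {x..x + w} \<le> 2 * (ennreal (C * l * w) * emeasure (\<mu> (1 / (2 * H l))) A)"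
    if l: "0 < l" "l \<le> \<Lambda>" and w: "0 \<le> w" and [measurable]: "A \<in> sets borel"
      and A: "\<And>y z. x \<le> y + z \<Longrightarrow> y + z \<le> x + w \<Longrightarrow> y \<in> A \<or> z \<in> A" for l x w A
  proof -
    let ?\<rho> = "\<mu> (1 / (2 * H l))"
    have \<rho>: "real_distribution ?\<rho>" using H_pos[OF l(1)] by (intro rd) simp
    interpret \<rho>: real_distribution ?\<rho> by fact
    have "emeasure (\<mu> (1 / H l)) {x..x + w} \<le> 2 * (\<integral>\<^sup>+z. indicator A z * emeasure ?\<rho> {x - z..x - z + w} \<partial>?\<rho>)"
      unfolding \<mu>_half[OF l(1)] by (rule emeasure_convolution_self_le[OF \<rho>]) (use A in auto)
    also have "\<dots> \<le> 2 * (\<integral>\<^sup>+z. ennreal (C * l * w) * indicator A z \<partial>?\<rho>)"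
      using half[OF l w] by (intro mult_left_mono nn_integral_mono) (auto simp: indicator_def)
    also have "\<dots> = 2 * (ennreal (C * l * w) * emeasure ?\<rho> A)" by (simp add: nn_integral_cmult)
    finally show ?thesis .
  qed
  show ?thesis
  proof (rule that[OF C(1) half])
    fix l f x assume l: "0 < l" "l \<le> \<Lambda>" and f: "cont_density (\<mu> (1 / H l)) f" and x: "(0::real) < x"
    show "f x \<le> 2 * C * l"
    proof (rule cont_density_le[OF f x])
      fix w :: real assume w: "0 < w"
      have "real_distribution (\<mu> (1 / (2 * H l)))" using H_pos[OF l(1)] by (intro rd) simp
      then interpret \<rho>: real_distribution "\<mu> (1 / (2 * H l))" .
      have "emeasure (\<mu> (1 / H l)) {x..x + w} \<le> 2 * (ennreal (C * l * w) * emeasure (\<mu> (1 / (2 * H l))) UNIV)"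
        using w by (intro A_bound l) auto
      also have "\<dots> = ennreal (2 * C * l * w)"
        using \<rho>.emeasure_space_1 C l w by (simp add: ennreal_mult' mult.assoc)
      finally show "emeasure (\<mu> (1 / H l)) {x..x + w} \<le> ennreal (2 * C * l * w)" .
    qed (use C l in auto)
  next
    fix l f \<sigma> assume l: "0 < l" "l \<le> \<Lambda>" and f: "cont_density (\<mu> (1 / H l)) f" and \<sigma>: "(0::real) < \<sigma>"
    define t where "t = 1 / H l"
    have t: "0 < t" using H_pos[OF l(1)] by (simp add: t_def)
    define x where "x = t * \<phi>' \<sigma>"
    have x: "0 < x" using t \<phi>'_pos[OF \<sigma>] by (simp add: x_def)
    let ?B = "\<lambda>w. 2 * C * l * exp (\<sigma> * ((x + w) / 2) - t / 2 * \<phi> \<sigma>)"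
    have "f x \<le> 2 * C * l * exp (\<sigma> * ((x + 0) / 2) - t / 2 * \<phi> \<sigma>)"
    proof (rule cont_density_le[OF f x, where B = ?B])
      fix w :: real assume w: "0 < w"
      have h: "t / 2 = 1 / (2 * H l)" by (simp add: t_def)
      have \<rho>: "laplace_law (jumps \<nu> (t / 2)) (\<mu> (t / 2))" using t by (intro law) simp
      then interpret \<rho>: real_distribution "\<mu> (t / 2)" by (simp add: laplace_law_def)
      have "(\<integral>\<^sup>+x. ennreal (exp (- \<sigma> * x)) \<partial>\<mu> (t / 2)) = ennreal (exp (- (t / 2 * \<phi> \<sigma>)))"
        using \<sigma> t laplace_law_nn[OF \<rho>, of \<sigma>] laplace_exponent_jumps[of "t / 2" \<sigma>] by simp
      then have "emeasure (\<mu> (t / 2)) {..(x + w) / 2} \<le> ennreal (exp (- (- \<sigma>) * ((x + w) / 2)) * exp (- (t / 2 * \<phi> \<sigma>)))"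
        using \<sigma> by (intro emeasure_le_exp_moment) auto
      then have e: "emeasure (\<mu> (t / 2)) {..(x + w) / 2} \<le> ennreal (exp (\<sigma> * ((x + w) / 2) - t / 2 * \<phi> \<sigma>))"
        by (simp add: exp_add[symmetric])
      \<comment> \<open>Two summands with total at most \<open>x + w\<close> cannot both exceed
        \<open>(x + w) / 2\<close>. For \<open>x = t * \<phi>' \<sigma>\<close> the Chernoff
        exponent at \<sigma> tends to exactly \<open>- (t / 2) * H \<sigma>\<close> as
        \<open>w\<close> shrinks.\<close>
      have "emeasure (\<mu> (1 / H l)) {x..x + w} \<le> 2 * (ennreal (C * l * w) * emeasure (\<mu> (1 / (2 * H l))) {..(x + w) / 2})"
        using w by (intro A_bound l) auto
      also have "\<dots> \<le> 2 * (ennreal (C * l * w) * ennreal (exp (\<sigma> * ((x + w) / 2) - t / 2 * \<phi> \<sigma>)))"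
        using e unfolding h by (intro mult_left_mono) auto
      also have "\<dots> = ennreal (2 * (C * l * w * exp (\<sigma> * ((x + w) / 2) - t / 2 * \<phi> \<sigma>)))"
        using C l w by (simp add: ennreal_mult')
      also have "2 * (C * l * w * exp (\<sigma> * ((x + w) / 2) - t / 2 * \<phi> \<sigma>)) = ?B w * w" by simp
      finally show "emeasure (\<mu> (1 / H l)) {x..x + w} \<le> ennreal (?B w * w)" .
    next
      show "(?B \<longlongrightarrow> 2 * C * l * exp (\<sigma> * ((x + 0) / 2) - t / 2 * \<phi> \<sigma>)) (at_right 0)"
        by (intro tendsto_intros) auto
    qed (use C l in auto)
    also have "\<sigma> * ((x + 0) / 2) - t / 2 * \<phi> \<sigma> = - (t / 2) * H \<sigma>"
      by (simp add: x_def H_eq[OF \<sigma>] algebra_simps)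
    finally show "f (1 / H l * \<phi>' \<sigma>) \<le> 2 * C * l * exp (- (1 / H l / 2) * H \<sigma>)"
      by (simp add: x_def t_def)
  qed
qed

text \<open>For \<open>t = 1 / H l\<close> this says that \<open>t * \<nu> s\<close> is at least of
  order \<open>l\<close> up to distance \<open>K / l\<close>. The cube of \<open>K\<close> is made
  of a square from \<open>H_scale\<close> and one factor from \<open>r = K / l\<close>.\<close>

lemma \<nu>_lower_near_origin:
  assumes K: "1 \<le> K"
  obtains c where "0 < c" "\<And>l s. 0 < l \<Longrightarrow> l \<le> \<Lambda> \<Longrightarrow> 0 < s \<Longrightarrow> s \<le> K / l \<Longrightarrow> c * l * H l \<le> \<nu> s"
proof -
  obtain C where C: "0 < C" "\<And>r s. 1 / \<Lambda> \<le> r \<Longrightarrow> 0 < s \<Longrightarrow> s \<le> r \<Longrightarrow> H (1 / r) \<le> C * (r * \<nu> s)"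
    using H_le_\<nu>_below[of "1 / \<Lambda>"] \<Lambda> by auto
  show ?thesis
  proof (rule that[of "1 / (C * K ^ 3)"])
    show "0 < 1 / (C * K ^ 3)" using C K by simp
    fix l s assume l: "0 < l" "l \<le> \<Lambda>" and s: "0 < s" "s \<le> K / l"
    have "1 / \<Lambda> \<le> K / l" using l K by (intro frac_le) auto
    then have "H (1 / (K / l)) \<le> C * (K / l * \<nu> s)" using s by (intro C) auto
    moreover have "H (K * (l / K)) \<le> K\<^sup>2 * H (l / K)" using K l by (intro H_scale) auto
    then have "H l \<le> K\<^sup>2 * H (l / K)" using K by simp
    moreover have "K\<^sup>2 * H (l / K) \<le> K\<^sup>2 * (C * (K / l * \<nu> s))"
      using calculation(1) K by (intro mult_left_mono) auto
    ultimately have "H l \<le> K\<^sup>2 * (C * (K / l * \<nu> s))" by linarith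
    then show "1 / (C * K ^ 3) * l * H l \<le> \<nu> s"
      using C K l by (simp add: field_simps power2_eq_square power3_eq_cube)
  qed
qed

end

section \<open>Moments of the jumps below a given size\<close>

context levy_nu
begin

lemma integrable_atMost_id:
  assumes a: "0 < a"
  shows "integrable L (\<lambda>s. indicator {..a} s * s)"
proof (rule integrable_L_bound)
  fix s :: real assume s: "0 < s"
  show "\<bar>indicator {..a} s * s\<bar> \<le> (1 + a) * min 1 s"
  proof (cases "s \<le> 1")
    case True
    then have "min 1 s = s" by simp
    moreover have "1 * s \<le> (1 + a) * s" using a s by (intro mult_right_mono) auto
    ultimately show ?thesis using s a by (auto simp: indicator_def)
  qed (use s a in \<open>auto simp: indicator_def\<close>)
qed measurable

text \<open>Since \<open>\<phi>' l\<close> is the mean of the jumps damped by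
  \<open>exp (- l * s)\<close>, the excess involves only \<open>s * (1 - exp (- l * s))\<close>
  below \<open>a\<close>. At time \<open>1 / H l\<close>, centring at \<open>t * \<phi>' l\<close>
  instead of the truncated mean thus costs at most \<open>6 * a\<close>.\<close>

lemma truncated_mean_le:
  assumes l: "0 < l" and a: "1 / l \<le> a"
  shows "(LINT s|L. indicator {..a} s * s) - \<phi>' l \<le> 6 * a * H l"
proof -
  have a0: "0 < a" using l a by (meson less_le_trans zero_less_divide_1_iff)
  have le: "indicator {..a} s * (s * (1 - exp (- l * s))) \<le> a * min 1 ((l * s)\<^sup>2)" if s: "0 < s" for s
  proof (cases "s \<le> a")
    case True
    have e1: "1 - exp (- l * s) \<le> 1" by simp
    have e2: "1 - exp (- l * s) \<le> l * s" using exp_ge_add_one_self[of "- l * s"] by simp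
    have e0: "0 \<le> 1 - exp (- l * s)" using l s by simp
    have "s * (1 - exp (- l * s)) \<le> a * 1" using True e0 e1 s a0 by (intro mult_mono) auto
    moreover have "s * (1 - exp (- l * s)) \<le> a * (l * s)\<^sup>2"
    proof -
      have "s * (1 - exp (- l * s)) \<le> s * (l * s)" using e2 s by (intro mult_left_mono) auto
      also have "\<dots> = 1 / l * (l * s)\<^sup>2" using l by (simp add: power2_eq_square)
      also have "\<dots> \<le> a * (l * s)\<^sup>2" using a by (intro mult_right_mono) auto
      finally show ?thesis .
    qed
    ultimately show ?thesis using True by (simp add: min_def)
  qed (use a0 in simp)
  have "(LINT s|L. indicator {..a} s * s) - \<phi>' l = (LINT s|L. indicator {..a} s * s - s * exp (- l * s))"
    unfolding \<phi>'_def using integrable_atMost_id[OF a0] L.integrable_mult_exp[OF l]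
    by (intro Bochner_Integration.integral_diff[symmetric])
  also have "\<dots> \<le> (LINT s|L. indicator {..a} s * (s * (1 - exp (- l * s))))"
  proof (rule integral_L_mono)
    show "integrable L (\<lambda>s. indicator {..a} s * s - s * exp (- l * s))"
      using integrable_atMost_id[OF a0] L.integrable_mult_exp[OF l] by (rule Bochner_Integration.integrable_diff)
    show "integrable L (\<lambda>s. indicator {..a} s * (s * (1 - exp (- l * s))))"
      using integral_le_H(1)[OF _ _ _ le] l a0 by auto
    fix s :: real assume "0 < s"
    then show "indicator {..a} s * s - s * exp (- l * s) \<le> indicator {..a} s * (s * (1 - exp (- l * s)))"
      by (auto simp: indicator_def algebra_simps)
  qed
  also have "\<dots> \<le> 6 * a * H l"
    using integral_le_H(2)[OF _ _ _ le] l a0 by auto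
  finally show ?thesis .
qed

text \<open>The linear term is kept exact; only the quadratic remainder pays the factor
  \<open>exp K\<close>, so \<open>K\<close> may grow as long as \<open>exp K * H (1 / a)\<close>
  stays under control.\<close>

lemma truncated_exp_moment_le:
  assumes a: "0 < a" and L: "0 \<le> K"
  shows "(LINT s|L. indicator {..a} s * (exp (K / a * s) - 1))
    \<le> K / a * (LINT s|L. indicator {..a} s * s) + exp K * (6 * H (1 / a))"
proof -
  have int: "integrable L (\<lambda>s. K / a * (indicator {..a} s * s) + exp K / a\<^sup>2 * (indicator {..a} s * s\<^sup>2))"
    using integrable_atMost_id[OF a] integral_square_atMost_le(1)[OF a] by simp
  have "(LINT s|L. indicator {..a} s * (exp (K / a * s) - 1))
    \<le> (LINT s|L. K / a * (indicator {..a} s * s) + exp K / a\<^sup>2 * (indicator {..a} s * s\<^sup>2))"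
  proof (rule integral_mono_AE'[OF int AE_L_I AE_L_I])
    fix s :: real assume s: "0 < s"
    show "0 \<le> K / a * (indicator {..a} s * s) + exp K / a\<^sup>2 * (indicator {..a} s * s\<^sup>2)"
      using s a L by simp
    show "indicator {..a} s * (exp (K / a * s) - 1) \<le> K / a * (indicator {..a} s * s) + exp K / a\<^sup>2 * (indicator {..a} s * s\<^sup>2)"
    proof (cases "s \<le> a")
      case True
      have "exp (K * (s / a)) - 1 - K * (s / a) \<le> (s / a)\<^sup>2 * exp K"
        using True s a L by (intro exp_minus_affine_le) auto
      then show ?thesis using True by (simp add: power_divide mult_ac)
    qed simp
  qed
  also have "\<dots> = K / a * (LINT s|L. indicator {..a} s * s) + exp K / a\<^sup>2 * (LINT s|L. indicator {..a} s * s\<^sup>2)"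
    using integrable_atMost_id[OF a] integral_square_atMost_le(1)[OF a] by simp
  also have "exp K / a\<^sup>2 * (LINT s|L. indicator {..a} s * s\<^sup>2) \<le> exp K / a\<^sup>2 * (6 * a\<^sup>2 * H (1 / a))"
    using integral_square_atMost_le(2)[OF a] by (intro mult_left_mono) auto
  also have "\<dots> = exp K * (6 * H (1 / a))" using a by simp
  finally show ?thesis by simp
qed

end

context levy_nu_laws
begin

text \<open>One of two copies is at least \<open>x / 2\<close>, and the other one smooths the
  interval: the resulting \<open>g\<close> is bounded by \<open>G * w\<close> and has Lebesgue
  integral at most \<open>w\<close>. Hence both terms of the one-big-jump bound are linear in
  \<open>w\<close>.\<close>

lemma emeasure_tail_bound:
  assumes t: "0 < t" and G: "\<And>x w. 0 \<le> w \<Longrightarrow> emeasure (\<mu> t) {x..x + w} \<le> ennreal (G * w)" "0 \<le> G"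
    and a: "0 < a" and B: "\<And>s. a < s \<Longrightarrow> t * \<nu> s \<le> B" "0 \<le> B" and \<theta>: "0 \<le> \<theta>" and w: "0 \<le> w"
  shows "emeasure (\<mu> (2 * t)) {x..x + w} \<le>
    ennreal (2 * (G * exp (- \<theta> * (x / 2) + t * (LINT s|L. indicator {..a} s * (exp (\<theta> * s) - 1))) + B) * w)"
proof -
  interpret N: levy_measure "jumps \<nu> t" by (rule levy_measure_jumps[OF t])
  interpret \<rho>: real_distribution "\<mu> t" by (rule rd[OF t])
  interpret P: pair_sigma_finite lborel "\<mu> t" ..
  define E where "E = - \<theta> * (x / 2) + t * (LINT s|L. indicator {..a} s * (exp (\<theta> * s) - 1))"
  define g where "g z = indicator {x / 2..} z * (\<integral>\<^sup>+y. indicator {x..x + w} (y + z) \<partial>\<mu> t)" for z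
  have [measurable]: "g \<in> borel_measurable borel" unfolding g_def by measurable
  have "(\<integral>\<^sup>+z. g z \<partial>lborel) \<le> (\<integral>\<^sup>+z. \<integral>\<^sup>+y. indicator {x..x + w} (y + z) \<partial>\<mu> t \<partial>lborel)"
    unfolding g_def by (intro nn_integral_mono) (auto simp: indicator_def)
  also have "\<dots> = (\<integral>\<^sup>+y. \<integral>\<^sup>+z. indicator {x..x + w} (y + z) \<partial>lborel \<partial>\<mu> t)"
    by (rule P.Fubini'[symmetric]) measurable
  also have "\<dots> = (\<integral>\<^sup>+y. ennreal w \<partial>\<mu> t)"
  proof (rule nn_integral_cong)
    fix y
    have "(\<integral>\<^sup>+z. indicator {x..x + w} (y + z) \<partial>lborel) = (\<integral>\<^sup>+z. indicator {x..x + w} z \<partial>lborel)"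
      using nn_integral_lborel_translate[of "indicator {x..x + w}" y] by (simp add: add.commute)
    then show "(\<integral>\<^sup>+z. indicator {x..x + w} (y + z) \<partial>lborel) = ennreal w" using w by simp
  qed
  also have "\<dots> = ennreal w" using \<rho>.emeasure_space_1 by simp
  finally have g_int: "(\<integral>\<^sup>+z. g z \<partial>lborel) \<le> ennreal w" .
  have "(\<integral>\<^sup>+z. g z \<partial>\<mu> t) \<le> ennreal (G * w * exp (- \<theta> * (x / 2) + (LINT s|jumps \<nu> t. indicator {..a} s * (exp (\<theta> * s) - 1))))
      + ennreal B * (\<integral>\<^sup>+z. g z \<partial>lborel)"
  proof (rule N.one_big_jump_upper_bound[OF law[OF t] jumps_def])
    show "t * jump_density \<nu> s \<le> B" if "a < s" for s using B(1)[OF that] a that by simp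
    show "g z \<le> ennreal (G * w)" for z
      using G(1)[OF w, of "x - z"] emeasure_translated_interval[of "\<mu> t" x z w]
      by (auto simp: g_def indicator_def)
    show "g z = 0" if "z < x / 2" for z using that by (simp add: g_def)
  qed (use a B(2) \<theta> G(2) w in auto)
  moreover have "(LINT s|jumps \<nu> t. indicator {..a} s * (exp (\<theta> * s) - 1)) = t * (LINT s|L. indicator {..a} s * (exp (\<theta> * s) - 1))"
    by (rule integral_jumps[OF t]) simp
  ultimately have "(\<integral>\<^sup>+z. g z \<partial>\<mu> t) \<le> ennreal (G * w * exp E) + ennreal B * (\<integral>\<^sup>+z. g z \<partial>lborel)"
    unfolding E_def by simp
  also have "\<dots> \<le> ennreal (G * w * exp E) + ennreal B * ennreal w"
    using g_int by (intro add_left_mono mult_left_mono) auto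
  also have "\<dots> = ennreal ((G * exp E + B) * w)"
    using G B w by (simp add: ennreal_mult'[symmetric] ennreal_plus[symmetric] algebra_simps del: ennreal_plus)
  finally have main: "(\<integral>\<^sup>+z. g z \<partial>\<mu> t) \<le> ennreal ((G * exp E + B) * w)" .
  have "emeasure (\<mu> (2 * t)) {x..x + w} \<le> 2 * (\<integral>\<^sup>+z. indicator {x / 2..} z * emeasure (\<mu> t) {x - z..x - z + w} \<partial>\<mu> t)"
    unfolding \<mu>_double[OF t] by (rule emeasure_convolution_self_le[OF \<rho>.real_distribution_axioms[folded real_distribution_def]]) auto
  also have "\<dots> = 2 * (\<integral>\<^sup>+z. g z \<partial>\<mu> t)"
    unfolding g_def by (subst emeasure_translated_interval) auto
  also have "\<dots> \<le> 2 * ennreal ((G * exp E + B) * w)" using main by (intro mult_left_mono) auto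
  also have "\<dots> = ennreal (2 * (G * exp E + B) * w)"
    using G B w by (simp add: ennreal_mult' distrib_left distrib_right mult.assoc)
  finally show ?thesis by (simp add: E_def)
qed

text \<open>With \<open>q = t * H (1 / y)\<close>, which is of the order of the probability of a jump of size \<open>y\<close>, the Chernoff parameter
  is \<open>ln (1 / q) / (\<rho> * y)\<close>. It bounds the contribution of the jumps below \<open>\<rho> * y\<close> by a multiple of
  \<open>q powr (1 / (2 * \<rho>) - 3)\<close>, and \<open>\<rho>\<close> is chosen to make this exponent \<open>1 + 1 / \<alpha>3\<close>.\<close>

theorem density_tail_bound:
  obtains C where "0 < C" "\<And>l f y. 0 < l \<Longrightarrow> l \<le> \<Lambda> \<Longrightarrow> cont_density (\<mu> (1 / H l)) f \<Longrightarrow> 0 < y \<Longrightarrow>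
    f (1 / H l * \<phi>' l + y) \<le> C * (1 / H l * \<nu> y)"
proof -
  obtain C1 where C1: "0 < C1"
    "\<And>l x w. 0 < l \<Longrightarrow> l \<le> \<Lambda> \<Longrightarrow> 0 \<le> w \<Longrightarrow> emeasure (\<mu> (1 / (2 * H l))) {x..x + w} \<le> ennreal (C1 * l * w)"
    "\<And>l f x. 0 < l \<Longrightarrow> l \<le> \<Lambda> \<Longrightarrow> cont_density (\<mu> (1 / H l)) f \<Longrightarrow> 0 < x \<Longrightarrow> f x \<le> 2 * C1 * l"
    using density_sup_bound by metis
  define \<rho> where "\<rho> = \<alpha>3 / (2 * (1 + 4 * \<alpha>3))"
  have \<rho>: "0 < \<rho>" "\<rho> \<le> 1 / 8" using \<alpha>34 by (auto simp: \<rho>_def field_simps)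
  have \<rho>_inv: "1 / (2 * \<rho>) = 4 + 1 / \<alpha>3" using \<alpha>34 by (simp add: \<rho>_def field_simps)
  \<comment> \<open>For \<open>y\<close> beyond \<open>K / l\<close> the truncation level
    \<open>\<rho> * y\<close> is at least \<open>1 / l\<close>, as the comparison of means requires,
    and at least \<open>R2\<close>, where \<nu> obeys the power bounds. For smaller \<open>y\<close>
    the bound of order \<open>l\<close> already suffices.\<close>
  define K where "K = max (1 / \<rho>) (R2 * \<Lambda> / \<rho>)"
  have K: "1 \<le> K" "1 / \<rho> \<le> K" "R2 * \<Lambda> / \<rho> \<le> K" using \<rho> by (auto simp: K_def le_max_iff_disj)
  obtain c where c: "0 < c" "\<And>l s. 0 < l \<Longrightarrow> l \<le> \<Lambda> \<Longrightarrow> 0 < s \<Longrightarrow> s \<le> K / l \<Longrightarrow> c * l * H l \<le> \<nu> s"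
    using \<nu>_lower_near_origin[OF K(1)] by blast
  have "1 \<le> 1 / \<rho>" using \<rho> by simp
  then obtain c\<nu> where c\<nu>: "0 < c\<nu>" "\<And>s y. R2 \<le> y \<Longrightarrow> 0 < s \<Longrightarrow> s \<le> 1 / \<rho> * y \<Longrightarrow> c\<nu> * \<nu> y \<le> \<nu> s"
    using \<nu>_ge_of_le_mult[of "1 / \<rho>"] by blast
  obtain CH where CH: "0 < CH" "\<And>r. R2 \<le> r \<Longrightarrow> H (1 / r) \<le> CH * (r * \<nu> r)" using H_le_\<nu> by blast
  obtain c3 where c3: "0 < c3" "\<And>k l. 1 \<le> k \<Longrightarrow> 0 < l \<Longrightarrow> k * l \<le> \<Lambda> \<Longrightarrow> c3 * k powr \<alpha>3 * H l \<le> H (k * l)"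
    using H_ge_power[OF \<Lambda>(1)] by blast
  define D where "D = (1 / c3) powr (1 / \<alpha>3)"
  have D: "0 < D" using c3 by (simp add: D_def)
  define C where "C = 2 * C1 / c + 2 * (C1 * exp (3 / \<rho>\<^sup>2) * D * CH + 1 / (2 * c\<nu>))"
  have C_parts: "0 \<le> 2 * C1 / c" "0 \<le> 2 * (C1 * exp (3 / \<rho>\<^sup>2) * D * CH + 1 / (2 * c\<nu>))" "0 < 2 * C1 / c"
    using C1 c D CH c\<nu> by auto
  show ?thesis
  proof (rule that[of C])
    show "0 < C" unfolding C_def using C_parts by linarith
    fix l f y assume l: "0 < l" "l \<le> \<Lambda>" and f: "cont_density (\<mu> (1 / H l)) f" and y: "(0::real) < y"
    have Hl: "0 < H l" by (rule H_pos[OF l(1)])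
    define t where "t = 1 / H l"
    have t: "0 < t" "t * H l = 1" using Hl by (auto simp: t_def)
    define x where "x = t * \<phi>' l + y"
    have x: "0 < x" using t \<phi>'_pos[OF l(1)] y by (simp add: x_def add_pos_pos)
    have ny: "0 < \<nu> y" by (rule \<nu>_pos[OF y])
    have "f x \<le> C * (t * \<nu> y)"
    proof (cases "y \<le> K / l")
      case True
      have "f x \<le> 2 * C1 * l" by (rule C1(3)[OF l f x])
      also have "\<dots> = 2 * C1 / c * (t * (c * l * H l))" using c t(2) by simp
      also have "\<dots> \<le> 2 * C1 / c * (t * \<nu> y)"
        using c(2)[OF l y True] t C_parts by (intro mult_left_mono) auto
      also have "\<dots> \<le> C * (t * \<nu> y)"
        unfolding C_def using C_parts t ny by (intro mult_right_mono) auto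
      finally show ?thesis .
    next
      case False
      then have Ky: "K < l * y" using l by (simp add: field_simps)
      define a where "a = \<rho> * y"
      have a: "0 < a" using \<rho> y by (simp add: a_def)
      have "\<rho> * (1 / \<rho>) \<le> \<rho> * (l * y)" using K Ky \<rho> by (intro mult_left_mono) auto
      then have la: "1 \<le> l * a" using \<rho> by (simp add: a_def mult_ac)
      have al: "1 / l \<le> a" using la l by (simp add: field_simps)
      have "\<rho> * (R2 * \<Lambda> / \<rho>) \<le> \<rho> * (l * y)" using K Ky \<rho> by (intro mult_left_mono) auto
      then have "R2 * \<Lambda> \<le> l * a" using \<rho> by (simp add: a_def mult_ac)
      also have "\<dots> \<le> \<Lambda> * a" using l a by (intro mult_right_mono) auto
      finally have aR: "R2 \<le> a" using \<Lambda> by (simp add: mult.commute)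
      have "\<rho> * y \<le> 1 * y" using \<rho> y by (intro mult_right_mono) auto
      then have ay: "a \<le> y" by (simp add: a_def)
      have yR: "R2 \<le> y" using aR ay by linarith
      define q where "q = t * H (1 / y)"
      have Hy: "0 < H (1 / y)" using y by (intro H_pos) simp
      have q: "0 < q" using t Hy by (simp add: q_def)
      have "l * a \<le> l * y" using ay l by (intro mult_left_mono) auto
      then have "1 \<le> l * y" using la by linarith
      then have "1 / y \<le> l" using y by (simp add: pos_divide_le_eq)
      then have "H (1 / y) \<le> H l" using y by (intro H_mono) auto
      then have q1: "q \<le> 1" using t Hl by (simp add: q_def t_def)
      define k where "k = - ln q"
      have k: "0 \<le> k" "exp k = 1 / q" using q q1 by (auto simp: k_def exp_minus field_simps)
      define \<theta> where "\<theta> = k / a"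
      have \<theta>: "0 \<le> \<theta>" using k a by (simp add: \<theta>_def)
      define E where "E = - \<theta> * (x / 2) + t / 2 * (LINT s|L. indicator {..a} s * (exp (\<theta> * s) - 1))"
      \<comment> \<open>The distance \<open>y\<close> contributes \<open>- k / (2 * \<rho>)\<close>
        and the shift of the mean by \<open>6 * a\<close> contributes \<open>3 * k\<close>. The
        quadratic term stays bounded because \<open>exp k = 1 / q\<close> cancels
        \<open>t * H (1 / y)\<close>.\<close>
      have E_le: "E \<le> - k * (1 + 1 / \<alpha>3) + 3 / \<rho>\<^sup>2"
      proof -
        define m where "m = (LINT s|L. indicator {..a} s * s)"
        have "H (1 / \<rho> * (1 / y)) \<le> (1 / \<rho>)\<^sup>2 * H (1 / y)" using y \<rho> by (intro H_scale) auto
        then have "H (1 / a) \<le> H (1 / y) / \<rho>\<^sup>2" by (simp add: a_def power_divide)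
        then have "t / 2 * (exp k * (6 * H (1 / a))) \<le> t / 2 * (exp k * (6 * (H (1 / y) / \<rho>\<^sup>2)))"
          using t by (intro mult_left_mono) auto
        also have "\<dots> = 3 / \<rho>\<^sup>2" using t Hy \<rho> unfolding k(2) q_def by (simp add: field_simps)
        finally have second: "t / 2 * (exp k * (6 * H (1 / a))) \<le> 3 / \<rho>\<^sup>2" .
        have "E \<le> - \<theta> * (x / 2) + t / 2 * (\<theta> * m + exp k * (6 * H (1 / a)))"
          unfolding E_def m_def \<theta>_def using truncated_exp_moment_le[OF a k(1)] t
          by (intro add_left_mono mult_left_mono) auto
        also have "\<dots> = \<theta> / 2 * (t * (m - \<phi>' l)) - \<theta> / 2 * y + t / 2 * (exp k * (6 * H (1 / a)))"
          by (simp add: x_def field_simps)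
        also have "\<theta> / 2 * (t * (m - \<phi>' l)) \<le> \<theta> / 2 * (t * (6 * a * H l))"
          unfolding m_def using truncated_mean_le[OF l(1) al] t \<theta> by (intro mult_left_mono) auto
        also have "t * (6 * a * H l) = 6 * a" using t(2) by (simp add: mult_ac)
        finally have "E \<le> \<theta> / 2 * (6 * a) - \<theta> / 2 * y + 3 / \<rho>\<^sup>2" using second by linarith
        also have "\<theta> / 2 * (6 * a) - \<theta> / 2 * y = - k * (1 / (2 * \<rho>) - 3)"
          using y \<rho> by (simp add: \<theta>_def a_def field_simps)
        finally show ?thesis unfolding \<rho>_inv by simp
      qed
      \<comment> \<open>Turns the surplus power \<open>1 / \<alpha>3\<close> of \<open>q\<close>
        into \<open>1 / (l * y)\<close>. This cancels the \<open>l\<close> of the sup bound and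
        leaves \<open>q / y\<close>, that is \<open>t * H (1 / y) / y\<close>, which is at most a
        multiple of \<open>t * \<nu> y\<close>.\<close>
      have "c3 * (l * y) powr \<alpha>3 * H (1 / y) \<le> H (l * y * (1 / y))"
        using y l Ky K by (intro c3) auto
      then have "c3 * (l * y) powr \<alpha>3 * H (1 / y) \<le> H l" using y by simp
      then have "c3 * (l * y) powr \<alpha>3 * q \<le> 1" using Hl by (simp add: q_def t_def field_simps)
      then have "q \<le> 1 / c3 * (1 / (l * y)) powr \<alpha>3"
        using c3 l y by (simp add: powr_divide field_simps)
      then have "q powr (1 / \<alpha>3) \<le> (1 / c3 * (1 / (l * y)) powr \<alpha>3) powr (1 / \<alpha>3)"
        using q \<alpha>34 by (intro powr_mono2) auto
      also have "\<dots> = D * (1 / (l * y))"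
      proof -
        have "(1 / c3 * (1 / (l * y)) powr \<alpha>3) powr (1 / \<alpha>3)
            = (1 / c3) powr (1 / \<alpha>3) * ((1 / (l * y)) powr \<alpha>3) powr (1 / \<alpha>3)"
          by (rule powr_mult)
        also have "((1 / (l * y)) powr \<alpha>3) powr (1 / \<alpha>3) = 1 / (l * y)"
          using l y \<alpha>34 unfolding powr_powr by simp
        finally show ?thesis by (simp add: D_def)
      qed
      finally have qp: "q powr (1 / \<alpha>3) \<le> D * (1 / (l * y))" .
      have "exp E \<le> exp (- k * (1 + 1 / \<alpha>3) + 3 / \<rho>\<^sup>2)" using E_le by simp
      also have "\<dots> = q powr (1 + 1 / \<alpha>3) * exp (3 / \<rho>\<^sup>2)"
        using q by (simp add: k_def powr_def exp_add mult.commute)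
      also have "q powr (1 + 1 / \<alpha>3) = q * q powr (1 / \<alpha>3)" using q by (simp add: powr_add)
      also have "\<dots> \<le> q * (D * (1 / (l * y)))" using qp q by (intro mult_left_mono) auto
      finally have expE: "exp E \<le> q * (D * (1 / (l * y))) * exp (3 / \<rho>\<^sup>2)" by simp
      have "C1 * l * exp E \<le> C1 * l * (q * (D * (1 / (l * y))) * exp (3 / \<rho>\<^sup>2))"
        using expE C1 l by (intro mult_left_mono) auto
      also have "\<dots> = C1 * exp (3 / \<rho>\<^sup>2) * D * (t * (H (1 / y) / y))"
        using l by (simp add: q_def field_simps)
      also have "\<dots> \<le> C1 * exp (3 / \<rho>\<^sup>2) * D * (t * (CH * \<nu> y))"
        using CH(2)[OF yR] y C1 D t by (intro mult_left_mono) (auto simp: field_simps)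
      finally have first: "C1 * l * exp E \<le> C1 * exp (3 / \<rho>\<^sup>2) * D * CH * (t * \<nu> y)" by (simp add: mult_ac)
      have h: "t / 2 = 1 / (2 * H l)" "2 * (t / 2) = 1 / H l" by (auto simp: t_def)
      define B where "B = t / 2 * (\<nu> y / c\<nu>)"
      have B: "0 \<le> B" using t ny c\<nu> by (simp add: B_def)
      have "f x \<le> 2 * (C1 * l * exp E + B)"
      proof (rule cont_density_le[OF f x, where B = "\<lambda>_. 2 * (C1 * l * exp E + B)"])
        fix w :: real assume w: "0 < w"
        have "emeasure (\<mu> (2 * (t / 2))) {x..x + w} \<le> ennreal (2 * (C1 * l * exp E + B) * w)"
          unfolding E_def
        proof (rule emeasure_tail_bound)
          show "emeasure (\<mu> (t / 2)) {x..x + w} \<le> ennreal (C1 * l * w)" if "0 \<le> w" for x w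
            unfolding h(1) by (rule C1(2)[OF l that])
          fix s assume s: "a < s"
          then have "c\<nu> * \<nu> s \<le> \<nu> y" using aR y \<rho> by (intro c\<nu>) (auto simp: a_def field_simps)
          then have "\<nu> s \<le> \<nu> y / c\<nu>" using c\<nu> by (simp add: field_simps)
          then show "t / 2 * \<nu> s \<le> B" unfolding B_def using t by (intro mult_left_mono) auto
        qed (use t C1 l a B \<theta> w in auto)
        then show "emeasure (\<mu> (1 / H l)) {x..x + w} \<le> ennreal (2 * (C1 * l * exp E + B) * w)"
          unfolding h(2) .
      qed (use C1 l B in auto)
      also have "\<dots> \<le> 2 * (C1 * exp (3 / \<rho>\<^sup>2) * D * CH * (t * \<nu> y) + 1 / (2 * c\<nu>) * (t * \<nu> y))"
        using first by (simp add: B_def)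
      also have "\<dots> = 2 * (C1 * exp (3 / \<rho>\<^sup>2) * D * CH + 1 / (2 * c\<nu>)) * (t * \<nu> y)" by (simp add: algebra_simps)
      also have "\<dots> \<le> C * (t * \<nu> y)"
        unfolding C_def using C_parts t ny by (intro mult_right_mono) auto
      finally show ?thesis .
    qed
    then show "f (1 / H l * \<phi>' l + y) \<le> C * (1 / H l * \<nu> y)" by (simp add: x_def t_def)
  qed
qed

end

section \<open>Lower bounds\<close>

text \<open>The bound holds for all interval lengths up to \<open>w\<close>, as the passage to the
  density requires; \<open>Y\<close> is a common upper end for all jump sizes involved.\<close>

lemma (in levy_measure) one_big_jump_density_bound:
  assumes law: "laplace_law N M"
    and N: "N = density lborel (\<lambda>s. ennreal (n s))" "n \<in> borel_measurable borel"
    and f: "cont_density M f" and x0: "0 < x0"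
    and a: "0 < a" "4 * a \<le> D"
    and m: "integrable N (\<lambda>s. indicator {..a} s * s)"
    and V: "integrable N (\<lambda>s. indicator {..a} s * s\<^sup>2)" "32 * (LINT s|N. indicator {..a} s * s\<^sup>2) \<le> D\<^sup>2"
    and lower: "a \<le> x0 - (LINT s|N. indicator {..a} s * s) - D"
    and upper: "x0 - (LINT s|N. indicator {..a} s * s) + D + w \<le> Y" and w: "0 < w"
    and k: "0 \<le> k" "\<And>s. 0 < s \<Longrightarrow> s \<le> Y \<Longrightarrow> k \<le> n s"
    and B: "measure N {a<..} \<le> B"
  shows "exp (- B) / 2 * k \<le> f x0"
proof (rule cont_density_ge[OF f x0 w])
  fix v :: real assume v: "0 < v" "v \<le> w"
  have "exp (- B) / 2 * k * v \<le> exp (- measure N {a<..}) / 2 * k * v"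
    using B k v by (intro mult_right_mono) auto
  then have "ennreal (exp (- B) / 2 * k * v) \<le> ennreal (exp (- measure N {a<..}) / 2 * k * v)" by (rule ennreal_leI)
  also have "\<dots> \<le> emeasure M {x0..x0 + v}"
    by (rule one_big_jump_lower_bound[OF law N a m V]) (use v k lower upper a in auto)
  finally show "ennreal (exp (- B) / 2 * k * v) \<le> emeasure M {x0..x0 + v}" .
qed (use k in auto)

context levy_nu
begin

text \<open>Above \<open>a\<close> the factors \<open>s / a\<close> and \<open>(s / a)^2\<close> are
  at least 1, which reduces both integrals to the damped second moment.\<close>

lemma integral_greater_le:
  assumes a: "0 < a" and u: "0 < u"
  shows "integrable L (\<lambda>s. indicator {a<..} s * (s * exp (- u * s)))"
    "(LINT s|L. indicator {a<..} s * (s * exp (- u * s))) \<le> 6 * H u / (a * u\<^sup>2)"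
    "integrable L (\<lambda>s. indicator {a<..} s * exp (- u * s))"
    "(LINT s|L. indicator {a<..} s * exp (- u * s)) \<le> 6 * H u / (a\<^sup>2 * u\<^sup>2)"
proof -
  note int = integral_square_exp_le[OF u]
  have le1: "indicator {a<..} s * (s * exp (- u * s)) \<le> 1 / a * (s\<^sup>2 * exp (- u * s))" if "0 < s" for s
  proof (cases "a < s")
    case True
    have "a * (s * exp (- u * s)) \<le> s * (s * exp (- u * s))" using True that by (intro mult_right_mono) auto
    then have "s * exp (- u * s) \<le> 1 / a * (s\<^sup>2 * exp (- u * s))"
      using a by (simp add: power2_eq_square pos_le_divide_eq mult_ac)
    then show ?thesis using True by simp
  qed (use a in simp)
  have le2: "indicator {a<..} s * exp (- u * s) \<le> 1 / a\<^sup>2 * (s\<^sup>2 * exp (- u * s))" if "0 < s" for s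
  proof (cases "a < s")
    case True
    have "a\<^sup>2 * exp (- u * s) \<le> s\<^sup>2 * exp (- u * s)" using True a by (intro mult_right_mono power_mono) auto
    then have "exp (- u * s) \<le> 1 / a\<^sup>2 * (s\<^sup>2 * exp (- u * s))"
      using a by (simp add: pos_le_divide_eq mult_ac)
    then show ?thesis using True by simp
  qed (use a in simp)
  show i1: "integrable L (\<lambda>s. indicator {a<..} s * (s * exp (- u * s)))"
    by (rule L.integrable_mult_bounded[OF L.integrable_mult_exp[OF u], where B = 1]) auto
  show i2: "integrable L (\<lambda>s. indicator {a<..} s * exp (- u * s))"
  proof (rule Bochner_Integration.integrable_bound)
    show "integrable L (\<lambda>s. 1 / a\<^sup>2 * (s\<^sup>2 * exp (- u * s)))" using int by simp
    show "AE s in L. norm (indicator {a<..} s * exp (- u * s)) \<le> norm (1 / a\<^sup>2 * (s\<^sup>2 * exp (- u * s)))"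
      by (rule AE_L_I) (use le2 in \<open>auto simp: abs_mult\<close>)
  qed simp
  have "(LINT s|L. indicator {a<..} s * (s * exp (- u * s))) \<le> (LINT s|L. 1 / a * (s\<^sup>2 * exp (- u * s)))"
    by (rule integral_L_mono[OF i1 _ le1]) (use int in simp)
  also have "\<dots> \<le> 1 / a * (6 * H u / u\<^sup>2)"
    unfolding integral_mult_right_zero using int(2) a by (intro mult_left_mono) auto
  finally show "(LINT s|L. indicator {a<..} s * (s * exp (- u * s))) \<le> 6 * H u / (a * u\<^sup>2)" by simp
  have "(LINT s|L. indicator {a<..} s * exp (- u * s)) \<le> (LINT s|L. 1 / a\<^sup>2 * (s\<^sup>2 * exp (- u * s)))"
    by (rule integral_L_mono[OF i2 _ le2]) (use int in simp)
  also have "\<dots> \<le> 1 / a\<^sup>2 * (6 * H u / u\<^sup>2)"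
    unfolding integral_mult_right_zero using int(2) a by (intro mult_left_mono) auto
  finally show "(LINT s|L. indicator {a<..} s * exp (- u * s)) \<le> 6 * H u / (a\<^sup>2 * u\<^sup>2)" by simp
qed

text \<open>Below \<open>a\<close> damping costs at most \<open>u * s^2\<close> per jump; above
  \<open>a\<close> the derivative contains the damped jumps in addition.\<close>

lemma \<phi>'_minus_truncated_mean:
  assumes a: "0 < a" and u: "0 < u"
  shows "\<phi>' u - (LINT s|L. indicator {..a} s * s) \<le> 6 * H u / (a * u\<^sup>2)"
    and "(LINT s|L. indicator {a<..} s * (s * exp (- u * s))) - u * (LINT s|L. indicator {..a} s * s\<^sup>2)
      \<le> \<phi>' u - (LINT s|L. indicator {..a} s * s)"
proof -
  note ints = integrable_atMost_id[OF a] L.integrable_mult_exp[OF u] integral_greater_le(1)[OF a u]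
    integral_square_atMost_le(1)[OF a]
  have "\<phi>' u \<le> (LINT s|L. indicator {..a} s * s + indicator {a<..} s * (s * exp (- u * s)))"
    unfolding \<phi>'_def using ints u
    by (intro integral_L_mono Bochner_Integration.integrable_add) (auto simp: indicator_def)
  also have "\<dots> = (LINT s|L. indicator {..a} s * s) + (LINT s|L. indicator {a<..} s * (s * exp (- u * s)))"
    using ints by (intro Bochner_Integration.integral_add)
  finally show "\<phi>' u - (LINT s|L. indicator {..a} s * s) \<le> 6 * H u / (a * u\<^sup>2)"
    using integral_greater_le(2)[OF a u] by linarith
  have "(LINT s|L. indicator {a<..} s * (s * exp (- u * s)) + indicator {..a} s * s) \<le> (LINT s|L. s * exp (- u * s) + u * (indicator {..a} s * s\<^sup>2))"
  proof (rule integral_L_mono)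
    fix s :: real assume s: "0 < s"
    have "s * (1 - u * s) \<le> s * exp (- u * s)"
      using exp_ge_add_one_self[of "- u * s"] s by (intro mult_left_mono) auto
    then show "indicator {a<..} s * (s * exp (- u * s)) + indicator {..a} s * s \<le> s * exp (- u * s) + u * (indicator {..a} s * s\<^sup>2)"
      by (auto simp: indicator_def algebra_simps power2_eq_square)
  qed (use ints in \<open>auto intro!: Bochner_Integration.integrable_add\<close>)
  then have "(LINT s|L. indicator {a<..} s * (s * exp (- u * s))) + (LINT s|L. indicator {..a} s * s)
      \<le> \<phi>' u + u * (LINT s|L. indicator {..a} s * s\<^sup>2)"
    unfolding \<phi>'_def using ints by (subst (asm) (1 2) Bochner_Integration.integral_add) auto
  then show "(LINT s|L. indicator {a<..} s * (s * exp (- u * s))) - u * (LINT s|L. indicator {..a} s * s\<^sup>2)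
      \<le> \<phi>' u - (LINT s|L. indicator {..a} s * s)" by linarith
qed

end

context levy_nu_laws
begin

text \<open>The truncation level \<open>\<kappa> / \<sigma>\<close> is so small that the fluctuation of the small jumps is
  negligible against the distance of their mean from \<open>t * \<phi>' \<sigma>\<close>.\<close>

theorem density_lower_bound_central:
  assumes N0: "1 \<le> N0"
  obtains c where "0 < c" "\<And>\<sigma> t f y B. 0 < \<sigma> \<Longrightarrow> \<sigma> \<le> \<Lambda> \<Longrightarrow> 1 \<le> t * H \<sigma> \<Longrightarrow> t * H \<sigma> \<le> N0 \<Longrightarrow>
    cont_density (\<mu> t) f \<Longrightarrow> 0 \<le> y \<Longrightarrow> 0 \<le> B \<Longrightarrow> B \<le> \<sigma> \<Longrightarrow> (0 < y \<Longrightarrow> B \<le> t * \<nu> y) \<Longrightarrow> c * B \<le> f (t * \<phi>' \<sigma> + y)"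
proof -
  obtain c1 where c1: "0 < c1" "\<And>l s. 0 < l \<Longrightarrow> l \<le> \<Lambda> \<Longrightarrow> 0 < s \<Longrightarrow> s \<le> 2 / l \<Longrightarrow> c1 * l * H l \<le> \<nu> s"
    using \<nu>_lower_near_origin[of 2] by auto
  \<comment> \<open>In units of \<open>H \<sigma> / \<sigma>\<close>, a lower bound for what the
    jumps in \<open>[1 / \<sigma>, 2 / \<sigma>]\<close>, damped by at least
    \<open>exp (- 2)\<close>, contribute to \<open>\<phi>' \<sigma>\<close>.\<close>
  define g where "g = c1 * exp (- 2)"
  have g: "0 < g" using c1 by (simp add: g_def)
  define d where "d = g / 4"
  \<comment> \<open>The first term keeps the loss by damping below a quarter of that contribution;
    the second meets the variance condition for \<open>D = d / \<sigma>\<close> as long as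
    \<open>t * H \<sigma> \<le> N0\<close>.\<close>
  define \<eta> where "\<eta> = min (g / 4) (d\<^sup>2 / (32 * N0))"
  have d: "0 < d" using g by (simp add: d_def)
  have \<eta>: "0 < \<eta>" "\<eta> \<le> g / 4" "32 * N0 * \<eta> \<le> d\<^sup>2"
    using g d N0 by (auto simp: \<eta>_def min_def field_simps)
  obtain \<kappa>0 where \<kappa>0: "0 < \<kappa>0"
    "\<And>l. 0 < l \<Longrightarrow> l \<le> \<Lambda> \<Longrightarrow> (LINT s|L. indicator {..\<kappa>0 / l} s * s\<^sup>2) \<le> \<eta> * H l / l\<^sup>2"
    using truncated_variance_small[OF \<eta>(1) \<Lambda>(1)] by blast
  \<comment> \<open>\<open>d / 4\<close> ensures \<open>4 * a \<le> D\<close>, and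
    \<open>1 / 2\<close> leaves the jumps in \<open>[1 / \<sigma>, 2 / \<sigma>]\<close> above the
    truncation level.\<close>
  define \<kappa> where "\<kappa> = min \<kappa>0 (min (d / 4) (1 / 2))"
  have \<kappa>: "0 < \<kappa>" "\<kappa> \<le> \<kappa>0" "\<kappa> \<le> d / 4" "\<kappa> \<le> 1 / 2" using \<kappa>0 d by (auto simp: \<kappa>_def)
  \<comment> \<open>In units of \<open>1 / \<sigma>\<close>: the distance of
    \<open>t * \<phi>' \<sigma>\<close> from the mean of the small jumps, the fluctuation
    \<open>D\<close>, and the window.\<close>
  define M where "M = 6 * N0 / \<kappa> + d + 1"
  have M: "1 \<le> M" using N0 \<kappa> d by (simp add: M_def)
  \<comment> \<open>For \<open>y\<close> beyond \<open>Y / \<sigma>\<close> one has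
    \<open>R2 \<le> y\<close> and \<open>M / \<sigma> \<le> y\<close>, so the required jump is at
    most \<open>2 * y\<close> and is compared with \<open>\<nu> y\<close>; for smaller
    \<open>y\<close> the bound of order \<open>\<sigma>\<close> near the origin is used.\<close>
  define Y where "Y = max M (R2 * \<Lambda>)"
  have Y: "M \<le> Y" "R2 * \<Lambda> \<le> Y" by (auto simp: Y_def)
  obtain c2 where c2: "0 < c2" "\<And>l s. 0 < l \<Longrightarrow> l \<le> \<Lambda> \<Longrightarrow> 0 < s \<Longrightarrow> s \<le> (Y + M) / l \<Longrightarrow> c2 * l * H l \<le> \<nu> s"
    using \<nu>_lower_near_origin[of "Y + M"] M Y by auto
  obtain c4 where c4: "0 < c4" "\<And>s y. R2 \<le> y \<Longrightarrow> 0 < s \<Longrightarrow> s \<le> 2 * y \<Longrightarrow> c4 * \<nu> y \<le> \<nu> s"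
    using \<nu>_ge_of_le_mult[of 2] by auto
  define c where "c = exp (- (6 * N0 / \<kappa>\<^sup>2)) / 2 * min c2 c4"
  show ?thesis
  proof (rule that[of c])
    show "0 < c" using c2 c4 by (simp add: c_def)
    fix \<sigma> t f y B assume \<sigma>: "0 < \<sigma>" "\<sigma> \<le> \<Lambda>" and tH: "1 \<le> t * H \<sigma>" "t * H \<sigma> \<le> N0"
      and f: "cont_density (\<mu> t) f" and y: "0 \<le> y" and B: "0 \<le> B" "B \<le> \<sigma>" "0 < y \<Longrightarrow> B \<le> t * \<nu> y"
    have H\<sigma>: "0 < H \<sigma>" by (rule H_pos[OF \<sigma>(1)])
    have t: "0 < t" using tH H\<sigma> zero_less_mult_pos2[of t "H \<sigma>"] by linarith
    interpret N: levy_measure "jumps \<nu> t" by (rule levy_measure_jumps[OF t])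
    define a where "a = \<kappa> / \<sigma>"
    define D where "D = d / \<sigma>"
    have a: "0 < a" using \<kappa> \<sigma> by (simp add: a_def)
    define m where "m = (LINT s|L. indicator {..a} s * s)"
    define v where "v = (LINT s|L. indicator {..a} s * s\<^sup>2)"
    have mN: "(LINT s|jumps \<nu> t. indicator {..a} s * s) = t * m" unfolding m_def by (rule integral_jumps[OF t]) simp
    have vN: "(LINT s|jumps \<nu> t. indicator {..a} s * s\<^sup>2) = t * v" unfolding v_def by (rule integral_jumps[OF t]) simp
    have "v \<le> (LINT s|L. indicator {..\<kappa>0 / \<sigma>} s * s\<^sup>2)"
      unfolding v_def using a \<kappa> \<sigma> by (intro integral_square_atMost_mono) (auto simp: a_def divide_right_mono)
    also have "\<dots> \<le> \<eta> * H \<sigma> / \<sigma>\<^sup>2" by (rule \<kappa>0(2)[OF \<sigma>])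
    finally have v: "v \<le> \<eta> * H \<sigma> / \<sigma>\<^sup>2" .
    have mass: "g * (H \<sigma> / \<sigma>) \<le> (LINT s|L. indicator {a<..} s * (s * exp (- \<sigma> * s)))"
    proof -
      have "c1 * \<sigma> * H \<sigma> * (1 / \<sigma> * exp (- 2)) * (2 / \<sigma> - 1 / \<sigma>) \<le> (LINT s|L. indicator {a<..} s * (s * exp (- \<sigma> * s)))"
      proof (rule integral_L_ge_interval)
        fix s assume s: "1 / \<sigma> \<le> s" "s \<le> 2 / \<sigma>"
        have s0: "0 < s" using s \<sigma> by (meson less_le_trans zero_less_divide_1_iff)
        show "c1 * \<sigma> * H \<sigma> \<le> \<nu> s" by (rule c1(2)[OF \<sigma> s0 s(2)])
        have "a < 1 / \<sigma>" unfolding a_def using \<kappa> \<sigma> by (intro divide_strict_right_mono) auto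
        then have "a < s" using s by linarith
        moreover have "\<sigma> * s \<le> 2" using s \<sigma> by (simp add: field_simps)
        then have "1 / \<sigma> * exp (- 2) \<le> s * exp (- \<sigma> * s)" using s s0 \<sigma> by (intro mult_mono) auto
        ultimately show "1 / \<sigma> * exp (- 2) \<le> indicator {a<..} s * (s * exp (- \<sigma> * s))" by simp
      qed (use \<sigma> c1 H\<sigma> integral_greater_le(1)[OF a \<sigma>(1)] in \<open>auto simp: divide_right_mono\<close>)
      also have "2 / \<sigma> - 1 / \<sigma> = 1 / \<sigma>" by (simp add: diff_divide_distrib[symmetric])
      finally show ?thesis using \<sigma> by (simp add: g_def mult_ac)
    qed
    have "\<sigma> * v \<le> \<sigma> * (\<eta> * H \<sigma> / \<sigma>\<^sup>2)" using v \<sigma> by (intro mult_left_mono) auto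
    also have "\<dots> = \<eta> * (H \<sigma> / \<sigma>)" using \<sigma> by (simp add: power2_eq_square)
    also have "\<dots> \<le> g / 4 * (H \<sigma> / \<sigma>)" using \<eta> H\<sigma> \<sigma> by (intro mult_right_mono) auto
    finally have \<sigma>v: "\<sigma> * v \<le> g / 4 * (H \<sigma> / \<sigma>)" .
    have "3 / 4 * g * (H \<sigma> / \<sigma>) = g * (H \<sigma> / \<sigma>) - g / 4 * (H \<sigma> / \<sigma>)" by simp
    also have "\<dots> \<le> (LINT s|L. indicator {a<..} s * (s * exp (- \<sigma> * s))) - \<sigma> * v"
      by (rule diff_mono[OF mass \<sigma>v])
    also have "\<dots> \<le> \<phi>' \<sigma> - m"
      unfolding m_def v_def by (rule \<phi>'_minus_truncated_mean(2)[OF a \<sigma>(1)])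
    finally have "3 / 4 * g * (H \<sigma> / \<sigma>) \<le> \<phi>' \<sigma> - m" .
    then have "t * (3 / 4 * g * (H \<sigma> / \<sigma>)) \<le> t * (\<phi>' \<sigma> - m)" using t by (intro mult_left_mono) auto
    moreover have "3 / 4 * g / \<sigma> * 1 \<le> 3 / 4 * g / \<sigma> * (t * H \<sigma>)" using tH g \<sigma> by (intro mult_left_mono) auto
    moreover have "3 / 4 * g / \<sigma> * (t * H \<sigma>) = t * (3 / 4 * g * (H \<sigma> / \<sigma>))" by simp
    \<comment> \<open>Enough room for \<open>a + D\<close>, since \<open>D\<close> is
      \<open>g / (4 * \<sigma>)\<close> and \<open>a\<close> at most a quarter of it.\<close>
    ultimately have gap: "3 / 4 * g / \<sigma> \<le> t * \<phi>' \<sigma> - t * m" unfolding right_diff_distrib by linarith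
    have aD: "4 * a \<le> D" using \<kappa> \<sigma> by (simp add: a_def D_def field_simps)
    have D_eq: "D = g / 4 / \<sigma>" by (simp add: D_def d_def)
    have "t * (\<phi>' \<sigma> - m) \<le> t * (6 * H \<sigma> / (a * \<sigma>\<^sup>2))"
      unfolding m_def using \<phi>'_minus_truncated_mean(1)[OF a \<sigma>(1)] t by (intro mult_left_mono) auto
    also have "\<dots> = 6 / (\<kappa> * \<sigma>) * (t * H \<sigma>)" using \<sigma> by (simp add: a_def power2_eq_square)
    also have "\<dots> \<le> 6 / (\<kappa> * \<sigma>) * N0" using tH \<kappa> \<sigma> by (intro mult_left_mono) auto
    finally have gap2: "t * \<phi>' \<sigma> - t * m + D + 1 / \<sigma> \<le> M / \<sigma>"
      by (simp add: M_def D_def right_diff_distrib add_divide_distrib mult.commute)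
    have "exp (- (6 * N0 / \<kappa>\<^sup>2)) / 2 * (min c2 c4 * B) \<le> f (t * \<phi>' \<sigma> + y)"
    proof (rule N.one_big_jump_density_bound[OF law[OF t] jumps_def _ f _ a aD])
      show "0 < t * \<phi>' \<sigma> + y" using t \<phi>'_pos[OF \<sigma>(1)] y by (simp add: add_pos_nonneg)
      show "integrable (jumps \<nu> t) (\<lambda>s. indicator {..a} s * s)"
        by (rule integrable_jumps[OF t _ integrable_atMost_id[OF a]]) simp
      show "integrable (jumps \<nu> t) (\<lambda>s. indicator {..a} s * s\<^sup>2)"
        by (rule integrable_jumps[OF t _ integral_square_atMost_le(1)[OF a]]) simp
      have "32 * (t * v) \<le> 32 * (t * (\<eta> * H \<sigma> / \<sigma>\<^sup>2))" using v t by (intro mult_left_mono) auto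
      also have "\<dots> = 32 * \<eta> * (t * H \<sigma>) / \<sigma>\<^sup>2" by simp
      also have "\<dots> \<le> 32 * \<eta> * N0 / \<sigma>\<^sup>2" using tH \<eta> by (intro divide_right_mono mult_left_mono) auto
      also have "\<dots> \<le> d\<^sup>2 / \<sigma>\<^sup>2" using \<eta>(3) by (intro divide_right_mono) (auto simp: mult_ac)
      finally show "32 * (LINT s|jumps \<nu> t. indicator {..a} s * s\<^sup>2) \<le> D\<^sup>2" unfolding vN by (simp add: D_def power_divide)
      have "g / 4 / \<sigma> + g / 4 / \<sigma> \<le> 3 / 4 * g / \<sigma>" using g \<sigma> by (simp add: field_simps)
      then show "a \<le> t * \<phi>' \<sigma> + y - (LINT s|jumps \<nu> t. indicator {..a} s * s) - D"
        unfolding mN using gap aD a y D_eq by linarith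
      show "t * \<phi>' \<sigma> + y - (LINT s|jumps \<nu> t. indicator {..a} s * s) + D + 1 / \<sigma> \<le> y + M / \<sigma>"
        unfolding mN using gap2 by linarith
      show "measure (jumps \<nu> t) {a<..} \<le> 6 * N0 / \<kappa>\<^sup>2"
      proof -
        have "measure (jumps \<nu> t) {a<..} \<le> 6 * t * H (1 / a)" by (rule measure_greater_le[OF a t])
        also have "H (1 / a) = H (1 / \<kappa> * \<sigma>)" by (simp add: a_def)
        also have "6 * t * \<dots> \<le> 6 * t * ((1 / \<kappa>)\<^sup>2 * H \<sigma>)"
          using H_scale[of \<sigma> "1 / \<kappa>"] \<sigma> \<kappa> t by (intro mult_left_mono) auto
        also have "\<dots> = 6 / \<kappa>\<^sup>2 * (t * H \<sigma>)" by (simp add: power_divide)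
        also have "\<dots> \<le> 6 / \<kappa>\<^sup>2 * N0" using tH by (intro mult_left_mono) auto
        finally show ?thesis by simp
      qed
      fix s assume s: "0 < s" "s \<le> y + M / \<sigma>"
      show "min c2 c4 * B \<le> t * jump_density \<nu> s"
      proof (cases "y \<le> Y / \<sigma>")
        case True
        then have "s \<le> (Y + M) / \<sigma>" using s by (simp add: add_divide_distrib)
        then have "c2 * \<sigma> * H \<sigma> \<le> \<nu> s" by (rule c2(2)[OF \<sigma> s(1)])
        then have "t * (c2 * \<sigma> * H \<sigma>) \<le> t * \<nu> s" using t by (intro mult_left_mono) auto
        moreover have "c2 * \<sigma> * 1 \<le> c2 * \<sigma> * (t * H \<sigma>)" using tH c2 \<sigma> by (intro mult_left_mono) auto
        moreover have "min c2 c4 * B \<le> c2 * \<sigma>" using B c2 c4 by (intro mult_mono) auto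
        ultimately show ?thesis using s by (simp add: mult_ac)
      next
        case False
        then have yY: "Y < \<sigma> * y" using \<sigma> by (simp add: field_simps)
        have "R2 * \<Lambda> \<le> \<sigma> * y" using yY Y by linarith
        also have "\<dots> \<le> \<Lambda> * y" using \<sigma> y by (intro mult_right_mono) auto
        finally have yR: "R2 \<le> y" using \<Lambda> by (simp add: mult.commute)
        have "M / \<sigma> \<le> y" using yY Y \<sigma> by (simp add: field_simps)
        then have "c4 * \<nu> y \<le> \<nu> s" using s by (intro c4(2)[OF yR]) auto
        then have "t * (c4 * \<nu> y) \<le> t * \<nu> s" using t by (intro mult_left_mono) auto
        moreover have "min c2 c4 * B \<le> c4 * (t * \<nu> y)" using B yR R2 c2 c4 t by (intro mult_mono) auto
        ultimately show ?thesis using s by (simp add: mult_ac)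
      qed
    qed (use \<sigma> B c2 c4 in auto)
    then show "c * B \<le> f (t * \<phi>' \<sigma> + y)" by (simp add: c_def mult_ac)
  qed
qed

end

section \<open>Exponentially tilted jumps\<close>

context levy_nu
begin

lemma jump_density_tilt: "jump_density (\<lambda>s. exp (- \<sigma> * s) * \<nu> s) s = exp (- \<sigma> * s) * jump_density \<nu> s"
  by (simp add: jump_density_def)

lemma levy_nu_tilt:
  assumes \<sigma>: "0 \<le> \<sigma>"
  shows "levy_nu (\<lambda>s. exp (- \<sigma> * s) * \<nu> s)"
proof
  have [measurable]: "(\<lambda>s. jump_density (\<lambda>s. exp (- \<sigma> * s) * \<nu> s) s) \<in> borel_measurable borel"
    unfolding jump_density_tilt by measurable
  have "integrable lborel (\<lambda>s. jump_density \<nu> s * min 1 s)"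
    using L.integrable_min jump_density_nonneg unfolding jumps_def by (subst (asm) integrable_density) auto
  then have "integrable lborel (\<lambda>s. jump_density (\<lambda>s. exp (- \<sigma> * s) * \<nu> s) s * min 1 s)"
  proof (rule Bochner_Integration.integrable_bound)
    show "AE s in lborel. norm (jump_density (\<lambda>s. exp (- \<sigma> * s) * \<nu> s) s * min 1 s) \<le> norm (jump_density \<nu> s * min 1 s)"
    proof (intro AE_I2)
      fix s
      show "norm (jump_density (\<lambda>s. exp (- \<sigma> * s) * \<nu> s) s * min 1 s) \<le> norm (jump_density \<nu> s * min 1 s)"
      proof (cases "0 < s")
        case True
        then have "exp (- \<sigma> * s) \<le> 1" using \<sigma> by simp
        then have "exp (- \<sigma> * s) * (\<bar>jump_density \<nu> s\<bar> * \<bar>min 1 s\<bar>) \<le> 1 * (\<bar>jump_density \<nu> s\<bar> * \<bar>min 1 s\<bar>)"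
          by (intro mult_right_mono) auto
        then show ?thesis unfolding jump_density_tilt by (simp add: abs_mult mult.assoc)
      qed (simp add: jump_density_def)
    qed
  qed measurable
  moreover have "(\<lambda>s. jump_density (\<lambda>s. exp (- \<sigma> * s) * \<nu> s) s * min 1 s)
      = (\<lambda>s. indicator {0<..} s *\<^sub>R (min 1 s * (exp (- \<sigma> * s) * \<nu> s)))"
    by (auto simp: jump_density_def)
  ultimately show "levy_density (\<lambda>s. exp (- \<sigma> * s) * \<nu> s)"
    using levy \<open>_ \<in> borel_measurable borel\<close>
    by (auto simp: levy_density_def set_integrable_def set_borel_measurable_def jump_density_def[abs_def])
qed

lemma tilted_integral:
  assumes \<sigma>: "0 \<le> \<sigma>" and t: "0 < t" and [measurable]: "g \<in> borel_measurable borel"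
  shows "(LINT s|jumps (\<lambda>s. exp (- \<sigma> * s) * \<nu> s) t. g s) = t * (LINT s|L. exp (- \<sigma> * s) * g s)"
proof -
  interpret t: levy_nu "\<lambda>s. exp (- \<sigma> * s) * \<nu> s" by (rule levy_nu_tilt[OF \<sigma>])
  have "(LINT s|jumps (\<lambda>s. exp (- \<sigma> * s) * \<nu> s) t. g s) = t * (LINT s|jumps (\<lambda>s. exp (- \<sigma> * s) * \<nu> s) 1. g s)"
    by (rule t.integral_jumps[OF t]) simp
  also have "(LINT s|jumps (\<lambda>s. exp (- \<sigma> * s) * \<nu> s) 1. g s) = (LINT s|lborel. jump_density \<nu> s * (exp (- \<sigma> * s) * g s))"
  proof -
    have "(LINT s|jumps (\<lambda>s. exp (- \<sigma> * s) * \<nu> s) 1. g s) = (LINT s|lborel. jump_density (\<lambda>s. exp (- \<sigma> * s) * \<nu> s) s * g s)"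
      by (rule t.integral_L) simp
    also have "\<dots> = (LINT s|lborel. jump_density \<nu> s * (exp (- \<sigma> * s) * g s))"
      unfolding jump_density_tilt by (rule Bochner_Integration.integral_cong) auto
    finally show ?thesis .
  qed
  also have "\<dots> = (LINT s|L. exp (- \<sigma> * s) * g s)" by (rule integral_L[symmetric]) simp
  finally show ?thesis .
qed

lemma tilted_integrable:
  fixes g :: "real \<Rightarrow> real"
  assumes \<sigma>: "0 \<le> \<sigma>" and t: "0 < t" and [measurable]: "g \<in> borel_measurable borel"
    and int: "integrable L (\<lambda>s. exp (- \<sigma> * s) * g s)"
  shows "integrable (jumps (\<lambda>s. exp (- \<sigma> * s) * \<nu> s) t) g"
proof -
  define \<nu>' where "\<nu>' = (\<lambda>s. exp (- \<sigma> * s) * \<nu> s)"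
  interpret t: levy_nu \<nu>' unfolding \<nu>'_def by (rule levy_nu_tilt[OF \<sigma>])
  have "integrable lborel (\<lambda>s. jump_density \<nu> s * (exp (- \<sigma> * s) * g s))"
    using int jump_density_nonneg unfolding jumps_def by (subst (asm) integrable_density) auto
  then have i1: "integrable lborel (\<lambda>s. t * (jump_density \<nu> s * (exp (- \<sigma> * s) * g s)))" by simp
  have i2: "(\<lambda>s. t * (jump_density \<nu> s * (exp (- \<sigma> * s) * g s))) = (\<lambda>s. t * jump_density \<nu>' s * g s)"
    unfolding \<nu>'_def jump_density_tilt by auto
  have "integrable lborel (\<lambda>s. t * jump_density \<nu>' s * g s)" using i1 unfolding i2 .
  then show ?thesis
    unfolding jumps_def \<nu>'_def[symmetric] using t t.jump_density_nonneg by (subst integrable_density) auto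
qed

end

lemma cont_density_tilt:
  assumes f: "cont_density M f"
  shows "cont_density (density M (\<lambda>x. ennreal (exp (- \<sigma> * x + c)))) (\<lambda>x. exp (- \<sigma> * x + c) * f x)"
proof -
  have cont: "continuous_on {0<..} f" and nonneg: "\<And>x. 0 < x \<Longrightarrow> 0 \<le> f x"
    and M: "M = density lborel (\<lambda>x. ennreal (indicator {0<..} x * f x))"
    using f by (auto simp: cont_density_def)
  have "(\<lambda>y. indicator {0<..} y *\<^sub>R f y) \<in> borel_measurable borel"
    using cont by (intro borel_measurable_continuous_on_indicator) auto
  then have [measurable]: "(\<lambda>y. indicator {0<..} y * f y) \<in> borel_measurable borel" by simp
  have "density M (\<lambda>x. ennreal (exp (- \<sigma> * x + c)))
      = density lborel (\<lambda>x. ennreal (indicator {0<..} x * f x) * ennreal (exp (- \<sigma> * x + c)))"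
    unfolding M by (rule density_density_eq) auto
  also have "(\<lambda>x. ennreal (indicator {0<..} x * f x) * ennreal (exp (- \<sigma> * x + c)))
      = (\<lambda>x. ennreal (indicator {0<..} x * (exp (- \<sigma> * x + c) * f x)))"
  proof
    fix x
    show "ennreal (indicator {0<..} x * f x) * ennreal (exp (- \<sigma> * x + c))
      = ennreal (indicator {0<..} x * (exp (- \<sigma> * x + c) * f x))"
      using nonneg[of x] by (cases "0 < x") (simp_all add: ennreal_mult mult.commute)
  qed
  finally show ?thesis
    unfolding cont_density_def using cont nonneg by (auto intro!: continuous_intros)
qed

context levy_nu_laws
begin

lemma tilted_law:
  assumes \<sigma>: "0 < \<sigma>" and t: "0 < t"
  shows "laplace_law (jumps (\<lambda>s. exp (- \<sigma> * s) * \<nu> s) t) (density (\<mu> t) (\<lambda>x. ennreal (exp (- \<sigma> * x + t * \<phi> \<sigma>))))"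
proof -
  interpret N: levy_measure "jumps \<nu> t" by (rule levy_measure_jumps[OF t])
  have "laplace_law (jumps (\<lambda>s. exp (- \<sigma> * s) * \<nu> s) t)
      (density (\<mu> t) (\<lambda>x. ennreal (exp (- \<sigma> * x + (LINT s|jumps \<nu> t. 1 - exp (- \<sigma> * s))))))"
  proof (rule N.laplace_law_tilt[OF law[OF t]])
    fix u :: real assume "0 \<le> u"
    have "(LINT s|jumps (\<lambda>s. exp (- \<sigma> * s) * \<nu> s) t. 1 - exp (- u * s)) = t * (LINT s|L. exp (- \<sigma> * s) * (1 - exp (- u * s)))"
      using \<sigma> by (intro tilted_integral t) auto
    also have "\<dots> = (LINT s|jumps \<nu> t. exp (- \<sigma> * s) * (1 - exp (- u * s)))"
      by (rule integral_jumps[OF t, symmetric]) simp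
    finally show "(LINT s|jumps (\<lambda>s. exp (- \<sigma> * s) * \<nu> s) t. 1 - exp (- u * s))
        = (LINT s|jumps \<nu> t. exp (- \<sigma> * s) * (1 - exp (- u * s)))" .
  qed (use \<sigma> in simp)
  then show ?thesis unfolding laplace_exponent_jumps[OF t] .
qed

text \<open>The jumps in \<open>[1 / \<sigma>, 2 / \<sigma>]\<close> suffice: the additional damping
  takes away at least the fraction \<open>1 - exp (- \<theta>)\<close> of each, which is at least
  \<open>\<theta> / 2\<close> for \<theta> up to 1.\<close>

lemma \<phi>'_decrement:
  obtains g where "0 < g" "\<And>\<sigma> \<theta>. 0 < \<sigma> \<Longrightarrow> \<sigma> \<le> \<Lambda> \<Longrightarrow> 0 \<le> \<theta> \<Longrightarrow> \<theta> \<le> 1 \<Longrightarrow>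
    g * \<theta> * (H \<sigma> / \<sigma>) \<le> \<phi>' \<sigma> - \<phi>' ((1 + \<theta>) * \<sigma>)"
proof -
  obtain c1 where c1: "0 < c1" "\<And>l s. 0 < l \<Longrightarrow> l \<le> \<Lambda> \<Longrightarrow> 0 < s \<Longrightarrow> s \<le> 2 / l \<Longrightarrow> c1 * l * H l \<le> \<nu> s"
    using \<nu>_lower_near_origin[of 2] by auto
  define g where "g = c1 * exp (- 2) / 2"
  show ?thesis
  proof (rule that[of g])
    show "0 < g" using c1 by (simp add: g_def)
    fix \<sigma> \<theta> :: real assume \<sigma>: "0 < \<sigma>" "\<sigma> \<le> \<Lambda>" and \<theta>: "0 \<le> \<theta>" "\<theta> \<le> 1"
    have H\<sigma>: "0 < H \<sigma>" by (rule H_pos[OF \<sigma>(1)])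
    have \<sigma>': "0 < (1 + \<theta>) * \<sigma>" using \<sigma> \<theta> by simp
    note ints = L.integrable_mult_exp[OF \<sigma>(1)] L.integrable_mult_exp[OF \<sigma>']
    have half: "\<theta> / 2 \<le> 1 - exp (- \<theta>)"
    proof -
      have "exp (- \<theta>) \<le> 1 / (1 + \<theta>)" using exp_ge_add_one_self[of \<theta>] \<theta> by (simp add: exp_minus divide_simps)
      moreover have "\<theta> / 2 \<le> \<theta> / (1 + \<theta>)" using \<theta> by (intro divide_left_mono) auto
      moreover have "1 - 1 / (1 + \<theta>) = \<theta> / (1 + \<theta>)" using \<theta> by (simp add: field_simps)
      ultimately show ?thesis by linarith
    qed
    have "c1 * \<sigma> * H \<sigma> * (1 / \<sigma> * exp (- 2) * (\<theta> / 2)) * (2 / \<sigma> - 1 / \<sigma>)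
        \<le> (LINT s|L. s * exp (- \<sigma> * s) - s * exp (- ((1 + \<theta>) * \<sigma>) * s))"
    proof (rule integral_L_ge_interval)
      show "integrable L (\<lambda>s. s * exp (- \<sigma> * s) - s * exp (- ((1 + \<theta>) * \<sigma>) * s))"
        using ints by (rule Bochner_Integration.integrable_diff)
      have eq: "s * exp (- \<sigma> * s) - s * exp (- ((1 + \<theta>) * \<sigma>) * s) = s * exp (- \<sigma> * s) * (1 - exp (- (\<theta> * (\<sigma> * s))))" for s
        by (simp add: algebra_simps exp_add[symmetric])
      show "0 \<le> s * exp (- \<sigma> * s) - s * exp (- ((1 + \<theta>) * \<sigma>) * s)" if "0 < s" for s
        unfolding eq using that \<sigma> \<theta> by simp
      fix s assume s: "1 / \<sigma> \<le> s" "s \<le> 2 / \<sigma>"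
      have s0: "0 < s" using s \<sigma> by (meson less_le_trans zero_less_divide_1_iff)
      show "c1 * \<sigma> * H \<sigma> \<le> \<nu> s" by (rule c1(2)[OF \<sigma> s0 s(2)])
      have \<sigma>s: "\<sigma> * s \<le> 2" "1 \<le> \<sigma> * s" using s \<sigma> by (auto simp: field_simps)
      have "\<theta> * 1 \<le> \<theta> * (\<sigma> * s)" using \<sigma>s \<theta> by (intro mult_left_mono) auto
      then have "\<theta> / 2 \<le> 1 - exp (- (\<theta> * (\<sigma> * s)))" using half exp_le_cancel_iff[of "- (\<theta> * (\<sigma> * s))" "- \<theta>"] by linarith
      then show "1 / \<sigma> * exp (- 2) * (\<theta> / 2) \<le> s * exp (- \<sigma> * s) - s * exp (- ((1 + \<theta>) * \<sigma>) * s)"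
        unfolding eq using s s0 \<sigma> \<sigma>s \<theta> by (intro mult_mono) auto
    qed (use \<sigma> c1 H\<sigma> in \<open>auto simp: divide_right_mono\<close>)
    also have "2 / \<sigma> - 1 / \<sigma> = 1 / \<sigma>" by (simp add: diff_divide_distrib[symmetric])
    also have "c1 * \<sigma> * H \<sigma> * (1 / \<sigma> * exp (- 2) * (\<theta> / 2)) * (1 / \<sigma>) = g * \<theta> * (H \<sigma> / \<sigma>)"
      using \<sigma> by (simp add: g_def)
    also have "(LINT s|L. s * exp (- \<sigma> * s) - s * exp (- ((1 + \<theta>) * \<sigma>) * s)) = \<phi>' \<sigma> - \<phi>' ((1 + \<theta>) * \<sigma>)"
      unfolding \<phi>'_def using ints by (rule Bochner_Integration.integral_diff)
    finally show "g * \<theta> * (H \<sigma> / \<sigma>) \<le> \<phi>' \<sigma> - \<phi>' ((1 + \<theta>) * \<sigma>)" .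
  qed
qed

lemma \<phi>'_decrement_le:
  assumes \<sigma>: "0 < \<sigma>" and \<theta>: "0 \<le> \<theta>"
  shows "\<phi>' \<sigma> - \<phi>' ((1 + \<theta>) * \<sigma>) \<le> 6 * \<theta> * (H \<sigma> / \<sigma>)"
proof -
  have \<sigma>': "0 < (1 + \<theta>) * \<sigma>" using \<sigma> \<theta> by simp
  note ints = L.integrable_mult_exp[OF \<sigma>] L.integrable_mult_exp[OF \<sigma>']
  have "\<phi>' \<sigma> - \<phi>' ((1 + \<theta>) * \<sigma>) = (LINT s|L. s * exp (- \<sigma> * s) - s * exp (- ((1 + \<theta>) * \<sigma>) * s))"
    unfolding \<phi>'_def using ints by (rule Bochner_Integration.integral_diff[symmetric])
  also have "\<dots> \<le> (LINT s|L. \<theta> * \<sigma> * (s\<^sup>2 * exp (- \<sigma> * s)))"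
  proof (rule integral_L_mono[OF Bochner_Integration.integrable_diff[OF ints]])
    fix s :: real assume s: "0 < s"
    have eq: "s * exp (- \<sigma> * s) - s * exp (- ((1 + \<theta>) * \<sigma>) * s) = s * exp (- \<sigma> * s) * (1 - exp (- (\<theta> * (\<sigma> * s))))"
      by (simp add: algebra_simps exp_add[symmetric])
    have "1 - exp (- (\<theta> * (\<sigma> * s))) \<le> \<theta> * (\<sigma> * s)" using exp_ge_add_one_self[of "- (\<theta> * (\<sigma> * s))"] by simp
    then have "s * exp (- \<sigma> * s) * (1 - exp (- (\<theta> * (\<sigma> * s)))) \<le> s * exp (- \<sigma> * s) * (\<theta> * (\<sigma> * s))"
      using s by (intro mult_left_mono) auto
    then show "s * exp (- \<sigma> * s) - s * exp (- ((1 + \<theta>) * \<sigma>) * s) \<le> \<theta> * \<sigma> * (s\<^sup>2 * exp (- \<sigma> * s))"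
      unfolding eq by (simp add: power2_eq_square mult_ac)
  qed (use integral_square_exp_le(1)[OF \<sigma>] in simp)
  also have "\<dots> \<le> \<theta> * \<sigma> * (6 * H \<sigma> / \<sigma>\<^sup>2)"
    unfolding integral_mult_right_zero using integral_square_exp_le(2)[OF \<sigma>] \<sigma> \<theta> by (intro mult_left_mono) auto
  also have "\<dots> = 6 * \<theta> * (H \<sigma> / \<sigma>)" using \<sigma> by (simp add: power2_eq_square)
  finally show ?thesis .
qed

text \<open>Under the tilted law with parameter \<open>(1 + \<theta>) \<sigma>\<close>, where \<open>\<theta>\<close> is of order \<open>1 / sqrt (t H \<sigma>)\<close>, the
  point \<open>t \<phi>' \<sigma>\<close> lies a few standard deviations above the mean and is reached by one jump; the
  price of that jump is only \<open>exp (O (sqrt (t H \<sigma>)))\<close>, which the factor 2 in the exponent absorbs.\<close>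

theorem density_lower_bound_left:
  obtains N0 c where "1 \<le> N0" "0 < c" "\<And>\<sigma> t f. 0 < \<sigma> \<Longrightarrow> \<sigma> \<le> \<Lambda> \<Longrightarrow> 0 < t \<Longrightarrow> N0 \<le> t * H \<sigma> \<Longrightarrow>
    cont_density (\<mu> t) f \<Longrightarrow> c * \<sigma> * exp (- 2 * (t * H \<sigma>)) \<le> f (t * \<phi>' \<sigma>)"
proof -
  obtain g where g: "0 < g" "\<And>\<sigma> \<theta>. 0 < \<sigma> \<Longrightarrow> \<sigma> \<le> \<Lambda> \<Longrightarrow> 0 \<le> \<theta> \<Longrightarrow> \<theta> \<le> 1 \<Longrightarrow>
    g * \<theta> * (H \<sigma> / \<sigma>) \<le> \<phi>' \<sigma> - \<phi>' ((1 + \<theta>) * \<sigma>)" using \<phi>'_decrement by blast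
  obtain C where C: "0 < C" "\<And>r s. 1 / \<Lambda> \<le> r \<Longrightarrow> 0 < s \<Longrightarrow> s \<le> r \<Longrightarrow> H (1 / r) \<le> C * (r * \<nu> s)"
    using H_le_\<nu>_below[of "1 / \<Lambda>"] \<Lambda> by auto
  \<comment> \<open>In units of \<open>u / \<sigma>\<close>: 90 / g for the change of tilt from
    \<sigma> to \<sigma>', 6 for the truncation of the mean, 14 for \<open>D\<close>, and 1 for the
    window.\<close>
  define M where "M = 90 / g + 21"
  have M: "21 \<le> M" using g by (simp add: M_def)
  \<comment> \<open>The square makes \<theta> at most 1/10, hence
    \<open>H \<sigma>' \<le> (121 / 100) * H \<sigma>\<close>.\<close>
  define N0 where "N0 = max 1 ((150 / g)\<^sup>2)"
  define c where "c = exp (- 6) / (2 * C * M ^ 3) * exp (- (2 * M + 1)\<^sup>2)"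
  show ?thesis
  proof (rule that[of N0 c])
    show "1 \<le> N0" by (simp add: N0_def)
    show "0 < c" using C M by (simp add: c_def)
    fix \<sigma> t f assume \<sigma>: "0 < \<sigma>" "\<sigma> \<le> \<Lambda>" and t: "0 < t" and N: "N0 \<le> t * H \<sigma>" and f: "cont_density (\<mu> t) f"
    have H\<sigma>: "0 < H \<sigma>" by (rule H_pos[OF \<sigma>(1)])
    define u where "u = sqrt (t * H \<sigma>)"
    have tH: "1 \<le> t * H \<sigma>" "(150 / g)\<^sup>2 \<le> t * H \<sigma>" using N by (auto simp: N0_def)
    have u2: "u\<^sup>2 = t * H \<sigma>" using tH by (simp add: u_def)
    have u1: "1 \<le> u" using tH by (simp add: u_def)
    have ug: "150 / g \<le> u" unfolding u_def using tH(2) by (rule real_le_rsqrt)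
    \<comment> \<open>Moves the tilted mean to the left by at least
      \<open>g * \<theta> * u^2 / \<sigma> = 15 * u / \<sigma>\<close>, which is
      \<open>a + D\<close>.\<close>
    define \<theta> where "\<theta> = 15 / (g * u)"
    have \<theta>: "0 < \<theta>" "\<theta> \<le> 1 / 10" using g u1 ug by (auto simp: \<theta>_def field_simps)
    define \<sigma>' where "\<sigma>' = (1 + \<theta>) * \<sigma>"
    have \<sigma>': "0 < \<sigma>'" "\<sigma> \<le> \<sigma>'" using \<sigma> \<theta> by (auto simp: \<sigma>'_def)
    have "H \<sigma>' \<le> (1 + \<theta>)\<^sup>2 * H \<sigma>" unfolding \<sigma>'_def using \<sigma> \<theta> by (intro H_scale) auto
    also have "(1 + \<theta>)\<^sup>2 * H \<sigma> \<le> 121 / 100 * H \<sigma>"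
    proof -
      have "(1 + \<theta>)\<^sup>2 \<le> (1 + 1 / 10)\<^sup>2" using \<theta> by (intro power_mono) auto
      then show ?thesis using H\<sigma> by (intro mult_right_mono) (auto simp: power2_eq_square)
    qed
    finally have "t * H \<sigma>' \<le> t * (121 / 100 * H \<sigma>)" using t by (intro mult_left_mono) auto
    then have tH': "t * H \<sigma>' \<le> 121 / 100 * u\<^sup>2" by (simp add: u2)
    have tHs: "t * (6 * H \<sigma>' / \<sigma>'\<^sup>2) \<le> 6 * u\<^sup>2 / \<sigma>\<^sup>2"
    proof -
      have "H \<sigma>' / \<sigma>'\<^sup>2 \<le> H \<sigma> / \<sigma>\<^sup>2"
      proof -
        have "H \<sigma>' / \<sigma>'\<^sup>2 \<le> (1 + \<theta>)\<^sup>2 * H \<sigma> / \<sigma>'\<^sup>2"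
          using \<open>H \<sigma>' \<le> (1 + \<theta>)\<^sup>2 * H \<sigma>\<close> by (rule divide_right_mono) simp
        also have "\<dots> = H \<sigma> / \<sigma>\<^sup>2" using \<theta> by (simp add: \<sigma>'_def power_mult_distrib)
        finally show ?thesis .
      qed
      then have "6 * t * (H \<sigma>' / \<sigma>'\<^sup>2) \<le> 6 * t * (H \<sigma> / \<sigma>\<^sup>2)" using t by (intro mult_left_mono) auto
      then show ?thesis by (simp add: u2 mult_ac)
    qed
    define a where "a = u / \<sigma>"
    \<comment> \<open>14 is the least integer whose square exceeds 32 * 6, as the variance bound
      \<open>6 * u^2 / \<sigma>^2\<close> requires.\<close>
    define D where "D = 14 * u / \<sigma>"
    have a: "0 < a" using u1 \<sigma> by (simp add: a_def)
    have aD: "4 * a \<le> D" "a + D = 15 * u / \<sigma>" using u1 \<sigma> by (auto simp: a_def D_def field_simps)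
    let ?\<nu> = "\<lambda>s. exp (- \<sigma>' * s) * \<nu> s"
    interpret tl: levy_nu ?\<nu> by (rule levy_nu_tilt) (use \<sigma>' in simp)
    interpret N: levy_measure "jumps ?\<nu> t" by (rule tl.levy_measure_jumps[OF t])
    have s0: "0 \<le> \<sigma>'" using \<sigma>' by simp
    note ti = tilted_integral[OF s0 t] and tb = tilted_integrable[OF s0 t]
    define m where "m = (LINT s|L. exp (- \<sigma>' * s) * (indicator {..a} s * s))"
    have int_m: "integrable L (\<lambda>s. exp (- \<sigma>' * s) * (indicator {..a} s * s))"
    proof -
      have "integrable L (\<lambda>s. indicator {..a} s * (s * exp (- \<sigma>' * s)))"
        by (rule L.integrable_mult_bounded[OF L.integrable_mult_exp[OF \<sigma>'(1)], where B = 1]) auto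
      then show ?thesis by (simp add: mult_ac)
    qed
    have int_v: "integrable L (\<lambda>s. exp (- \<sigma>' * s) * (indicator {..a} s * s\<^sup>2))"
    proof -
      have "integrable L (\<lambda>s. indicator {..a} s * (s\<^sup>2 * exp (- \<sigma>' * s)))"
        by (rule L.integrable_mult_bounded[OF integral_square_exp_le(1)[OF \<sigma>'(1)], where B = 1]) auto
      then show ?thesis by (simp add: mult_ac)
    qed
    have mN: "(LINT s|jumps ?\<nu> t. indicator {..a} s * s) = t * m" unfolding m_def by (rule ti) simp
    have vN: "(LINT s|jumps ?\<nu> t. indicator {..a} s * s\<^sup>2) \<le> 6 * u\<^sup>2 / \<sigma>\<^sup>2"
    proof -
      have "(LINT s|jumps ?\<nu> t. indicator {..a} s * s\<^sup>2) = t * (LINT s|L. exp (- \<sigma>' * s) * (indicator {..a} s * s\<^sup>2))"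
        by (rule ti) simp
      also have "\<dots> \<le> t * (LINT s|L. s\<^sup>2 * exp (- \<sigma>' * s))"
        using t int_v integral_square_exp_le(1)[OF \<sigma>'(1)]
        by (intro mult_left_mono integral_L_mono) (auto simp: indicator_def)
      also have "\<dots> \<le> t * (6 * H \<sigma>' / \<sigma>'\<^sup>2)"
        using t integral_square_exp_le(2)[OF \<sigma>'(1)] by (intro mult_left_mono) auto
      finally show ?thesis using tHs by linarith
    qed
    have \<phi>'m: "m \<le> \<phi>' \<sigma>'" "\<phi>' \<sigma>' - m \<le> 6 * H \<sigma>' / (a * \<sigma>'\<^sup>2)"
    proof -
      show "m \<le> \<phi>' \<sigma>'" unfolding m_def \<phi>'_def
        using int_m L.integrable_mult_exp[OF \<sigma>'(1)] by (intro integral_L_mono) (auto simp: indicator_def)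
      have "\<phi>' \<sigma>' \<le> (LINT s|L. exp (- \<sigma>' * s) * (indicator {..a} s * s) + indicator {a<..} s * (s * exp (- \<sigma>' * s)))"
        unfolding \<phi>'_def using int_m L.integrable_mult_exp[OF \<sigma>'(1)] integral_greater_le(1)[OF a \<sigma>'(1)]
        by (intro integral_L_mono Bochner_Integration.integrable_add) (auto simp: indicator_def)
      also have "\<dots> = m + (LINT s|L. indicator {a<..} s * (s * exp (- \<sigma>' * s)))"
        unfolding m_def using int_m integral_greater_le(1)[OF a \<sigma>'(1)] by (intro Bochner_Integration.integral_add)
      finally show "\<phi>' \<sigma>' - m \<le> 6 * H \<sigma>' / (a * \<sigma>'\<^sup>2)" using integral_greater_le(2)[OF a \<sigma>'(1)] by linarith
    qed
    have gap: "15 * u / \<sigma> \<le> t * \<phi>' \<sigma> - t * m"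
    proof -
      have "g * \<theta> * (H \<sigma> / \<sigma>) \<le> \<phi>' \<sigma> - m" using g(2)[OF \<sigma>, of \<theta>] \<theta> \<phi>'m by (simp add: \<sigma>'_def)
      then have "t * (g * \<theta> * (H \<sigma> / \<sigma>)) \<le> t * (\<phi>' \<sigma> - m)" using t by (intro mult_left_mono) auto
      also have "t * (g * \<theta> * (H \<sigma> / \<sigma>)) = g * \<theta> * u\<^sup>2 / \<sigma>" by (simp add: u2)
      also have "\<dots> = 15 * u / \<sigma>" using g u1 by (simp add: \<theta>_def power2_eq_square)
      finally show ?thesis by (simp add: right_diff_distrib)
    qed
    have gap2: "t * \<phi>' \<sigma> - t * m + D + 1 / \<sigma> \<le> M * u / \<sigma>"
    proof -
      have "t * (\<phi>' \<sigma> - \<phi>' \<sigma>') \<le> t * (6 * \<theta> * (H \<sigma> / \<sigma>))"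
        unfolding \<sigma>'_def using \<phi>'_decrement_le[OF \<sigma>(1), of \<theta>] \<theta> t by (intro mult_left_mono) auto
      also have "\<dots> = 6 * \<theta> * u\<^sup>2 / \<sigma>" by (simp add: u2)
      also have "\<dots> = 90 / g * u / \<sigma>" using g u1 by (simp add: \<theta>_def power2_eq_square)
      finally have 1: "t * (\<phi>' \<sigma> - \<phi>' \<sigma>') \<le> 90 / g * u / \<sigma>" .
      have "t * (\<phi>' \<sigma>' - m) \<le> t * (6 * H \<sigma>' / (a * \<sigma>'\<^sup>2))" using \<phi>'m t by (intro mult_left_mono) auto
      also have "\<dots> = 1 / a * (t * (6 * H \<sigma>' / \<sigma>'\<^sup>2))" by simp
      also have "\<dots> \<le> 1 / a * (6 * u\<^sup>2 / \<sigma>\<^sup>2)" using a by (intro mult_left_mono tHs) auto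
      also have "\<dots> = 6 * u / \<sigma>" using u1 \<sigma> by (simp add: a_def power2_eq_square)
      finally have 2: "t * (\<phi>' \<sigma>' - m) \<le> 6 * u / \<sigma>" .
      have 3: "1 / \<sigma> \<le> u / \<sigma>" using u1 \<sigma> by (intro divide_right_mono) auto
      have "M * u / \<sigma> = 90 / g * u / \<sigma> + 6 * u / \<sigma> + 14 * u / \<sigma> + u / \<sigma>"
        by (simp add: M_def add_divide_distrib distrib_right)
      with 1 2 3 show ?thesis unfolding D_def right_diff_distrib by linarith
    qed
    have meas: "measure (jumps ?\<nu> t) {a<..} \<le> 6"
    proof -
      have "measure (jumps ?\<nu> t) {a<..} = (LINT s|jumps ?\<nu> t. indicator {a<..} s)" by (simp add: jumps_def)
      also have "\<dots> = t * (LINT s|L. exp (- \<sigma>' * s) * indicator {a<..} s)" by (rule ti) simp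
      also have "\<dots> = t * (LINT s|L. indicator {a<..} s * exp (- \<sigma>' * s))" by (simp only: mult.commute)
      also have "\<dots> \<le> t * (6 * H \<sigma>' / (a\<^sup>2 * \<sigma>'\<^sup>2))"
        using integral_greater_le(4)[OF a \<sigma>'(1)] t by (intro mult_left_mono) auto
      also have "\<dots> = 1 / a\<^sup>2 * (t * (6 * H \<sigma>' / \<sigma>'\<^sup>2))" by simp
      also have "\<dots> \<le> 1 / a\<^sup>2 * (6 * u\<^sup>2 / \<sigma>\<^sup>2)" by (intro mult_left_mono tHs) auto
      also have "\<dots> = 6" using u1 \<sigma> by (simp add: a_def power_divide)
      finally show ?thesis .
    qed
    \<comment> \<open>A lower bound for the tilted Levy density up to
      \<open>M * u / \<sigma>\<close>: the fraction bounds \<open>t * \<nu> s\<close>, and the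
      exponential bounds the damping because \<open>\<sigma>' \<le> 2 * \<sigma>\<close>.\<close>
    define k where "k = \<sigma> / (C * M ^ 3 * u) * exp (- (2 * M * u))"
    define F where "F x = exp (- \<sigma>' * x + t * \<phi> \<sigma>') * f x" for x
    have F: "cont_density (density (\<mu> t) (\<lambda>x. ennreal (exp (- \<sigma>' * x + t * \<phi> \<sigma>')))) F"
      unfolding F_def by (rule cont_density_tilt[OF f])
    have "exp (- 6) / 2 * k \<le> F (t * \<phi>' \<sigma>)"
    proof (rule N.one_big_jump_density_bound[OF tilted_law[OF \<sigma>'(1) t] jumps_def _ F _ a aD(1)])
      show "0 < t * \<phi>' \<sigma>" using t \<phi>'_pos[OF \<sigma>(1)] by simp
      show "(\<lambda>s. t * jump_density ?\<nu> s) \<in> borel_measurable borel"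
        by (intro borel_measurable_times borel_measurable_const tl.jump_density_measurable)
      show "integrable (jumps ?\<nu> t) (\<lambda>s. indicator {..a} s * s)" by (rule tb[OF _ int_m]) simp
      show "integrable (jumps ?\<nu> t) (\<lambda>s. indicator {..a} s * s\<^sup>2)" by (rule tb[OF _ int_v]) simp
      have "32 * (6 * u\<^sup>2 / \<sigma>\<^sup>2) \<le> D\<^sup>2" by (simp add: D_def power_divide power_mult_distrib divide_right_mono)
      with vN show "32 * (LINT s|jumps ?\<nu> t. indicator {..a} s * s\<^sup>2) \<le> D\<^sup>2" by linarith
      show "a \<le> t * \<phi>' \<sigma> - (LINT s|jumps ?\<nu> t. indicator {..a} s * s) - D"
        unfolding mN using gap aD by linarith
      show "t * \<phi>' \<sigma> - (LINT s|jumps ?\<nu> t. indicator {..a} s * s) + D + 1 / \<sigma> \<le> M * u / \<sigma>"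
        unfolding mN by (rule gap2)
      show "measure (jumps ?\<nu> t) {a<..} \<le> 6" by (rule meas)
      show "0 \<le> k" using C M u1 \<sigma> by (simp add: k_def)
      fix s assume s: "0 < s" "s \<le> M * u / \<sigma>"
      define r where "r = M * u / \<sigma>"
      have Mu: "1 \<le> M * u" using M u1 mult_mono[of 1 M 1 u] by simp
      have "1 / \<Lambda> \<le> r" unfolding r_def using \<sigma> Mu \<Lambda> by (intro frac_le) auto
      then have Hr: "H (1 / r) \<le> C * (r * \<nu> s)" using s by (intro C) (auto simp: r_def)
      have "H (M * u * (1 / r)) \<le> (M * u)\<^sup>2 * H (1 / r)" using Mu \<sigma> by (intro H_scale) (auto simp: r_def)
      moreover have "M * u * (1 / r) = \<sigma>" using Mu \<sigma> M u1 by (simp add: r_def)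
      ultimately have "H \<sigma> \<le> (M * u)\<^sup>2 * H (1 / r)" by simp
      also have "\<dots> \<le> (M * u)\<^sup>2 * (C * (r * \<nu> s))" using Hr by (intro mult_left_mono) auto
      finally have "t * H \<sigma> \<le> t * ((M * u)\<^sup>2 * (C * (r * \<nu> s)))" using t by (intro mult_left_mono) auto
      then have "u\<^sup>2 \<le> C * M ^ 3 * u ^ 3 / \<sigma> * (t * \<nu> s)"
        unfolding u2 by (simp add: r_def power2_eq_square power3_eq_cube mult_ac)
      then have "\<sigma> / (C * M ^ 3 * u) \<le> t * \<nu> s"
        using C M u1 \<sigma> by (simp add: field_simps power2_eq_square power3_eq_cube)
      moreover have "exp (- (2 * M * u)) \<le> exp (- \<sigma>' * s)"
      proof -
        have "\<sigma>' * s \<le> (2 * \<sigma>) * (M * u / \<sigma>)"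
          using s \<sigma> \<theta> by (intro mult_mono) (auto simp: \<sigma>'_def)
        then show ?thesis using \<sigma> by simp
      qed
      ultimately have "k \<le> t * \<nu> s * exp (- \<sigma>' * s)"
        unfolding k_def using \<sigma> C M u1 t \<nu>_pos[OF s(1)] by (intro mult_mono) auto
      also have "\<dots> = t * jump_density ?\<nu> s" unfolding jump_density_tilt using s by simp
      finally show "k \<le> t * jump_density ?\<nu> s" .
    qed (use \<sigma> in auto)
    \<comment> \<open>At the point \<open>t * \<phi>' \<sigma>\<close> the tilting factor is at most
      \<open>exp (t * H \<sigma>')\<close>.\<close>
    moreover have "F (t * \<phi>' \<sigma>) \<le> exp (121 / 100 * u\<^sup>2) * f (t * \<phi>' \<sigma>)"
    proof -
      have "- \<sigma>' * (t * \<phi>' \<sigma>) + t * \<phi> \<sigma>' = t * H \<sigma>' - t * \<sigma>' * (\<phi>' \<sigma> - \<phi>' \<sigma>')"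
        unfolding H_eq[OF \<sigma>'(1)] by (simp add: algebra_simps)
      also have "\<dots> \<le> t * H \<sigma>'" using t \<sigma>' \<phi>'_antimono[OF \<sigma>(1) \<sigma>'(2)] by simp
      also have "\<dots> \<le> 121 / 100 * u\<^sup>2" by (rule tH')
      finally have "exp (- \<sigma>' * (t * \<phi>' \<sigma>) + t * \<phi> \<sigma>') \<le> exp (121 / 100 * u\<^sup>2)" by (simp only: exp_le_cancel_iff)
      moreover have "0 \<le> f (t * \<phi>' \<sigma>)" using f t \<phi>'_pos[OF \<sigma>(1)] by (simp add: cont_density_def)
      ultimately show ?thesis unfolding F_def by (intro mult_right_mono)
    qed
    ultimately have "exp (- 6) / 2 * k \<le> exp (121 / 100 * u\<^sup>2) * f (t * \<phi>' \<sigma>)" by linarith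
    then have "exp (- (121 / 100 * u\<^sup>2)) * (exp (- 6) / 2 * k) \<le> exp (- (121 / 100 * u\<^sup>2)) * (exp (121 / 100 * u\<^sup>2) * f (t * \<phi>' \<sigma>))"
      by (intro mult_left_mono) auto
    also have "\<dots> = f (t * \<phi>' \<sigma>)" by (simp only: mult.assoc[symmetric] exp_add[symmetric]) simp
    finally have fk: "exp (- (121 / 100 * u\<^sup>2)) * (exp (- 6) / 2 * k) \<le> f (t * \<phi>' \<sigma>)" .
    \<comment> \<open>The factor \<open>1 / u\<close> is at least \<open>exp (- u)\<close>, and
      completing the square gives \<open>(2 * M + 1) * u \<le> (2 * M + 1)^2 + u^2 / 4\<close>.
      There is room in the exponent because 121 / 100 + 1 / 4 is below 2.\<close>
    have poly: "exp (- (2 * M + 1)\<^sup>2) * exp (- 2 * u\<^sup>2) \<le> 1 / u * exp (- (2 * M * u)) * exp (- (121 / 100 * u\<^sup>2))"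
    proof -
      have "u \<le> exp u" using exp_ge_add_one_self[of u] by linarith
      then have "exp (- u) \<le> 1 / u" using u1 by (simp add: exp_minus divide_simps)
      then have "exp (- u) * (exp (- (2 * M * u)) * exp (- (121 / 100 * u\<^sup>2))) \<le> 1 / u * (exp (- (2 * M * u)) * exp (- (121 / 100 * u\<^sup>2)))"
        by (intro mult_right_mono) auto
      moreover have "exp (- (2 * M + 1)\<^sup>2) * exp (- 2 * u\<^sup>2) \<le> exp (- u) * (exp (- (2 * M * u)) * exp (- (121 / 100 * u\<^sup>2)))"
      proof -
        define b where "b = 2 * M + 1"
        have "0 \<le> (b - u / 2)\<^sup>2" by simp
        then have "b * u \<le> b\<^sup>2 + 1 / 4 * u\<^sup>2" by (simp add: power2_eq_square algebra_simps)
        moreover have "0 \<le> u\<^sup>2" by simp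
        moreover have "b * u = 2 * M * u + u" by (simp add: b_def algebra_simps)
        ultimately have "- (2 * M + 1)\<^sup>2 + - 2 * u\<^sup>2 \<le> - u + (- (2 * M * u) + - (121 / 100 * u\<^sup>2))"
          unfolding b_def[symmetric] by linarith
        then show ?thesis by (simp only: exp_add[symmetric] exp_le_cancel_iff)
      qed
      ultimately show ?thesis by (simp add: mult.assoc)
    qed
    have "c * \<sigma> * exp (- 2 * u\<^sup>2) = exp (- 6) / (2 * C * M ^ 3) * \<sigma> * (exp (- (2 * M + 1)\<^sup>2) * exp (- 2 * u\<^sup>2))"
      by (simp add: c_def)
    also have "\<dots> \<le> exp (- 6) / (2 * C * M ^ 3) * \<sigma> * (1 / u * exp (- (2 * M * u)) * exp (- (121 / 100 * u\<^sup>2)))"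
      using C M \<sigma> by (intro mult_left_mono poly) auto
    also have "\<dots> = exp (- (121 / 100 * u\<^sup>2)) * (exp (- 6) / 2 * k)" by (simp add: k_def mult_ac)
    also note fk
    finally show "c * \<sigma> * exp (- 2 * (t * H \<sigma>)) \<le> f (t * \<phi>' \<sigma>)" by (simp add: u2)
  qed
qed

end

section \<open>Two-sided bounds\<close>

lemma min_nu_ext:
  assumes "0 < t"
  shows "min (ereal r) (ereal t * nu_ext \<nu> y) = ereal (if y = 0 then r else min r (t * \<nu> y))"
  using assms by (simp add: nu_ext_def)

context levy_nu_laws
begin

text \<open>Right of the centre \<open>t * \<phi>' l\<close> the exponential factors of the second
  pair lie between positive constants, so it follows from the first. Left of it the convention for
  \<nu> at 0 leaves only the exponential term.\<close>

theorem density_bounds: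
  assumes \<Lambda>_eq: "H \<Lambda> = 1 / T" and p: "\<And>t. T \<le> t \<Longrightarrow> cont_density (\<mu> t) (p t)"
  obtains c1 c2 where "1 < c1" "1 < c2"
    "\<And>t y. T \<le> t \<Longrightarrow> 0 \<le> y \<Longrightarrow>
       ereal (1 / c1) * min (ereal (H_phi_inv \<nu> (1 / t))) (ereal t * nu_ext \<nu> y) \<le> ereal (p t (t * b_phi \<nu> t + y)) \<and>
       ereal (p t (t * b_phi \<nu> t + y)) \<le> ereal c1 * min (ereal (H_phi_inv \<nu> (1 / t))) (ereal t * nu_ext \<nu> y)"
    "\<And>t x. T \<le> t \<Longrightarrow> t * b_phi \<nu> T \<le> x \<Longrightarrow>
       ereal (1 / c2) * min (ereal (H_phi_inv \<nu> (1 / t) * exp (- 2 * t * H_phi \<nu> (sigma_phi \<nu> t x))))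
                            (ereal t * nu_ext \<nu> (max (x - t * b_phi \<nu> t) 0)) \<le> ereal (p t x) \<and>
       ereal (p t x) \<le> ereal c2 * min (ereal (H_phi_inv \<nu> (1 / t) * exp (- (t / 2) * H_phi \<nu> (sigma_phi \<nu> t x))))
                            (ereal t * nu_ext \<nu> (max (x - t * b_phi \<nu> t) 0))"
proof -
  obtain N0 c3 where N0: "1 \<le> N0" and c3: "0 < c3" "\<And>\<sigma> t f. 0 < \<sigma> \<Longrightarrow> \<sigma> \<le> \<Lambda> \<Longrightarrow> 0 < t \<Longrightarrow> N0 \<le> t * H \<sigma> \<Longrightarrow>
    cont_density (\<mu> t) f \<Longrightarrow> c3 * \<sigma> * exp (- 2 * (t * H \<sigma>)) \<le> f (t * \<phi>' \<sigma>)"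
    using density_lower_bound_left by metis
  obtain c where c: "0 < c" "\<And>\<sigma> t f y B. 0 < \<sigma> \<Longrightarrow> \<sigma> \<le> \<Lambda> \<Longrightarrow> 1 \<le> t * H \<sigma> \<Longrightarrow> t * H \<sigma> \<le> N0 \<Longrightarrow>
    cont_density (\<mu> t) f \<Longrightarrow> 0 \<le> y \<Longrightarrow> 0 \<le> B \<Longrightarrow> B \<le> \<sigma> \<Longrightarrow> (0 < y \<Longrightarrow> B \<le> t * \<nu> y) \<Longrightarrow> c * B \<le> f (t * \<phi>' \<sigma> + y)"
    using density_lower_bound_central[OF N0] by metis
  obtain C where C: "0 < C"
    "\<And>l f x. 0 < l \<Longrightarrow> l \<le> \<Lambda> \<Longrightarrow> cont_density (\<mu> (1 / H l)) f \<Longrightarrow> 0 < x \<Longrightarrow> f x \<le> 2 * C * l"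
    "\<And>l f \<sigma>. 0 < l \<Longrightarrow> l \<le> \<Lambda> \<Longrightarrow> cont_density (\<mu> (1 / H l)) f \<Longrightarrow> 0 < \<sigma> \<Longrightarrow>
       f (1 / H l * \<phi>' \<sigma>) \<le> 2 * C * l * exp (- (1 / H l / 2) * H \<sigma>)"
    using density_sup_bound by metis
  obtain C' where C': "0 < C'" "\<And>l f y. 0 < l \<Longrightarrow> l \<le> \<Lambda> \<Longrightarrow> cont_density (\<mu> (1 / H l)) f \<Longrightarrow> 0 < y \<Longrightarrow>
    f (1 / H l * \<phi>' l + y) \<le> C' * (1 / H l * \<nu> y)"
    using density_tail_bound by metis
  define A where "A = 2 + 2 * C + C' + 1 / c + 1 / c3"
  have A: "2 \<le> A" "2 * C \<le> A" "C' \<le> A" "1 / c \<le> A" "1 / c3 \<le> A"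
    using C C' c c3 by (auto simp: A_def)
  have Ac: "1 / A \<le> c" "1 / A \<le> c3"
    using A c c3 by (auto simp: field_simps)
  \<comment> \<open>Right of the centre \<open>t * h \<le> 1\<close>, so the factor
    \<open>exp (- (t / 2) * h)\<close> is at least \<open>exp (- 1 / 2)\<close>.\<close>
  define A2 where "A2 = A * exp (1 / 2)"
  have A2: "A \<le> A2" using A by (simp add: A2_def)
  define B where "B t y l = (if y = 0 then l else min l (t * \<nu> y))" for t y l :: real
  have time: "\<exists>l. 0 < l \<and> l \<le> \<Lambda> \<and> t = 1 / H l \<and> H_phi_inv \<nu> (1 / t) = l \<and> b_phi \<nu> t = \<phi>' l"
    if t: "T \<le> t" for t
  proof -
    have t0: "0 < t" using t T by linarith
    obtain l where l: "0 < l" "H l = 1 / t" using H_surj[of "1 / t"] t0 by auto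
    have "H l \<le> H \<Lambda>" unfolding l(2) \<Lambda>_eq using t T by (intro frac_le) auto
    then have "l \<le> \<Lambda>" using H_less_iff[OF l(1) \<Lambda>(1)] by simp
    moreover have "H_phi_inv \<nu> (1 / t) = l" unfolding l(2)[symmetric] by (rule H_phi_inv_eq[OF l(1)])
    ultimately show ?thesis using l by (intro exI[of _ l]) (auto simp: b_phi_def phi_deriv_eq)
  qed
  have b\<Lambda>: "b_phi \<nu> T = \<phi>' \<Lambda>"
    unfolding b_phi_def \<Lambda>_eq[symmetric] H_phi_inv_eq[OF \<Lambda>(1)] by (rule phi_deriv_eq[OF \<Lambda>(1)])
  have main: "1 / A * B t y l \<le> p t (t * \<phi>' l + y)" "p t (t * \<phi>' l + y) \<le> A * B t y l"
    if t: "T \<le> t" and l: "0 < l" "l \<le> \<Lambda>" "t = 1 / H l" and y: "0 \<le> y" for t l y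
  proof -
    have Hl: "0 < H l" by (rule H_pos[OF l(1)])
    have t0: "0 < t" using t T by linarith
    have tH: "t * H l = 1" using l Hl by simp
    have f: "cont_density (\<mu> t) (p t)" by (rule p[OF t])
    have B0: "0 \<le> B t y l" "B t y l \<le> l" "0 < y \<Longrightarrow> B t y l \<le> t * \<nu> y"
      using l y t0 \<nu>_pos[of y] by (auto simp: B_def less_eq_real_def)
    have "1 / A * B t y l \<le> c * B t y l" using Ac B0 by (intro mult_right_mono)
    also have "\<dots> \<le> p t (t * \<phi>' l + y)"
      using B0 y tH N0 by (intro c(2) l f) auto
    finally show "1 / A * B t y l \<le> p t (t * \<phi>' l + y)" .
    have x0: "0 < t * \<phi>' l + y" using t0 \<phi>'_pos[OF l(1)] y by (simp add: add_pos_nonneg)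
    have "p t (t * \<phi>' l + y) \<le> 2 * C * l" using C(2)[OF l(1,2) f[unfolded l(3)] x0[unfolded l(3)]] l(3) by simp
    also have "\<dots> \<le> A * l" using A l by (intro mult_right_mono) auto
    finally have 1: "p t (t * \<phi>' l + y) \<le> A * l" .
    have 2: "p t (t * \<phi>' l + y) \<le> A * (t * \<nu> y)" if y': "0 < y"
    proof -
      have "p t (t * \<phi>' l + y) \<le> C' * (t * \<nu> y)" using C'(2)[OF l(1,2) f[unfolded l(3)] y'] l(3) by simp
      also have "\<dots> \<le> A * (t * \<nu> y)" using A t0 \<nu>_pos[OF y'] by (intro mult_right_mono) auto
      finally show ?thesis .
    qed
    show "p t (t * \<phi>' l + y) \<le> A * B t y l" using 1 2 y by (auto simp: B_def min_def)
  qed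
  show ?thesis
  proof (rule that[of A A2])
    show "1 < A" "1 < A2" using A A2 by auto
    fix t y assume t: "T \<le> t" and y: "(0::real) \<le> y"
    have t0: "0 < t" using t T by linarith
    obtain l where l: "0 < l" "l \<le> \<Lambda>" "t = 1 / H l" "H_phi_inv \<nu> (1 / t) = l" "b_phi \<nu> t = \<phi>' l"
      using time[OF t] by blast
    show "ereal (1 / A) * min (ereal (H_phi_inv \<nu> (1 / t))) (ereal t * nu_ext \<nu> y) \<le> ereal (p t (t * b_phi \<nu> t + y)) \<and>
       ereal (p t (t * b_phi \<nu> t + y)) \<le> ereal A * min (ereal (H_phi_inv \<nu> (1 / t))) (ereal t * nu_ext \<nu> y)"
      unfolding min_nu_ext[OF t0] l(4,5) B_def[symmetric] times_ereal.simps ereal_less_eq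
      using main[OF t l(1-3) y] by blast
  next
    fix t x assume t: "T \<le> t" and x: "t * b_phi \<nu> T \<le> x"
    have t0: "0 < t" using t T by linarith
    obtain l where l: "0 < l" "l \<le> \<Lambda>" "t = 1 / H l" "H_phi_inv \<nu> (1 / t) = l" "b_phi \<nu> t = \<phi>' l"
      using time[OF t] by blast
    have Hl: "0 < H l" by (rule H_pos[OF l(1)])
    have tH: "t * H l = 1" using l Hl by simp
    have f: "cont_density (\<mu> t) (p t)" by (rule p[OF t])
    have x\<Lambda>: "t * \<phi>' \<Lambda> \<le> x" using x b\<Lambda> by simp
    define h where "h = H_phi \<nu> (sigma_phi \<nu> t x)"
    define y where "y = max (x - t * \<phi>' l) 0"
    have "1 / A2 * B t y (l * exp (- 2 * t * h)) \<le> p t x \<and> p t x \<le> A2 * B t y (l * exp (- (t / 2) * h))"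
    proof (cases "t * \<phi>' l \<le> x")
      case True
      then have xy: "x = t * \<phi>' l + y" "0 \<le> y" by (auto simp: y_def)
      \<comment> \<open>There the parameter \<sigma> is at most \<open>l\<close>, and
        \<open>t * H l = 1\<close>; the default value 0 is harmless.\<close>
      have h: "0 \<le> h" "t * h \<le> 1"
      proof -
        have "0 \<le> h \<and> t * h \<le> 1"
          using t0 \<Lambda>(1) x\<Lambda>
        proof (cases rule: sigma_phi_cases)
          case (1 u)
          have "\<phi>' l \<le> \<phi>' u" using True 1 t0 by simp
          then have "u \<le> l" using \<phi>'_strict_antimono[OF l(1), of u] by (cases "u \<le> l") auto
          then have "t * H u \<le> t * H l" using t0 1 by (intro mult_left_mono H_mono) auto
          then show ?thesis using 1 tH H_pos[of u] by (simp add: h_def H_phi_eq less_imp_le)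
        qed (simp add: h_def H_phi_def)
        then show "0 \<le> h" "t * h \<le> 1" by auto
      qed
      have B_mono: "B t y r \<le> B t y s" if "r \<le> s" for r s using that by (auto simp: B_def)
      have B0: "0 \<le> B t y r" if "0 \<le> r" for r
        using that xy t0 \<nu>_pos[of y] by (auto simp: B_def less_eq_real_def)
      have "l * exp (- 2 * t * h) \<le> l * 1" using l h t0 by (intro mult_left_mono) auto
      then have "1 / A2 * B t y (l * exp (- 2 * t * h)) \<le> 1 / A * B t y l"
        using A A2 l by (intro mult_mono B_mono B0 frac_le) auto
      then have lo: "1 / A2 * B t y (l * exp (- 2 * t * h)) \<le> p t x"
        using main(1)[OF t l(1-3) xy(2)] xy(1) by simp
      have "l \<le> exp (1 / 2) * (l * exp (- (t / 2) * h))"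
      proof -
        have "l * 1 \<le> l * exp (1 / 2 + - (t / 2) * h)" using h l by (intro mult_left_mono) auto
        then show ?thesis unfolding exp_add by (simp only: mult_1_right mult.left_commute)
      qed
      moreover have "t * \<nu> y \<le> exp (1 / 2) * (t * \<nu> y)" if "y \<noteq> 0"
      proof -
        have "0 \<le> t * \<nu> y" using that xy t0 \<nu>_pos[of y] by simp
        then have "1 * (t * \<nu> y) \<le> exp (1 / 2) * (t * \<nu> y)" by (intro mult_right_mono) auto
        then show ?thesis by simp
      qed
      ultimately have "B t y l \<le> exp (1 / 2) * B t y (l * exp (- (t / 2) * h))"
        by (auto simp: B_def min_def)
      then have "A * B t y l \<le> A * (exp (1 / 2) * B t y (l * exp (- (t / 2) * h)))"
        using A by (intro mult_left_mono) auto
      then have "p t x \<le> A2 * B t y (l * exp (- (t / 2) * h))"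
        using main(2)[OF t l(1-3) xy(2)] xy(1) by (simp add: A2_def mult.assoc)
      with lo show ?thesis by blast
    next
      case False
      then have y0: "y = 0" by (simp add: y_def)
      have "1 / A * (l * exp (- 2 * t * h)) \<le> p t x \<and> p t x \<le> A * (l * exp (- (t / 2) * h))"
        using t0 \<Lambda>(1) x\<Lambda>
      proof (cases rule: sigma_phi_cases)
        case (1 u)
        have hu: "h = H u" using 1 by (simp add: h_def H_phi_eq)
        have "\<phi>' u < \<phi>' l" using False 1 t0 by simp
        then have lu: "l \<le> u" using \<phi>'_antimono[OF 1(1), of l] by (cases "l \<le> u") auto
        have "p t x \<le> 2 * C * l * exp (- (t / 2) * h)"
          using C(3)[OF l(1,2) f[unfolded l(3)] 1(1)] 1(3) l(3) by (simp add: hu)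
        also have "\<dots> = 2 * C * (l * exp (- (t / 2) * h))" by simp
        also have "\<dots> \<le> A * (l * exp (- (t / 2) * h))" using A l by (intro mult_right_mono) auto
        finally have up: "p t x \<le> A * (l * exp (- (t / 2) * h))" .
        have tHu: "1 \<le> t * H u" using lu l t0 tH mult_left_mono[OF H_mono[of l u], of t] by simp
        have "1 / A * (l * exp (- 2 * t * h)) \<le> p t x"
        proof (cases "N0 \<le> t * H u")
          case True
          have "1 / A * (l * exp (- 2 * t * h)) \<le> c3 * (u * exp (- 2 * (t * h)))"
            using Ac lu l c3 by (intro mult_mono) auto
          also have "\<dots> \<le> p t x" using c3(2)[OF 1(1,2) t0 True f] 1(3) by (simp add: hu mult.assoc)
          finally show ?thesis .
        next
          case False
          have "l * exp (- 2 * t * h) \<le> u * 1"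
            using lu l tHu by (intro mult_mono) (auto simp: hu)
          then have "1 / A * (l * exp (- 2 * t * h)) \<le> c * u"
            using Ac l c by (intro mult_mono) auto
          also have "\<dots> \<le> p t (t * \<phi>' u + 0)" using 1 tHu False by (intro c(2) f) auto
          finally show ?thesis using 1(3) by simp
        qed
        with up show ?thesis by blast
      next
        case 2
        \<comment> \<open>The default value of \<sigma> would put \<open>x\<close> at or beyond
          \<open>t * \<phi>' l\<close>.\<close>
        then show ?thesis using False l by blast
      qed
      moreover have "1 / A2 * (l * exp (- 2 * t * h)) \<le> 1 / A * (l * exp (- 2 * t * h))"
        using A A2 l by (intro mult_right_mono frac_le) auto
      moreover have "A * (l * exp (- (t / 2) * h)) \<le> A2 * (l * exp (- (t / 2) * h))"
        using A2 l by (intro mult_right_mono) auto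
      ultimately show ?thesis unfolding y0 B_def by simp
    qed
    then show "ereal (1 / A2) * min (ereal (H_phi_inv \<nu> (1 / t) * exp (- 2 * t * H_phi \<nu> (sigma_phi \<nu> t x))))
                            (ereal t * nu_ext \<nu> (max (x - t * b_phi \<nu> t) 0)) \<le> ereal (p t x) \<and>
       ereal (p t x) \<le> ereal A2 * min (ereal (H_phi_inv \<nu> (1 / t) * exp (- (t / 2) * H_phi \<nu> (sigma_phi \<nu> t x))))
                            (ereal t * nu_ext \<nu> (max (x - t * b_phi \<nu> t) 0))"
      unfolding min_nu_ext[OF t0] l(4,5) h_def[symmetric] y_def[symmetric] B_def[symmetric] times_ereal.simps ereal_less_eq .
  qed
qed

end

section \<open>Transfer to the subordinator\<close>

lemma (in levy_nu) laplace_law_driftless_subordinator: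
  assumes S: "driftless_subordinator M S \<nu>" and t: "0 < t"
  shows "laplace_law (jumps \<nu> t) (distr M borel (S t))"
proof -
  have levy_S: "levy_process M S" and mono: "AE \<omega> in M. mono_on {0..} (\<lambda>t. S t \<omega>)"
    and lap: "\<And>u. 0 \<le> u \<Longrightarrow> (LINT \<omega>|M. exp (- u * S t \<omega>)) = exp (- t * laplace_exponent \<nu> u)"
    using S t by (auto simp: driftless_subordinator_def subordinator_def)
  interpret prob_space M using levy_S by (simp add: levy_process_def)
  have [measurable]: "S t \<in> borel_measurable M" using levy_S t by (simp add: levy_process_def)
  have "AE \<omega> in M. S 0 \<omega> = 0" using levy_S by (simp add: levy_process_def)
  with mono have nonneg: "AE \<omega> in M. 0 \<le> S t \<omega>"
  proof eventually_elim
    case (elim \<omega>)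
    then have "S 0 \<omega> \<le> S t \<omega>" using t by (intro mono_onD[of "{0..}" "\<lambda>t. S t \<omega>"]) auto
    then show ?case using elim by simp
  qed
  show ?thesis
    unfolding laplace_law_def
  proof (intro conjI allI impI)
    show "real_distribution (distr M borel (S t))" by simp
    show "AE x in distr M borel (S t). 0 \<le> x" using nonneg by (simp add: AE_distr_iff)
    fix u :: real assume u: "0 \<le> u"
    have "(LINT x|distr M borel (S t). exp (- u * x)) = (LINT \<omega>|M. exp (- u * S t \<omega>))"
      by (rule integral_distr) auto
    also have "\<dots> = exp (- (LINT s|jumps \<nu> t. 1 - exp (- u * s)))"
      unfolding laplace_exponent_jumps[OF t] lap[OF u] laplace_exponent_eq by simp
    finally show "(LINT x|distr M borel (S t). exp (- u * x)) = exp (- (LINT s|jumps \<nu> t. 1 - exp (- u * s)))" .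
  qed
qed

lemma cont_density_of_continuous_bounded_density:
  assumes "continuous_bounded_density M X f"
  shows "cont_density (distr M borel X) f"
proof -
  have "distr M borel X = distr M lborel X" by (rule distr_cong) auto
  then show ?thesis
    using assms by (auto simp: continuous_bounded_density_def cont_density_def distributed_def)
qed

text \<open>For \<open>R2 < R3\<close> a reference point \<open>R\<close> is placed strictly between
  them: up to \<delta> the singularity gives \<open>c0 / \<delta>\<close>, beyond \<delta> the power
  bound compares \<open>\<nu> s\<close> with \<open>\<nu> R\<close>. For \<open>R3 \<le> R2\<close>
  that bound does not reach up to \<open>R2\<close>, and the floor is the assumption
  \<open>gap\<close>.\<close>

lemma levy_density_bounded_below:
  fixes \<nu> :: "real \<Rightarrow> real"
  assumes \<delta>: "0 < \<delta>" "0 < c0" "\<And>s. 0 < s \<Longrightarrow> s \<le> \<delta> \<Longrightarrow> c0 \<le> s * \<nu> s"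
    and R: "0 < R2" "0 < R3" and a: "0 < a8" "0 < a9"
    and pos: "\<And>r. 0 < r \<Longrightarrow> r < R3 \<Longrightarrow> 0 < \<nu> r"
    and small: "\<And>r R. 0 < r \<Longrightarrow> r \<le> R \<Longrightarrow> R < R3 \<Longrightarrow> a8 * (R / r) powr (- a9) \<le> \<nu> r / \<nu> R"
    and gap: "R3 \<le> R2 \<Longrightarrow> \<exists>\<epsilon>>0. \<forall>r. 0 < r \<and> r \<le> R2 \<longrightarrow> \<epsilon> \<le> \<nu> r"
  obtains \<epsilon> where "0 < \<epsilon>" "\<And>s. 0 < s \<Longrightarrow> s \<le> R2 \<Longrightarrow> \<epsilon> \<le> \<nu> s"
proof (cases "R3 \<le> R2")
  case True
  then show ?thesis using gap that by blast
next
  case False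
  define R where "R = (R2 + R3) / 2"
  have R': "R2 < R" "R < R3" "0 < R" using False R by (auto simp: R_def)
  have nR: "0 < \<nu> R" using R' by (intro pos) auto
  define e where "e = min (c0 / \<delta>) (a8 * (R / \<delta>) powr (- a9) * \<nu> R)"
  show ?thesis
  proof (rule that[of e])
    show "0 < e" using \<delta> a nR R' by (simp add: e_def)
    fix s assume s: "0 < s" "s \<le> R2"
    show "e \<le> \<nu> s"
    proof (cases "s \<le> \<delta>")
      case True
      have "c0 / \<delta> \<le> c0 / s" using True s \<delta> by (intro divide_left_mono) auto
      also have "\<dots> \<le> \<nu> s" using \<delta>(3)[OF s(1) True] s by (simp add: pos_divide_le_eq mult.commute)
      finally show ?thesis by (simp add: e_def)
    next
      case False
      have "(R / \<delta>) powr (- a9) \<le> (R / s) powr (- a9)"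
        using False s \<delta> R' a by (intro powr_mono2') (auto simp: frac_le)
      then have "a8 * (R / \<delta>) powr (- a9) \<le> a8 * (R / s) powr (- a9)" using a by (intro mult_left_mono) auto
      also have "\<dots> \<le> \<nu> s / \<nu> R" using s R' by (intro small) auto
      finally have "a8 * (R / \<delta>) powr (- a9) * \<nu> R \<le> \<nu> s" using nR by (simp add: pos_le_divide_eq)
      then show ?thesis by (simp add: e_def)
    qed
  qed
qed

theorem corollary1p8:
  fixes M :: "'a measure" and S :: "real \<Rightarrow> 'a \<Rightarrow> real"
    and \<nu> :: "real \<Rightarrow> real" and p :: "real \<Rightarrow> real \<Rightarrow> real"
    and T\<^sub>0 R\<^sub>2 R\<^sub>3 a\<^sub>6 a\<^sub>7 a\<^sub>8 a\<^sub>9 \<alpha>\<^sub>3 \<alpha>\<^sub>4 :: real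
  assumes S: "driftless_subordinator M S \<nu>"
    and T0: "0 \<le> T\<^sub>0" "Liminf (at_right 0) (\<lambda>x. ereal (x * \<nu> x)) = 1 / ereal T\<^sub>0"
    and p: "\<And>t. T\<^sub>0 < t \<Longrightarrow> continuous_bounded_density M (S t) (p t)"
    and R: "0 < R\<^sub>2" "0 < R\<^sub>3"
    and a: "0 < a\<^sub>6" "0 < a\<^sub>7" "0 < a\<^sub>8" "0 < a\<^sub>9"
    and \<alpha>: "\<alpha>\<^sub>4 < 2" "\<alpha>\<^sub>3 \<le> \<alpha>\<^sub>4" "0 < \<alpha>\<^sub>3"
    and pos: "\<And>r. R\<^sub>2 \<le> r \<Longrightarrow> 0 < \<nu> r" "\<And>r. 0 < r \<Longrightarrow> r < R\<^sub>3 \<Longrightarrow> 0 < \<nu> r"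
    and large: "\<And>r R. R\<^sub>2 \<le> r \<Longrightarrow> r \<le> R \<Longrightarrow>
        a\<^sub>6 * (R / r) powr (1 + \<alpha>\<^sub>3) \<le> \<nu> r / \<nu> R \<and> \<nu> r / \<nu> R \<le> a\<^sub>7 * (R / r) powr (1 + \<alpha>\<^sub>4)"
    and small: "\<And>r R. 0 < r \<Longrightarrow> r \<le> R \<Longrightarrow> R < R\<^sub>3 \<Longrightarrow> a\<^sub>8 * (R / r) powr (- a\<^sub>9) \<le> \<nu> r / \<nu> R"
    and gap: "R\<^sub>3 \<le> R\<^sub>2 \<Longrightarrow> \<exists>\<epsilon>>0. \<forall>r. 0 < r \<and> r \<le> R\<^sub>2 \<longrightarrow> \<epsilon> \<le> \<nu> r"
  shows
    "(\<exists>T\<^sub>1>T\<^sub>0. \<exists>c\<^sub>1>1.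
       (\<forall>t\<ge>T\<^sub>1. \<forall>y\<ge>0.
          ereal (1 / c\<^sub>1) * min (ereal (H_phi_inv \<nu> (1 / t))) (ereal t * nu_ext \<nu> y)
            \<le> ereal (p t (t * b_phi \<nu> t + y)) \<and>
          ereal (p t (t * b_phi \<nu> t + y))
            \<le> ereal c\<^sub>1 * min (ereal (H_phi_inv \<nu> (1 / t))) (ereal t * nu_ext \<nu> y)) \<and>
       (\<exists>c\<^sub>2>1. \<forall>t\<ge>T\<^sub>1. \<forall>x\<ge>t * b_phi \<nu> T\<^sub>1.
          ereal (1 / c\<^sub>2) * min (ereal (H_phi_inv \<nu> (1 / t) * exp (- 2 * t * H_phi \<nu> (sigma_phi \<nu> t x))))
                              (ereal t * nu_ext \<nu> (max (x - t * b_phi \<nu> t) 0))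
            \<le> ereal (p t x) \<and>
          ereal (p t x)
            \<le> ereal c\<^sub>2 * min (ereal (H_phi_inv \<nu> (1 / t) * exp (- (t / 2) * H_phi \<nu> (sigma_phi \<nu> t x))))
                              (ereal t * nu_ext \<nu> (max (x - t * b_phi \<nu> t) 0)))) \<and>
     (T\<^sub>0 = 0 \<longrightarrow> (\<forall>T>0. \<exists>c\<^sub>1>1. \<exists>c\<^sub>2>1.
       (\<forall>t\<ge>T. \<forall>y\<ge>0.
          ereal (1 / c\<^sub>1) * min (ereal (H_phi_inv \<nu> (1 / t))) (ereal t * nu_ext \<nu> y)
            \<le> ereal (p t (t * b_phi \<nu> t + y)) \<and>
          ereal (p t (t * b_phi \<nu> t + y))
            \<le> ereal c\<^sub>1 * min (ereal (H_phi_inv \<nu> (1 / t))) (ereal t * nu_ext \<nu> y)) \<and>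
       (\<forall>t\<ge>T. \<forall>x\<ge>t * b_phi \<nu> T.
          ereal (1 / c\<^sub>2) * min (ereal (H_phi_inv \<nu> (1 / t) * exp (- 2 * t * H_phi \<nu> (sigma_phi \<nu> t x))))
                              (ereal t * nu_ext \<nu> (max (x - t * b_phi \<nu> t) 0))
            \<le> ereal (p t x) \<and>
          ereal (p t x)
            \<le> ereal c\<^sub>2 * min (ereal (H_phi_inv \<nu> (1 / t) * exp (- (t / 2) * H_phi \<nu> (sigma_phi \<nu> t x))))
                              (ereal t * nu_ext \<nu> (max (x - t * b_phi \<nu> t) 0)))))"
proof -
  let ?claim = "\<lambda>T c\<^sub>1 c\<^sub>2. (\<forall>t\<ge>T. \<forall>y\<ge>0.
          ereal (1 / c\<^sub>1) * min (ereal (H_phi_inv \<nu> (1 / t))) (ereal t * nu_ext \<nu> y)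
            \<le> ereal (p t (t * b_phi \<nu> t + y)) \<and>
          ereal (p t (t * b_phi \<nu> t + y))
            \<le> ereal c\<^sub>1 * min (ereal (H_phi_inv \<nu> (1 / t))) (ereal t * nu_ext \<nu> y)) \<and>
       (\<forall>t\<ge>T. \<forall>x\<ge>t * b_phi \<nu> T.
          ereal (1 / c\<^sub>2) * min (ereal (H_phi_inv \<nu> (1 / t) * exp (- 2 * t * H_phi \<nu> (sigma_phi \<nu> t x))))
                              (ereal t * nu_ext \<nu> (max (x - t * b_phi \<nu> t) 0))
            \<le> ereal (p t x) \<and>
          ereal (p t x)
            \<le> ereal c\<^sub>2 * min (ereal (H_phi_inv \<nu> (1 / t) * exp (- (t / 2) * H_phi \<nu> (sigma_phi \<nu> t x))))
                              (ereal t * nu_ext \<nu> (max (x - t * b_phi \<nu> t) 0)))"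
  have levy: "levy_density \<nu>" using S by (simp add: driftless_subordinator_def)
  have bounds: "\<exists>c\<^sub>1>1. \<exists>c\<^sub>2>1. ?claim T c\<^sub>1 c\<^sub>2"
    if T\<^sub>0_less: "T\<^sub>0 < T" and c: "0 < c" "8 \<le> c * T" "ereal c < 1 / ereal T\<^sub>0" for T c
  proof -
    have "eventually (\<lambda>x. ereal c < ereal (x * \<nu> x)) (at_right 0)"
      using c(3) T0(2) by (intro less_LiminfD) simp
    then obtain d where d: "0 < d" "\<And>x. 0 < x \<Longrightarrow> x < d \<Longrightarrow> c < x * \<nu> x"
      by (auto simp: eventually_at_right_field)
    \<comment> \<open>Halving turns the open range of the limit inferior into a closed one.\<close>
    define \<delta> where "\<delta> = d / 2"
    have \<delta>: "0 < \<delta>" "\<And>s. 0 < s \<Longrightarrow> s \<le> \<delta> \<Longrightarrow> c \<le> s * \<nu> s"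
      using d by (auto simp: \<delta>_def intro!: less_imp_le)
    obtain \<epsilon> where \<epsilon>: "0 < \<epsilon>" "\<And>s. 0 < s \<Longrightarrow> s \<le> R\<^sub>2 \<Longrightarrow> \<epsilon> \<le> \<nu> s"
      using levy_density_bounded_below[OF \<delta>(1) c(1) \<delta>(2) R a(3,4) pos(2) small gap] by blast
    interpret levy_nu_scaling \<nu> c \<delta> R\<^sub>2 \<epsilon> a\<^sub>6 a\<^sub>7 \<alpha>\<^sub>3 \<alpha>\<^sub>4
      by unfold_locales (use levy c \<delta> R \<epsilon> a \<alpha> pos large in auto)
    have T': "0 < T" using T\<^sub>0_less T0 by linarith
    obtain \<Lambda> where \<Lambda>': "0 < \<Lambda>" "H \<Lambda> = 1 / T" using H_surj[of "1 / T"] T' by auto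
    interpret levy_nu_laws \<nu> c \<delta> R\<^sub>2 \<epsilon> a\<^sub>6 a\<^sub>7 \<alpha>\<^sub>3 \<alpha>\<^sub>4 "\<lambda>t. distr M borel (S t)" T \<Lambda>
      by unfold_locales (use laplace_law_driftless_subordinator[OF S] T' c \<Lambda>' in auto)
    have dens: "cont_density (distr M borel (S t)) (p t)" if "T \<le> t" for t
      using that T\<^sub>0_less by (intro cont_density_of_continuous_bounded_density p) auto
    obtain c\<^sub>1 c\<^sub>2 where "1 < c\<^sub>1" "1 < c\<^sub>2" "?claim T c\<^sub>1 c\<^sub>2"
      by (rule density_bounds[OF \<Lambda>'(2) dens]) blast+
    then show ?thesis by blast
  qed
  have T1: "\<exists>T>T\<^sub>0. \<exists>c. 0 < c \<and> 8 \<le> c * T \<and> ereal c < 1 / ereal T\<^sub>0"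
  proof (cases "T\<^sub>0 = 0")
    case True
    then show ?thesis by (intro exI[of _ 8] conjI exI[of _ 1]) (auto simp: divide_ereal_def)
  next
    case False
    then have "0 < T\<^sub>0" using T0 by simp
    then show ?thesis
      \<comment> \<open>\<open>c\<close> is half the limit inferior, strictly below it, and with
        \<open>16 * T\<^sub>0\<close> the product is exactly 8.\<close>
      by (intro exI[of _ "16 * T\<^sub>0"] conjI exI[of _ "1 / (2 * T\<^sub>0)"]) (auto simp: divide_ereal_def field_simps)
  qed
  then obtain T\<^sub>1 c where "T\<^sub>0 < T\<^sub>1" "0 < c" "8 \<le> c * T\<^sub>1" "ereal c < 1 / ereal T\<^sub>0" by blast
  then have first: "\<exists>T\<^sub>1>T\<^sub>0. \<exists>c\<^sub>1>1. \<exists>c\<^sub>2>1. ?claim T\<^sub>1 c\<^sub>1 c\<^sub>2" using bounds by blast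
  \<comment> \<open>With an infinite limit inferior every real \<open>c\<close> is admissible, so
    \<open>8 / T\<close> serves an arbitrarily small \<open>T\<close>.\<close>
  have second: "\<exists>c\<^sub>1>1. \<exists>c\<^sub>2>1. ?claim T c\<^sub>1 c\<^sub>2" if "T\<^sub>0 = 0" "0 < T" for T
    using that by (intro bounds[of T "8 / T"]) (auto simp: divide_ereal_def)
  show ?thesis
  proof (rule conjI)
    from first show "\<exists>T\<^sub>1>T\<^sub>0. \<exists>c\<^sub>1>1.
       (\<forall>t\<ge>T\<^sub>1. \<forall>y\<ge>0.
          ereal (1 / c\<^sub>1) * min (ereal (H_phi_inv \<nu> (1 / t))) (ereal t * nu_ext \<nu> y)
            \<le> ereal (p t (t * b_phi \<nu> t + y)) \<and>
          ereal (p t (t * b_phi \<nu> t + y))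
            \<le> ereal c\<^sub>1 * min (ereal (H_phi_inv \<nu> (1 / t))) (ereal t * nu_ext \<nu> y)) \<and>
       (\<exists>c\<^sub>2>1. \<forall>t\<ge>T\<^sub>1. \<forall>x\<ge>t * b_phi \<nu> T\<^sub>1.
          ereal (1 / c\<^sub>2) * min (ereal (H_phi_inv \<nu> (1 / t) * exp (- 2 * t * H_phi \<nu> (sigma_phi \<nu> t x))))
                              (ereal t * nu_ext \<nu> (max (x - t * b_phi \<nu> t) 0))
            \<le> ereal (p t x) \<and>
          ereal (p t x)
            \<le> ereal c\<^sub>2 * min (ereal (H_phi_inv \<nu> (1 / t) * exp (- (t / 2) * H_phi \<nu> (sigma_phi \<nu> t x))))
                              (ereal t * nu_ext \<nu> (max (x - t * b_phi \<nu> t) 0)))"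
      by (elim exE conjE) (intro exI conjI; assumption)
  qed (use second in blast)
qed

end
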